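(* Let $\epsilon>0$ be fixed. Let $q$ be a large integer and let $N = q^\theta$ with $\theta < 1-\epsilon$ and $4\sqrt{\log q \log\log q}\, \log\log\log q < \log N$. Then \[\Delta(N,q) \geq \sqrt{N}\exp\left((1 + o(1)) \sqrt{\frac{(1-\theta)\log q}{\log\log q}}\right).\] If in addition $q$ is prime, then \[\Delta\!\left(\frac{q}{N}, q\right) \geq \sqrt{\frac{q}{N}} \exp\left((1 + o(1))\sqrt{\frac{(1-\theta)\log q}{2\log\log q}}\right).\] Here $o(1)$ denotes quantities tending to $0$ as $q\to\infty$.
   Context: For a positive integer $q$ and real $N\ge 1$, $\Delta(N,q) = \sup_{\chi \neq \chi_0 \bmod q} \left| \sum_{n \leq N}\chi(n)\right|$, the supremum over non-principal Dirichlet characters $\chi$ modulo $q$. *)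

theory Defs
  imports "HOL-Analysis.Analysis"
begin

definition dirichlet_char :: "nat \<Rightarrow> (nat \<Rightarrow> complex) \<Rightarrow> bool" where
  "dirichlet_char q chi \<longleftrightarrow>
     q \<ge> 1 \<and> chi 1 = 1 \<and>
     (\<forall>m n. chi (m * n) = chi m * chi n) \<and>
     (\<forall>n. chi (n + q) = chi n) \<and>
     (\<forall>n. chi n = 0 \<longleftrightarrow> \<not> coprime n q)"

definition principal_char :: "nat \<Rightarrow> nat \<Rightarrow> complex" where
  "principal_char q n = (if coprime n q then 1 else 0)"

definition Delta :: "real \<Rightarrow> nat \<Rightarrow> real" where
  "Delta N q = Sup {cmod (\<Sum>n\<in>{1..nat \<lfloor>N\<rfloor>}. chi n) | chi.
                     dirichlet_char q chi \<and> chi \<noteq> principal_char q}"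

end

theory Submission
  imports Defs "HOL-Number_Theory.Number_Theory" "HOL-Real_Asymp.Real_Asymp"
begin

text \<open>Resonance method. For a weight \<open>r\<close> on integers coprime to \<open>q\<close> put \<open>R(\<chi>) = \<Sum> r(n) \<chi>(n)\<close>. By
  orthogonality the second moment of \<open>S\<^sub>N(\<chi>) R(\<chi>)\<close> counts the solutions of \<open>m\<^sub>1 n\<^sub>1 = m\<^sub>2 n\<^sub>2\<close>, \<open>m\<^sub>i \<le> N\<close>, with weight
  \<open>r(n\<^sub>1) r(n\<^sub>2)\<close>, so \<open>\<Delta>(N,q)\<^sup>2\<close> is at least the ratio of this count to \<open>\<Sum> r(n)\<^sup>2\<close>, up to the principal character.

  Take \<open>r(n) = n powr (-1/2)\<close> on products of primes with exactly \<open>k\<^sub>i\<close> of them in the block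
  \<open>(ln q) powr a\<^sub>i < p \<le> (ln q) powr a\<^sub>i\<^sub>+\<^sub>1\<close>, \<open>a\<^sub>i = (1 + \<eta>)^i\<close>. Prescribing the numbers \<open>k\<^sub>i\<close> bounds
  the size of \<open>n\<close> outright, so no Rankin-type truncation is needed, and only Mertens' first theorem is used
  about primes. Cutting the support according to \<open>\<lfloor>ln n\<rfloor>\<close> into at most \<open>ln q + 1\<close> pieces costs a power of \<open>ln q\<close> and makes
  all \<open>n\<close> comparable, which replaces the saddle point analysis.

  For prime \<open>q\<close> and length \<open>q/N\<close> one pairs \<open>S\<^sub>q\<^sub>/\<^sub>N(\<chi>)\<close> with the dual sum \<open>\<tau>(\<chi>) S\<^sub>H(cnj \<chi>)\<close>, \<open>H = N/18\<close>: comparability of the \<open>n\<close>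
  keeps the relevant frequencies below \<open>N/6\<close>, where the exponential sum has positive real part, and the
  remaining ones are negligible as long as \<open>n\<^sup>2\<close> is at most a constant times \<open>q/N\<close>. This is the source of the factor
  \<open>2\<close> in the second exponent.\<close>

section \<open>Primes\<close>

text \<open>Exchanging \<open>l\<close> of the \<open>k\<close> primes of a block gains
  \<open>(k choose l) * s ^ l / fact l\<close>, where \<open>s\<close> is the sum of
  \<open>1 / p\<close> over the block; near \<open>l = t = sqrt (k * s)\<close> this is about
  \<open>exp (2 * t)\<close>. A resonator of size at most \<open>X\<close> allows the blocks a total
  of \<open>k * a * ln (ln q) = t^2 * a * ln (ln q) / s\<close> up to \<open>ln X\<close>. By
  Cauchy-Schwarz the best \<open>t\<close> is proportional to \<open>s / a\<close>, and since the
  geometric series of the \<open>s / a\<close> tends to 1 with \<open>eta\<close>, the gain in the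
  second moment is about \<open>exp (2 * sqrt (ln X / ln (ln q)))\<close>. The principal character
  limits \<open>X\<close> to about \<open>q / N\<close> for short sums; for the dual sums
  \<open>X\<close> is about \<open>sqrt (q / N)\<close>. The exchanged primes have a product of size
  \<open>exp (c * sqrt (ln q * ln (ln q)))\<close>, and \<open>N\<close> has to exceed it. The
  constant \<open>c\<close> depends on the permitted loss, and the triple logarithm in the lower
  bound for \<open>ln N\<close> outgrows it. The blocks begin above \<open>ln q\<close>, where the
  primes dividing \<open>q\<close> and those already used carry a negligible part of the sum of
  \<open>1 / p\<close>.\<close>

lemma prod_primes_dvd:
  fixes n :: nat
  assumes "finite S" "\<And>p. p \<in> S \<Longrightarrow> prime p \<and> p dvd n"
  shows "\<Prod>S dvd n"
  using assms
proof (induction S rule: finite_induct)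
  case (insert p S)
  have "coprime p (\<Prod>S)"
    using insert by (intro prod_coprime_right) (metis insertCI primes_coprime)
  then show ?case
    using insert by (simp add: divides_mult)
qed simp

lemma finite_primes_le: "finite {p::nat. prime p \<and> real p \<le> x}"
  by (rule finite_subset[of _ "{..nat \<lfloor>x\<rfloor>}"]) (auto simp: le_nat_floor)

text \<open>Chebyshev's bound by the argument of Erdos: for odd \<open>n = 2 * m + 1\<close> the
  primes in \<open>(m + 1, n]\<close> divide \<open>n choose m\<close>, which is at most
  \<open>4 ^ m\<close>. The primes up to \<open>m + 1\<close> are left to the induction, and an even
  \<open>n > 2\<close> is not prime.\<close>

lemma sum_ln_primes_le: "(\<Sum>p | prime p \<and> p \<le> n. ln (real p)) \<le> ln 4 * real n"
proof (induction n rule: less_induct)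
  case (less n)
  consider "n \<le> 1" | "n = 2" | "n > 2" "even n" | "n > 2" "odd n" by linarith
  then show ?case
  proof cases
    case 1
    then have "{p. prime p \<and> p \<le> n} = {}"
      by (auto dest: prime_gt_1_nat)
    then show ?thesis by (simp only: sum.empty) simp
  next
    case 2
    then have "{p. prime p \<and> p \<le> n} = {2}"
      by (auto dest: prime_ge_2_nat)
    then have "(\<Sum>p | prime p \<and> p \<le> n. ln (real p)) = ln 2" using 2 by simp
    moreover have "ln 2 \<le> ln (4::real)" "ln (4::real) \<ge> 0" by simp_all
    ultimately show ?thesis using 2 by (simp only: of_nat_numeral)
  next
    case 3
    then have "\<not> prime n" using prime_odd_nat by blast
    then have "{p. prime p \<and> p \<le> n} = {p. prime p \<and> p \<le> n - 1}"
      using 3 by (auto simp: le_less)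
    then have "(\<Sum>p | prime p \<and> p \<le> n. ln (real p)) \<le> ln 4 * real (n - 1)"
      using less[of "n - 1"] 3 by simp
    also have "\<dots> \<le> ln 4 * real n" by (intro mult_left_mono) auto
    finally show ?thesis .
  next
    case 4
    then obtain m where n: "n = 2 * m + 1" by (elim oddE)
    with 4 have m: "m \<ge> 1" by simp
    define S where "S = {p. prime p \<and> m + 1 < p \<and> p \<le> n}"
    have fin: "finite S" unfolding S_def by (rule finite_subset[of _ "{..n}"]) auto
    have "\<Prod>S dvd n choose m"
    proof (rule prod_primes_dvd[OF fin])
      fix p assume "p \<in> S"
      then have p: "prime p" "m + 1 < p" "p \<le> n" by (auto simp: S_def)
      have "p dvd fact n" using p prime_dvd_fact_iff by blast
      also have "(fact n :: nat) = fact m * fact (n - m) * (n choose m)"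
        using binomial_fact_lemma[of m n] n by simp
      finally have "p dvd fact m \<or> p dvd fact (n - m) \<or> p dvd n choose m"
        using p(1) prime_dvd_mult_iff by blast
      moreover have "n - m = m + 1" using n by simp
      ultimately show "prime p \<and> p dvd n choose m"
        using p prime_dvd_fact_iff[of p m] prime_dvd_fact_iff[of p "m+1"] by auto
    qed
    then have "\<Prod>S \<le> n choose m" using n by (intro dvd_imp_le) auto
    \<comment> \<open>For odd \<open>n\<close> the middle coefficient occurs twice in its row; the
      factor 2 saved here lets the induction close without loss.\<close>
    moreover have "n choose m \<le> 4 ^ m"
    proof -
      have "(n choose m) + (n choose (m+1)) = (\<Sum>k\<in>{m, m+1}. n choose k)" by simp
      also have "\<dots> \<le> (\<Sum>k\<le>n. n choose k)" using n by (intro sum_mono2) auto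
      also have "\<dots> = 2 ^ n" by (rule choose_row_sum)
      also have "\<dots> = 2 * 4 ^ m" using n by (simp add: power_mult)
      finally show ?thesis
        using binomial_symmetric[of m n] n by simp
    qed
    ultimately have "\<Prod>S \<le> 4 ^ m" by linarith
    then have "real (\<Prod>S) \<le> real (4 ^ m)" using of_nat_le_iff by blast
    moreover have pos: "real (\<Prod>S) > 0"
      using fin by (auto simp: S_def prime_gt_0_nat intro!: prod_pos)
    ultimately have "ln (real (\<Prod>S)) \<le> ln (4 ^ m)" by simp
    moreover have "ln (real (\<Prod>S)) = (\<Sum>p\<in>S. ln (real p))"
      unfolding of_nat_prod using fin by (subst ln_prod) (auto simp: S_def prime_gt_0_nat)
    ultimately have S: "(\<Sum>p\<in>S. ln (real p)) \<le> ln 4 * real m"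
      by (simp add: ln_realpow mult.commute)
    have "{p. prime p \<and> p \<le> n} = {p. prime p \<and> p \<le> m + 1} \<union> S"
      using n by (auto simp: S_def)
    moreover have "finite {p. prime p \<and> p \<le> m + 1}"
      by (rule finite_subset[of _ "{..m+1}"]) auto
    ultimately have "(\<Sum>p | prime p \<and> p \<le> n. ln (real p))
        = (\<Sum>p | prime p \<and> p \<le> m + 1. ln (real p)) + (\<Sum>p\<in>S. ln (real p))"
      using fin by (simp add: sum.union_disjoint S_def disjoint_iff)
    also have "\<dots> \<le> ln 4 * real (m + 1) + ln 4 * real m"
      using less[of "m + 1"] n m S by simp
    also have "\<dots> = ln 4 * real n" using n by (simp add: algebra_simps)
    finally show ?thesis .
  qed
qed

section \<open>Mertens' first theorem\<close>

lemma ln_fact_ge: "real n * ln (real n) - real n \<le> ln (fact n)"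
proof (induction n)
  case (Suc n)
  show ?case
  proof (cases "n = 0")
    case False
    then have n: "real n > 0" by simp
    have "ln (1 + 1 / real n) \<le> 1 / real n" using n by (intro ln_add_one_self_le_self) auto
    then have "real n * ln (1 + 1 / real n) \<le> 1" using n by (simp add: field_simps)
    moreover have "1 + 1 / real n = real (Suc n) / real n" using n by (simp add: field_simps)
    ultimately have "real n * (ln (real (Suc n)) - ln (real n)) \<le> 1"
      using n by (simp add: ln_div)
    then show ?thesis using Suc
      by (simp add: ln_mult algebra_simps del: of_nat_Suc) (simp add: algebra_simps)
  qed simp
qed simp

text \<open>From \<open>n\<close> to \<open>Suc n\<close> the quotient \<open>n div d\<close> grows
  by one exactly for the divisors \<open>d\<close> of \<open>Suc n\<close>, whose von Mangoldt
  values add up to \<open>ln (Suc n)\<close>.\<close>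

lemma sum_mangoldt_div: "(\<Sum>d=1..n. mangoldt d * real (n div d)) = ln (fact n)"
proof (induction n)
  case (Suc n)
  have div: "Suc n div d = n div d + (if d dvd Suc n then 1 else 0)" if "d \<ge> 1" for d
    using that by (simp add: div_Suc dvd_eq_mod_eq_0)
  have "(\<Sum>d=1..Suc n. mangoldt d * real (Suc n div d))
      = (\<Sum>d=1..Suc n. mangoldt d * real (n div d) + (if d dvd Suc n then mangoldt d else 0))"
    by (intro sum.cong) (auto simp: div algebra_simps)
  also have "\<dots> = (\<Sum>d=1..Suc n. mangoldt d * real (n div d))
      + (\<Sum>d=1..Suc n. if d dvd Suc n then mangoldt d else 0)"
    by (simp add: sum.distrib)
  also have "(\<Sum>d=1..Suc n. mangoldt d * real (n div d)) = ln (fact n)"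
    using Suc by simp
  also have "(\<Sum>d=1..Suc n. if d dvd Suc n then mangoldt d else 0)
      = (\<Sum>d | d dvd Suc n. mangoldt d :: real)"
    by (rule sum.mono_neutral_cong_right)
       (auto dest: dvd_imp_le simp: Suc_le_eq intro!: Nat.gr0I)
  also have "\<dots> = ln (real (Suc n))" by (subst mangoldt_sum) auto
  finally show ?case by (simp add: ln_mult del: of_nat_Suc)
qed simp

text \<open>For fixed \<open>p\<close> the exponents from 2 on form a geometric series of size at
  most \<open>2 * ln p / p^2\<close>, and \<open>ln p \<le> 2 * sqrt p\<close> turns this into a
  summable majorant.\<close>

lemma sum_mangoldt_nonprime_bounded:
  "\<exists>C>0. \<forall>n::nat. (\<Sum>d | d \<in> {1..n} \<and> \<not> prime d. mangoldt d / real d) \<le> C"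
proof -
  have summ: "summable (\<lambda>p. 4 * real p powr (-3/2))"
    by (intro summable_mult) (simp add: summable_real_powr_iff)
  define C where "C = (\<Sum>p. 4 * real p powr (-3/2)) + 1"
  have "C > 0" unfolding C_def using suminf_nonneg[OF summ] by simp
  moreover have "(\<Sum>d | d \<in> {1..n} \<and> \<not> prime d. mangoldt d / real d) \<le> C" for n
  proof -
    define P where "P = {p. prime p \<and> p \<le> n}"
    have finP: "finite P" unfolding P_def by (rule finite_subset[of _ "{..n}"]) auto
    have "(\<Sum>d | d \<in> {1..n} \<and> \<not> prime d. mangoldt d / real d)
        = (\<Sum>d | d \<in> {1..n} \<and> \<not> prime d \<and> primepow d. mangoldt d / real d)"
      by (rule sum.mono_neutral_right) (auto simp: mangoldt_def)
    also have "\<dots> \<le> (\<Sum>d\<in>(\<lambda>(p,k). p ^ k) ` (P \<times> {2..n}). mangoldt d / real d)"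
    proof (rule sum_mono2)
      show "{d. d \<in> {1..n} \<and> \<not> prime d \<and> primepow d} \<subseteq> (\<lambda>(p,k). p ^ k) ` (P \<times> {2..n})"
      proof
        fix d assume "d \<in> {d. d \<in> {1..n} \<and> \<not> prime d \<and> primepow d}"
        then obtain p k where d: "d \<le> n" "\<not> prime d" "prime p" "k > 0" "d = p ^ k"
          unfolding primepow_def by auto
        have "k \<noteq> 1" using d by auto
        moreover have "k \<le> n"
          using d(1,5) less_exp[of k] power_mono[of 2 p k] prime_ge_2_nat[OF d(3)] by linarith
        moreover have "p \<le> n" using d dvd_imp_le[of p d] prime_gt_0_nat[OF d(3)]
          by (metis dvd_power le_trans zero_less_power)
        ultimately have "(p, k) \<in> P \<times> {2..n}" using d by (auto simp: P_def)
        then show "d \<in> (\<lambda>(p,k). p ^ k) ` (P \<times> {2..n})" using d by (auto intro!: image_eqI[of _ _ "(p,k)"])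
      qed
    qed (use finP in \<open>auto simp: mangoldt_nonneg\<close>)
    also have "\<dots> \<le> (\<Sum>(p,k)\<in>P \<times> {2..n}. mangoldt (p ^ k) / real (p ^ k))"
      using finP sum_image_le[of "P \<times> {2..n}" "\<lambda>d. mangoldt d / real d" "\<lambda>(p,k). p ^ k"]
      by (auto simp: mangoldt_nonneg case_prod_unfold o_def)
    also have "\<dots> = (\<Sum>p\<in>P. \<Sum>k\<in>{2..n}. mangoldt (p ^ k) / real (p ^ k))"
      by (rule sum.cartesian_product[symmetric])
    also have "\<dots> \<le> (\<Sum>p\<in>P. 4 * real p powr (-3/2))"
    proof (rule sum_mono)
      fix p assume "p \<in> P"
      then have p: "prime p" by (simp add: P_def)
      then have p2: "real p \<ge> 2" using prime_ge_2_nat by force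
      define x where "x = 1 / real p"
      have x: "0 < x" "x \<le> 1/2" using p2 by (auto simp: x_def field_simps)
      have "(\<Sum>k\<in>{2..n}. mangoldt (p ^ k) / real (p ^ k)) = (\<Sum>k\<in>{2..n}. ln (real p) * x ^ k)"
        by (intro sum.cong) (use p in \<open>auto simp: x_def power_one_over field_simps\<close>)
      also have "\<dots> = ln (real p) * (\<Sum>k\<in>{2..n}. x ^ k)" by (simp add: sum_distrib_left)
      also have "(\<Sum>k\<in>{2..n}. x ^ k) \<le> 2 * x\<^sup>2"
      proof (cases "n \<ge> 2")
        case True
        have "(\<Sum>k\<in>{2..n}. x ^ k) = (x ^ 2 - x ^ Suc n) / (1 - x)"
          using True x by (subst sum_gp) auto
        also have "\<dots> \<le> x\<^sup>2 / (1/2)"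
          using x by (intro frac_le) auto
        finally show ?thesis by simp
      qed auto
      also have "ln (real p) \<le> 2 * sqrt (real p)"
      proof -
        have "ln (real p) = 2 * ln (sqrt (real p))" using p2 by (simp add: ln_sqrt)
        also have "\<dots> \<le> 2 * sqrt (real p)"
          using ln_le_minus_one[of "sqrt (real p)"] p2 by simp
        finally show ?thesis .
      qed
      also have "2 * sqrt (real p) * (2 * x\<^sup>2) = 4 * real p powr (-3/2)"
      proof -
        have "real p powr (-3/2) = real p powr (1/2) * real p powr (-2)"
          by (subst powr_add[symmetric]) simp
        also have "\<dots> = sqrt (real p) * x\<^sup>2"
          using p2 by (simp add: powr_half_sqrt x_def powr_minus_divide power_one_over)
        finally show ?thesis by simp
      qed
      finally show "(\<Sum>k\<in>{2..n}. mangoldt (p ^ k) / real (p ^ k)) \<le> 4 * real p powr (-3/2)"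
        using x p2 by (simp add: mult_right_mono)
    qed
    also have "\<dots> \<le> C"
      unfolding C_def using sum_le_suminf[OF summ finP] by auto
    finally show ?thesis .
  qed
  ultimately show ?thesis by blast
qed

text \<open>Both bounds read off \<open>ln (fact n)\<close> as a von Mangoldt sum. In one direction
  only the primes are kept, and the loss in \<open>n / p - 1 \<le> n div p\<close> is Chebyshev's
  sum. In the other \<open>n div d \<le> n / d\<close>, and the proper prime powers cost a
  constant.\<close>

lemma mertens_nat:
  "\<exists>C>0. \<forall>n\<ge>1. \<bar>(\<Sum>p | prime p \<and> p \<le> n. ln (real p) / real p) - ln (real n)\<bar> \<le> C"
proof -
  obtain C where C: "C > 0" "\<And>n. (\<Sum>d | d \<in> {1..n} \<and> \<not> prime d. mangoldt d / real d) \<le> C"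
    using sum_mangoldt_nonprime_bounded by blast
  have "\<bar>(\<Sum>p | prime p \<and> p \<le> n. ln (real p) / real p) - ln (real n)\<bar> \<le> C + 1 + ln 4"
    if n: "n \<ge> 1" for n
  proof -
    define P where "P = {p. prime p \<and> p \<le> n}"
    have P: "P = {d \<in> {1..n}. prime d}" by (auto simp: P_def Suc_le_eq prime_gt_0_nat)
    have finP: "finite P" by (simp add: P)
    let ?M = "\<Sum>p\<in>P. ln (real p) / real p"
    have "real n * ?M - (\<Sum>p\<in>P. ln (real p)) = (\<Sum>p\<in>P. ln (real p) * (real n / real p - 1))"
      by (simp add: sum_distrib_left sum_subtractf algebra_simps)
    also have "\<dots> \<le> (\<Sum>p\<in>P. mangoldt p * real (n div p))"
    proof (rule sum_mono)
      fix p assume p: "p \<in> P"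
      then have "real p > 0" by (simp add: P)
      have "\<lfloor>real n / real p\<rfloor> = int (n div p)" by (rule floor_divide_of_nat_eq)
      then have "real n / real p - 1 \<le> real (n div p)" by linarith
      then show "ln (real p) * (real n / real p - 1) \<le> mangoldt p * real (n div p)"
        using p by (auto simp: P intro!: mult_left_mono)
    qed
    also have "\<dots> \<le> (\<Sum>d=1..n. mangoldt d * real (n div d))"
      by (intro sum_mono2) (auto simp: P mangoldt_nonneg)
    also have "\<dots> = ln (fact n)" by (rule sum_mangoldt_div)
    also have "\<dots> \<le> ln (real n ^ n)"
      using fact_le_power[of n, where ?'a = real] n by (subst ln_le_cancel_iff) auto
    also have "\<dots> = real n * ln (real n)" using n by (simp add: ln_realpow)
    finally have "real n * ?M \<le> real n * (ln (real n) + ln 4)"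
      using sum_ln_primes_le[of n] by (simp add: P_def algebra_simps)
    then have up: "?M \<le> ln (real n) + ln 4"
      by (rule mult_left_le_imp_le) (use n in simp)
    have "real n * ln (real n) - real n \<le> (\<Sum>d=1..n. mangoldt d * real (n div d))"
      using ln_fact_ge[of n] by (simp only: sum_mangoldt_div)
    also have "\<dots> \<le> (\<Sum>d=1..n. real n * (mangoldt d / real d))"
    proof (rule sum_mono)
      fix d assume "d \<in> {1..n}"
      have "\<lfloor>real n / real d\<rfloor> = int (n div d)" by (rule floor_divide_of_nat_eq)
      then have "real (n div d) \<le> real n / real d" by linarith
      then have "mangoldt d * real (n div d) \<le> mangoldt d * (real n / real d)"
        by (intro mult_left_mono) (auto simp: mangoldt_nonneg)
      then show "mangoldt d * real (n div d) \<le> real n * (mangoldt d / real d)"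
        by (simp add: mult.commute)
    qed
    also have "\<dots> = real n * (\<Sum>d=1..n. mangoldt d / real d)" by (simp add: sum_distrib_left)
    also have "(\<Sum>d=1..n. mangoldt d / real d) = ?M + (\<Sum>d | d \<in> {1..n} \<and> \<not> prime d. mangoldt d / real d)"
    proof -
      have "(\<Sum>d=1..n. mangoldt d / real d)
          = (\<Sum>d\<in>{1..n} - P. mangoldt d / real d) + (\<Sum>d\<in>P. mangoldt d / real d)"
        by (rule sum.subset_diff) (auto simp: P)
      moreover have "{1..n} - P = {d. d \<in> {1..n} \<and> \<not> prime d}" by (auto simp: P)
      moreover have "(\<Sum>d\<in>P. mangoldt d / real d) = ?M" by (rule sum.cong) (auto simp: P)
      ultimately show ?thesis by (metis add.commute)
    qed
    also have "real n * (?M + (\<Sum>d | d \<in> {1..n} \<and> \<not> prime d. mangoldt d / real d)) \<le> real n * (?M + C)"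
      using C(2)[of n] by (intro mult_left_mono) auto
    finally have "real n * (ln (real n) - 1) \<le> real n * (?M + C)" by (simp add: algebra_simps)
    then have "ln (real n) - 1 \<le> ?M + C" using n by simp
    moreover have "ln (4::real) > 0" by simp
    ultimately show ?thesis using up C(1) unfolding P_def abs_le_iff by linarith
  qed
  moreover have "C + 1 + ln 4 > 0" using C(1) by (simp add: add_pos_pos)
  ultimately show ?thesis by blast
qed

lemma mertens:
  "\<exists>C>0. \<forall>x\<ge>1. \<bar>(\<Sum>p | prime p \<and> real p \<le> x. ln (real p) / real p) - ln x\<bar> \<le> C"
proof -
  obtain C where C: "C > 0"
    "\<And>n. n \<ge> 1 \<Longrightarrow> \<bar>(\<Sum>p | prime p \<and> p \<le> n. ln (real p) / real p) - ln (real n)\<bar> \<le> C"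
    using mertens_nat by blast
  have "\<bar>(\<Sum>p | prime p \<and> real p \<le> x. ln (real p) / real p) - ln x\<bar> \<le> C + ln 2"
    if x: "x \<ge> 1" for x
  proof -
    define n where "n = nat \<lfloor>x\<rfloor>"
    have n: "n \<ge> 1" "real n \<le> x" "x < real n + 1" using x by (auto simp: n_def le_nat_iff)
    have "{p. prime p \<and> real p \<le> x} = {p. prime p \<and> p \<le> n}"
      using n by (auto simp: n_def le_nat_floor)
    moreover have "ln (real n) \<le> ln x" using n by simp
    moreover have "ln x \<le> ln (2 * real n)" using n x by (subst ln_le_cancel_iff) linarith+
    moreover have "ln (2 * real n) = ln 2 + ln (real n)" using n by (simp add: ln_mult)
    ultimately show ?thesis using C(2)[OF n(1)] by simp
  qed
  moreover have "C + ln 2 > 0" using C(1) by (simp add: add_pos_pos)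
  ultimately show ?thesis by blast
qed

section \<open>Dirichlet characters\<close>

text \<open>A character of a subgroup \<open>H\<close> of the unit group mod \<open>q\<close>, where
  \<open>H\<close> is kept as a union of residue classes of naturals. Inverses in \<open>H\<close>
  come from Euler's theorem. Outside \<open>H\<close> the values of \<open>chi\<close> are
  arbitrary.\<close>

definition partial_char :: "nat \<Rightarrow> nat set \<Rightarrow> (nat \<Rightarrow> complex) \<Rightarrow> bool" where
  "partial_char q H chi \<longleftrightarrow>
     1 \<in> H \<and> chi 1 = 1 \<and> (\<forall>m\<in>H. coprime m q) \<and>
     (\<forall>m\<in>H. \<forall>n. [n = m] (mod q) \<longrightarrow> n \<in> H \<and> chi n = chi m) \<and>
     (\<forall>m\<in>H. \<forall>n\<in>H. m * n \<in> H \<and> chi (m * n) = chi m * chi n)"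

lemma partial_charD:
  assumes "partial_char q H chi"
  shows "1 \<in> H" "chi 1 = 1" "m \<in> H \<Longrightarrow> coprime m q"
    "m \<in> H \<Longrightarrow> [n = m] (mod q) \<Longrightarrow> n \<in> H" "m \<in> H \<Longrightarrow> [n = m] (mod q) \<Longrightarrow> chi n = chi m"
    "m \<in> H \<Longrightarrow> n \<in> H \<Longrightarrow> m * n \<in> H" "m \<in> H \<Longrightarrow> n \<in> H \<Longrightarrow> chi (m * n) = chi m * chi n"
  using assms unfolding partial_char_def by blast+

lemma partial_char_power:
  assumes "partial_char q H chi" "m \<in> H"
  shows "m ^ k \<in> H \<and> chi (m ^ k) = chi m ^ k"
proof (induction k)
  case 0
  then show ?case using partial_charD(1,2)[OF assms(1)] by simp
next
  case (Suc k)
  then show ?case using partial_charD(6,7)[OF assms(1)] assms(2) by simp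
qed

lemma inverse_power_mod:
  fixes z q :: nat
  assumes "coprime z q" "q \<ge> 1"
  shows "[z * z ^ (totient q - 1) = 1] (mod q)"
proof -
  have "totient q > 0" using assms by simp
  then have "z * z ^ (totient q - 1) = z ^ totient q"
    by (metis Suc_diff_1 power_Suc)
  then show ?thesis using euler_theorem[OF assms(1)] by simp
qed

lemma partial_char_nonzero:
  assumes "partial_char q H chi" "m \<in> H" "q \<ge> 1"
  shows "chi m \<noteq> 0"
proof
  assume "chi m = 0"
  have "coprime m q" using partial_charD(3)[OF assms(1,2)] .
  then have "[m ^ totient q = 1] (mod q)" by (rule euler_theorem)
  then have "chi (m ^ totient q) = 1"
    using partial_charD(1,2)[OF assms(1)] partial_charD(5)[OF assms(1)] by metis
  moreover have "chi (m ^ totient q) = chi m ^ totient q"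
    using partial_char_power[OF assms(1,2)] by blast
  moreover have "(0::complex) ^ totient q = 0" using assms by (intro zero_power) simp
  ultimately show False using \<open>chi m = 0\<close> by simp
qed

text \<open>\<open>H\<close> is closed under division: \<open>m ^ (totient q - 1)\<close> lies in
  \<open>H\<close> and inverts \<open>m\<close> mod \<open>q\<close>.\<close>

lemma partial_char_cancel:
  assumes "partial_char q H chi" "m \<in> H" "coprime z q" "[h = m * z] (mod q)" "h \<in> H" "q \<ge> 1"
  shows "z \<in> H"
proof -
  have m: "coprime m q" using partial_charD(3)[OF assms(1,2)] .
  let ?m = "m ^ (totient q - 1)"
  have "?m * h \<in> H" using assms(5) partial_char_power[OF assms(1,2)] partial_charD(6)[OF assms(1)] by blast
  moreover have "[z = ?m * h] (mod q)"
  proof -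
    have "[?m * h = ?m * (m * z)] (mod q)" using assms(4) cong_scalar_left by blast
    also have "?m * (m * z) = (m * ?m) * z" by simp
    also have "[(m * ?m) * z = 1 * z] (mod q)"
      using inverse_power_mod[OF m assms(6)] cong_scalar_right by blast
    finally show ?thesis by (simp add: cong_sym_eq)
  qed
  ultimately show ?thesis using partial_charD(4)[OF assms(1)] by blast
qed

text \<open>Let \<open>d\<close> be the order of \<open>y\<close> modulo \<open>H\<close>, at least
  2 since \<open>y\<close> lies outside \<open>H\<close>. On the group generated by \<open>H\<close>
  and \<open>y\<close> put \<open>chi' (h * y ^ j) = chi h * w ^ j\<close> with
  \<open>w ^ d = chi (y ^ d)\<close>. There are \<open>d\<close> such \<open>w\<close>, so one of
  them differs from 1; this freedom is what later separates residues by characters.\<close>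

lemma partial_char_extend:
  assumes pc: "partial_char q H chi" and q: "q \<ge> 1" and y: "coprime y q" "y \<notin> H"
  shows "\<exists>H' chi'. partial_char q H' chi' \<and> H \<subseteq> H' \<and> y \<in> H' \<and> (\<forall>m\<in>H. chi' m = chi m) \<and> chi' y \<noteq> 1"
proof -
  have one: "1 \<in> H" "chi 1 = 1" and cop: "\<And>m. m \<in> H \<Longrightarrow> coprime m q"
    and cg: "\<And>m n. m \<in> H \<Longrightarrow> [n = m] (mod q) \<Longrightarrow> n \<in> H \<and> chi n = chi m"
    and mul: "\<And>m n. m \<in> H \<Longrightarrow> n \<in> H \<Longrightarrow> m * n \<in> H \<and> chi (m * n) = chi m * chi n"
    using pc unfolding partial_char_def by blast+
  define d where "d = (LEAST d. d > 0 \<and> y ^ d \<in> H)"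
  have "totient q > 0 \<and> y ^ totient q \<in> H"
    using q one cg euler_theorem[OF y(1)] by (metis One_nat_def less_eq_Suc_le totient_gt_0_iff)
  then have d: "d > 0 \<and> y ^ d \<in> H" unfolding d_def by (rule LeastI)
  have dmin: "\<not> (e > 0 \<and> y ^ e \<in> H)" if "e < d" for e
    using not_less_Least that unfolding d_def by blast
  have "d \<noteq> 1" using d y by auto
  then have d2: "d \<ge> 2" using d by linarith
  have copy: "coprime (y ^ j) q" for j using y(1) by simp
  have ddvd: "d dvd j" if "y ^ j \<in> H" for j
  proof -
    have "y ^ j = (y ^ d) ^ (j div d) * y ^ (j mod d)"
      by (metis div_mult_mod_eq mult.commute power_add power_mult)
    then have "[y ^ j = (y ^ d) ^ (j div d) * y ^ (j mod d)] (mod q)" by simp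
    moreover have "(y ^ d) ^ (j div d) \<in> H" using partial_char_power[OF pc] d by blast
    ultimately have "y ^ (j mod d) \<in> H"
      using partial_char_cancel[OF pc _ copy _ that q] by blast
    then show ?thesis using dmin[of "j mod d"] d by (auto simp: dvd_eq_mod_eq_0)
  qed
  have "chi (y ^ d) \<noteq> 0" using partial_char_nonzero[OF pc _ q] d by blast
  then have "card {w. w ^ d = chi (y ^ d)} = d" using d by (intro card_nth_roots) auto
  then have "\<not> {w. w ^ d = chi (y ^ d)} \<subseteq> {1}"
    using d2 card_mono[of "{1::complex}" "{w. w ^ d = chi (y ^ d)}"] by auto
  then obtain w where w: "w ^ d = chi (y ^ d)" "w \<noteq> 1" by blast
  define R where "R n h j \<longleftrightarrow> h \<in> H \<and> [n = h * y ^ j] (mod q)" for n h j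
  define H' where "H' = {n. \<exists>h j. R n h j}"
  define chi' where "chi' n = (THE v. \<exists>h j. R n h j \<and> v = chi h * w ^ j)" for n
  \<comment> \<open>Two representations whose exponents differ by \<open>e\<close> force
    \<open>y ^ e\<close> into \<open>H\<close>, hence \<open>d dvd e\<close>, and then
    \<open>w ^ d = chi (y ^ d)\<close> makes the two values agree.\<close>
  have uniq_le: "chi h * w ^ j = chi h' * w ^ j'" if R: "R n h j" "R n h' j'" and "j \<le> j'" for n h j h' j'
  proof -
    have h: "h \<in> H" "h' \<in> H" using R by (auto simp: R_def)
    obtain e where e: "j' = j + e" using \<open>j \<le> j'\<close> le_Suc_ex by blast
    have "[h * y ^ j = (h' * y ^ e) * y ^ j] (mod q)"
      using R e unfolding R_def by (metis cong_sym cong_trans mult.assoc mult.commute power_add)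
    then have c: "[h = h' * y ^ e] (mod q)"
      using copy by (metis cong_mult_rcancel_nat)
    then have ye: "y ^ e \<in> H" using partial_char_cancel[OF pc h(2) copy _ h(1) q] by blast
    then obtain f where f: "e = d * f" using ddvd by blast
    have "chi h = chi (h' * y ^ e)" using c cg mul h ye by blast
    also have "\<dots> = chi h' * chi ((y ^ d) ^ f)" using mul h ye f by (simp add: power_mult)
    also have "chi ((y ^ d) ^ f) = (w ^ d) ^ f" using partial_char_power[OF pc] d w by simp
    also have "\<dots> = w ^ e" using f by (simp add: power_mult)
    finally show ?thesis using e by (simp add: power_add)
  qed
  have uniq: "chi h * w ^ j = chi h' * w ^ j'" if "R n h j" "R n h' j'" for n h j h' j'
    using uniq_le[of n h j h' j'] uniq_le[of n h' j' h j] that by (cases "j \<le> j'") auto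
  have val: "chi' n = chi h * w ^ j" if "R n h j" for n h j
    unfolding chi'_def using that uniq by (intro the_equality) blast+
  have R1: "R h h 0" if "h \<in> H" for h using that by (simp add: R_def)
  have Ry: "R y 1 1" using one by (simp add: R_def)
  have Rmul: "R (m * n) (h * h') (j + j')" if "R m h j" "R n h' j'" for m n h h' j j'
  proof -
    have "[m * n = (h * y ^ j) * (h' * y ^ j')] (mod q)"
      using that unfolding R_def by (intro cong_mult) auto
    also have "(h * y ^ j) * (h' * y ^ j') = (h * h') * y ^ (j + j')" by (simp add: power_add)
    finally show ?thesis using that mul by (auto simp: R_def)
  qed
  have Rcong: "R n h j" if "R m h j" "[n = m] (mod q)" for m n h j
    using that cong_trans unfolding R_def by blast
  have "partial_char q H' chi'"
    unfolding partial_char_def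
  proof (intro conjI ballI allI impI)
    show "1 \<in> H'" using R1[OF one(1)] by (auto simp: H'_def)
    show "chi' 1 = 1" using val[OF R1[OF one(1)]] one by simp
  next
    fix m assume "m \<in> H'"
    then obtain h j where R: "R m h j" by (auto simp: H'_def)
    then have "coprime (h * y ^ j) q" using cop copy by (simp add: R_def)
    then show "coprime m q" using R unfolding R_def
      by (metis cong_imp_coprime cong_sym)
  next
    fix m n assume "m \<in> H'" "[n = m] (mod q)"
    then obtain h j where R: "R m h j" "R n h j" using Rcong by (auto simp: H'_def)
    then show "n \<in> H'" "chi' n = chi' m" using val by (auto simp: H'_def)
  next
    fix m n assume "m \<in> H'" "n \<in> H'"
    then obtain h j h' j' where R: "R m h j" "R n h' j'" by (auto simp: H'_def)
    have hm: "h \<in> H" "h' \<in> H" using R by (auto simp: R_def)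
    show "m * n \<in> H'" using Rmul[OF R] by (auto simp: H'_def)
    show "chi' (m * n) = chi' m * chi' n"
      using val[OF Rmul[OF R]] val[OF R(1)] val[OF R(2)] mul[OF hm] by (simp add: power_add)
  qed
  moreover have "H \<subseteq> H'" using R1 by (auto simp: H'_def)
  moreover have "y \<in> H'" using Ry by (auto simp: H'_def)
  moreover have "\<forall>m\<in>H. chi' m = chi m" using val[OF R1] by simp
  moreover have "chi' y \<noteq> 1" using val[OF Ry] one w by simp
  ultimately show ?thesis by blast
qed

text \<open>Induction on the number of unit residues below \<open>q\<close> outside
  \<open>H\<close>; every extension adjoins at least one of them.\<close>

lemma partial_char_extend_all:
  assumes "partial_char q H chi" "q \<ge> 1"
  shows "\<exists>chi'. partial_char q {n. coprime n q} chi' \<and> (\<forall>m\<in>H. chi' m = chi m)"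
  using assms(1)
proof (induction "card ({n. n < q \<and> coprime n q} - H)" arbitrary: H chi rule: less_induct)
  case less
  have sub: "H \<subseteq> {n. coprime n q}" using partial_charD(3)[OF less.prems] by blast
  show ?case
  proof (cases "H = {n. coprime n q}")
    case True
    then show ?thesis using less.prems by blast
  next
    case False
    then obtain y0 where y0: "coprime y0 q" "y0 \<notin> H" using sub by blast
    define y where "y = y0 mod q"
    have c: "[y0 = y] (mod q)" by (simp add: y_def cong_def)
    have y: "coprime y q" "y \<notin> H" "y < q"
      using y0 c assms(2) partial_charD(4)[OF less.prems _ c] by (auto simp: y_def)
    obtain H' chi' where H': "partial_char q H' chi'" "H \<subseteq> H'" "y \<in> H'" "\<forall>m\<in>H. chi' m = chi m"
      using partial_char_extend[OF less.prems assms(2) y(1,2)] by blast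
    have "card ({n. n < q \<and> coprime n q} - H') < card ({n. n < q \<and> coprime n q} - H)"
      by (rule psubset_card_mono) (use H' y in auto)
    from less.hyps[OF this H'(1)] show ?thesis using H' by (metis subsetD)
  qed
qed

lemma partial_char_imp_dirichlet_char:
  assumes "partial_char q {n. coprime n q} chi" "q \<ge> 1"
  shows "dirichlet_char q (\<lambda>n. if coprime n q then chi n else 0)"
proof -
  have nz: "chi n \<noteq> 0" if "coprime n q" for n
    using partial_char_nonzero[OF assms(1) _ assms(2)] that by blast
  have "[n + q = n] (mod q)" for n by (simp add: cong_def)
  then have "chi (n + q) = chi n" if "coprime n q" for n
    using partial_charD(5)[OF assms(1)] that by blast
  moreover have "coprime (n + q) q \<longleftrightarrow> coprime n q" for n
    by (metis coprime_iff_gcd_eq_1 gcd_add1)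
  moreover have "chi (m * n) = chi m * chi n" if "coprime m q" "coprime n q" for m n
    using partial_charD(7)[OF assms(1), of m n] that by simp
  ultimately show ?thesis
    using assms(2) nz partial_charD(2)[OF assms(1)] unfolding dirichlet_char_def
    by (auto simp: coprime_mult_left_iff)
qed

text \<open>The trivial character on the class of 1 is extended by \<open>x\<close> with a value
  other than 1, and from there to all units.\<close>

lemma dirichlet_char_separates:
  assumes "q \<ge> 1" "coprime x q" "\<not> [x = 1] (mod q)"
  shows "\<exists>chi. dirichlet_char q chi \<and> chi x \<noteq> 1"
proof -
  have "partial_char q {n. [n = 1] (mod q)} (\<lambda>_. 1)"
    unfolding partial_char_def
  proof (intro conjI ballI allI impI CollectI)
    fix m assume "m \<in> {n. [n = 1] (mod q)}"
    then have "[1 = m] (mod q)" by (simp add: cong_sym)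
    then show "coprime m q" using cong_imp_coprime coprime_1_left by blast
  next
    fix m n assume "m \<in> {n. [n = 1] (mod q)}" "n \<in> {n. [n = 1] (mod q)}"
    then show "[m * n = 1] (mod q)" using cong_mult[of m 1 q n 1] by simp
  qed (auto intro: cong_trans)
  from partial_char_extend[OF this assms(1,2)] assms(3) obtain H chi
    where "partial_char q H chi" "x \<in> H" "chi x \<noteq> 1" by blast
  moreover then obtain chi' where "partial_char q {n. coprime n q} chi'" "chi' x = chi x"
    using partial_char_extend_all assms(1) by metis
  ultimately show ?thesis
    using partial_char_imp_dirichlet_char[OF _ assms(1)] assms(2)
    by (intro exI[of _ "\<lambda>n. if coprime n q then chi' n else 0"]) auto
qed

section \<open>Elementary properties of Dirichlet characters\<close>

lemma dirichlet_char_mod: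
  assumes "dirichlet_char q chi"
  shows "chi (n mod q) = chi n"
proof -
  have "chi (m + k * q) = chi m" for m k
  proof (induction k)
    case (Suc k)
    have "chi (m + Suc k * q) = chi ((m + k * q) + q)" by (simp add: algebra_simps)
    also have "\<dots> = chi (m + k * q)" using assms unfolding dirichlet_char_def by blast
    finally show ?case using Suc by simp
  qed simp
  from this[of "n mod q" "n div q"] show ?thesis by (simp add: mod_div_mult_eq)
qed

lemma dirichlet_char_cong:
  assumes "dirichlet_char q chi" "[m = n] (mod q)"
  shows "chi m = chi n"
  using dirichlet_char_mod[OF assms(1), of m] dirichlet_char_mod[OF assms(1), of n] assms(2)
  by (simp add: cong_def)

lemma dirichlet_char_mult: "dirichlet_char q chi \<Longrightarrow> chi (m * n) = chi m * chi n"
  unfolding dirichlet_char_def by blast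

lemma dirichlet_char_power: "dirichlet_char q chi \<Longrightarrow> chi (m ^ k) = chi m ^ k"
  by (induction k) (simp_all add: dirichlet_char_def)

lemma dirichlet_char_eq_0: "dirichlet_char q chi \<Longrightarrow> \<not> coprime n q \<Longrightarrow> chi n = 0"
  unfolding dirichlet_char_def by blast

lemma dirichlet_char_root:
  assumes "dirichlet_char q chi" "coprime n q"
  shows "chi n ^ totient q = 1"
proof -
  have "chi n ^ totient q = chi (n ^ totient q)" using dirichlet_char_power[OF assms(1)] by simp
  also have "\<dots> = chi 1"
    by (rule dirichlet_char_cong[OF assms(1)]) (rule euler_theorem[OF assms(2)])
  finally show ?thesis using assms(1) by (simp add: dirichlet_char_def)
qed

lemma dirichlet_char_norm:
  assumes "dirichlet_char q chi" "coprime n q"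
  shows "cmod (chi n) = 1"
proof -
  have "q \<ge> 1" using assms by (simp add: dirichlet_char_def)
  then have "totient q > 0" by simp
  moreover have "cmod (chi n) ^ totient q = 1"
    using dirichlet_char_root[OF assms] by (simp flip: norm_power)
  ultimately show ?thesis
    using power_eq_imp_eq_base[of "cmod (chi n)" "totient q" 1] by simp
qed

lemma dirichlet_char_norm_le: "dirichlet_char q chi \<Longrightarrow> cmod (chi n) \<le> 1"
  using dirichlet_char_norm[of q chi n] dirichlet_char_eq_0[of q chi n]
  by (cases "coprime n q") simp_all

text \<open>A character is determined by its values below \<open>q\<close>, each of which is 0 or a
  root of unity of order dividing \<open>totient q\<close>.\<close>

lemma finite_dirichlet_chars: "finite {chi. dirichlet_char q chi}"
proof (cases "q \<ge> 1")
  case True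
  define V where "V = insert 0 {z::complex. z ^ totient q = 1}"
  have "finite V" unfolding V_def using True by (auto intro: finite_roots_unity)
  then have "finite (PiE {..<q} (\<lambda>_. V))" by (intro finite_PiE) auto
  moreover have "(\<lambda>chi. restrict chi {..<q}) ` {chi. dirichlet_char q chi} \<subseteq> PiE {..<q} (\<lambda>_. V)"
  proof (intro image_subsetI PiE_I)
    fix chi n assume "chi \<in> {chi. dirichlet_char q chi}" "n \<in> {..<q}"
    then show "restrict chi {..<q} n \<in> V"
      using dirichlet_char_root[of q chi n] dirichlet_char_eq_0[of q chi n]
      by (cases "coprime n q") (auto simp: V_def)
  qed auto
  ultimately have "finite ((\<lambda>chi. restrict chi {..<q}) ` {chi. dirichlet_char q chi})"
    using finite_subset by blast
  moreover have "inj_on (\<lambda>chi. restrict chi {..<q}) {chi. dirichlet_char q chi}"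
  proof (rule inj_onI, rule ext)
    fix chi chi' n
    assume chi: "chi \<in> {chi. dirichlet_char q chi}" "chi' \<in> {chi. dirichlet_char q chi}"
      and "restrict chi {..<q} = restrict chi' {..<q}"
    then have "chi (n mod q) = chi' (n mod q)"
      using True by (metis lessThan_iff mod_less_divisor restrict_apply' zero_less_one order_less_le_trans)
    then show "chi n = chi' n" using chi by (simp add: dirichlet_char_mod)
  qed
  ultimately show ?thesis using finite_imageD by blast
next
  case False
  then show ?thesis by (simp add: dirichlet_char_def)
qed

section \<open>Orthogonality relations\<close>

lemma dirichlet_char_principal:
  assumes "q \<ge> 1"
  shows "dirichlet_char q (principal_char q)"
proof -
  have "coprime (n + q) q \<longleftrightarrow> coprime n q" for n
    by (metis coprime_iff_gcd_eq_1 gcd_add1)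
  then show ?thesis
    using assms by (auto simp: dirichlet_char_def principal_char_def coprime_mult_left_iff)
qed

text \<open>Multiplication by a character \<open>psi\<close> with \<open>psi x \<noteq> 1\<close>
  permutes the characters, so the sum equals \<open>psi x\<close> times itself.\<close>

lemma sum_dirichlet_chars_eq_0:
  assumes "q \<ge> 1" "coprime x q" "\<not> [x = 1] (mod q)"
  shows "(\<Sum>chi | dirichlet_char q chi. chi x) = 0"
proof -
  obtain psi where psi: "dirichlet_char q psi" "psi x \<noteq> 1"
    using dirichlet_char_separates assms by blast
  let ?X = "{chi. dirichlet_char q chi}"
  let ?f = "\<lambda>chi n. psi n * chi n :: complex"
  have "inj_on ?f ?X"
  proof (rule inj_onI, rule ext)
    fix chi chi' n
    assume chi: "chi \<in> ?X" "chi' \<in> ?X" and eq: "?f chi = ?f chi'"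
    show "chi n = chi' n"
    proof (cases "coprime n q")
      case True
      then have "psi n \<noteq> 0" using psi unfolding dirichlet_char_def by blast
      then show ?thesis using fun_cong[OF eq, of n] by simp
    next
      case False
      then show ?thesis using chi by (simp add: dirichlet_char_eq_0)
    qed
  qed
  moreover have "?f ` ?X \<subseteq> ?X"
    using psi by (auto simp: dirichlet_char_def)
  ultimately have "bij_betw ?f ?X ?X"
    using finite_dirichlet_chars[of q] by (simp add: bij_betw_def endo_inj_surj)
  then have "(\<Sum>chi\<in>?X. chi x) = (\<Sum>chi\<in>?X. psi x * chi x)"
    by (subst sum.reindex_bij_betw[symmetric]) auto
  also have "\<dots> = psi x * (\<Sum>chi\<in>?X. chi x)" by (simp add: sum_distrib_left)
  finally show ?thesis using psi(2) by simp
qed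

lemma dirichlet_char_cnj:
  assumes "dirichlet_char q chi" "coprime n q"
  shows "cnj (chi n) = chi (n ^ (totient q - 1))"
proof -
  have q: "q \<ge> 1" using assms by (simp add: dirichlet_char_def)
  have "chi n * chi (n ^ (totient q - 1)) = chi 1"
    using dirichlet_char_cong[OF assms(1) inverse_power_mod[OF assms(2) q]]
    by (simp only: dirichlet_char_mult[OF assms(1)])
  then have "chi n * chi (n ^ (totient q - 1)) = 1" using assms by (simp add: dirichlet_char_def)
  moreover have "chi n * cnj (chi n) = 1"
    using dirichlet_char_norm[OF assms] by (simp add: complex_norm_square[symmetric])
  ultimately show ?thesis by (metis mult_cancel_left mult_zero_left zero_neq_one)
qed

lemma sum_totatives_mult:
  fixes f :: "nat \<Rightarrow> 'a :: comm_monoid_add"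
  assumes "q > 1" "coprime b q" "\<And>n. f (n mod q) = f n"
  shows "(\<Sum>a\<in>totatives q. f (a * b)) = (\<Sum>a\<in>totatives q. f a)"
proof -
  let ?g = "\<lambda>a. (a * b) mod q"
  have lt: "a < q" if "a \<in> totatives q" for a
    using totatives_less[OF that] assms by simp
  have "inj_on ?g (totatives q)"
  proof (rule inj_onI)
    fix x y assume xy: "x \<in> totatives q" "y \<in> totatives q" "?g x = ?g y"
    then have "[x = y] (mod q)"
      using assms(2) by (metis cong_def cong_mult_rcancel_nat)
    then show "x = y" using lt[OF xy(1)] lt[OF xy(2)] by (simp add: cong_def)
  qed
  moreover have "?g ` totatives q \<subseteq> totatives q"
  proof safe
    fix a assume "a \<in> totatives q"
    then have "coprime (?g a) q" using assms by (auto simp: totatives_def)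
    moreover then have "?g a \<noteq> 0" using assms(1) by (intro notI) simp
    moreover have "?g a < q" using assms(1) by simp
    ultimately show "?g a \<in> totatives q" unfolding totatives_def by (simp add: less_imp_le)
  qed
  ultimately have "bij_betw ?g (totatives q) (totatives q)"
    by (simp add: bij_betw_def endo_inj_surj)
  then have "(\<Sum>a\<in>totatives q. f a) = (\<Sum>a\<in>totatives q. f (?g a))"
    by (rule sum.reindex_bij_betw[symmetric])
  then show ?thesis using assms(3) by simp
qed

lemma sum_totatives_char_eq_0:
  assumes "q > 1" "dirichlet_char q chi" "chi \<noteq> principal_char q"
  shows "(\<Sum>a\<in>totatives q. chi a) = 0"
proof -
  obtain b where "chi b \<noteq> principal_char q b" using assms(3) by blast
  then have b: "coprime b q" "chi b \<noteq> 1"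
    using dirichlet_char_eq_0[OF assms(2)] by (auto simp: principal_char_def split: if_splits)
  have "(\<Sum>a\<in>totatives q. chi a) = (\<Sum>a\<in>totatives q. chi (a * b))"
    by (rule sum_totatives_mult[symmetric]) (use assms b dirichlet_char_mod in auto)
  also have "\<dots> = (\<Sum>a\<in>totatives q. chi a) * chi b"
    using dirichlet_char_mult[OF assms(2)] by (simp add: sum_distrib_right)
  finally show ?thesis using b(2) by simp
qed

text \<open>The double sum of \<open>chi a\<close> over characters and unit residues is evaluated in
  both orders: in one only the principal character survives, in the other only
  \<open>a = 1\<close>.\<close>

lemma card_dirichlet_chars:
  assumes "q > 1"
  shows "card {chi. dirichlet_char q chi} = totient q"
proof -
  let ?X = "{chi. dirichlet_char q chi}"
  have "(\<Sum>chi\<in>?X. \<Sum>a\<in>totatives q. chi a)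
      = (\<Sum>chi\<in>?X. if chi = principal_char q then of_nat (totient q) else 0)"
  proof (intro sum.cong refl)
    fix chi assume "chi \<in> ?X"
    moreover have "(\<Sum>a\<in>totatives q. principal_char q a) = of_nat (totient q)"
      by (simp add: principal_char_def totatives_def totient_def)
    ultimately show "(\<Sum>a\<in>totatives q. chi a)
        = (if chi = principal_char q then of_nat (totient q) else 0)"
      using sum_totatives_char_eq_0[OF assms] by auto
  qed
  also have "\<dots> = of_nat (totient q)"
    using assms finite_dirichlet_chars dirichlet_char_principal[of q] by (subst sum.delta) auto
  finally have "of_nat (totient q) = (\<Sum>a\<in>totatives q. \<Sum>chi\<in>?X. chi a)"
    by (subst sum.swap) simp
  also have "\<dots> = (\<Sum>a\<in>totatives q. if a = 1 then of_nat (card ?X) else 0)"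
  proof (intro sum.cong refl)
    fix a assume a: "a \<in> totatives q"
    have "[a = 1] (mod q) \<longleftrightarrow> a = 1"
      using totatives_less[OF a] assms by (auto simp: cong_def)
    moreover have "(\<Sum>chi\<in>?X. chi 1) = (\<Sum>chi\<in>?X. 1 :: complex)"
      by (rule sum.cong) (auto simp: dirichlet_char_def)
    ultimately show "(\<Sum>chi\<in>?X. chi a) = (if a = 1 then of_nat (card ?X) else 0)"
      using sum_dirichlet_chars_eq_0[of q a] a assms by (auto simp: totatives_def)
  qed
  also have "\<dots> = of_nat (card ?X)"
    using assms by (subst sum.delta) (auto simp: totatives_def)
  finally show ?thesis using of_nat_eq_iff by metis
qed

lemma dirichlet_char_orthogonality:
  assumes "q > 1" "coprime m q" "coprime n q"
  shows "(\<Sum>chi | dirichlet_char q chi. chi m * cnj (chi n))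
      = (if [m = n] (mod q) then of_nat (totient q) else 0)"
proof -
  let ?n = "n ^ (totient q - 1)"
  have "(\<Sum>chi | dirichlet_char q chi. chi m * cnj (chi n))
      = (\<Sum>chi | dirichlet_char q chi. chi (m * ?n))"
    by (intro sum.cong) (auto simp: dirichlet_char_cnj assms dirichlet_char_mult)
  also have "\<dots> = (if [m = n] (mod q) then of_nat (totient q) else 0)"
  proof (cases "[m = n] (mod q)")
    case True
    then have "[m * ?n = n * ?n] (mod q)" by (rule cong_scalar_right)
    also have "[n * ?n = 1] (mod q)" using assms by (intro inverse_power_mod) auto
    finally have *: "[m * ?n = 1] (mod q)" .
    have "chi (m * ?n) = 1" if "dirichlet_char q chi" for chi
    proof -
      have "chi (m * ?n) = chi 1" by (rule dirichlet_char_cong[OF that *])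
      then show ?thesis using that by (simp add: dirichlet_char_def)
    qed
    then have "(\<Sum>chi | dirichlet_char q chi. chi (m * ?n)) = (\<Sum>chi | dirichlet_char q chi. 1)"
      by (intro sum.cong) auto
    then show ?thesis using True card_dirichlet_chars[OF assms(1)] by simp
  next
    case False
    have "\<not> [m * ?n = 1] (mod q)"
    proof
      assume "[m * ?n = 1] (mod q)"
      also have "[1 = n * ?n] (mod q)"
        by (rule cong_sym, rule inverse_power_mod) (use assms in auto)
      finally have "[m = n] (mod q)"
        using assms cong_mult_rcancel_nat[of ?n q m n] by simp
      then show False using False by simp
    qed
    then show ?thesis using False sum_dirichlet_chars_eq_0[of q "m * ?n"] assms by simp
  qed
  finally show ?thesis .
qed

text \<open>The indices \<open>w\<close> are kept apart from the arguments \<open>g w\<close>: in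
  the main application \<open>w\<close> is a pair and \<open>g w\<close> its product, and
  coincidences among the products are what has to be counted.\<close>

lemma dirichlet_char_parseval:
  fixes c :: "'w \<Rightarrow> real" and g :: "'w \<Rightarrow> nat"
  assumes "q > 1" "finite W" "\<And>w. w \<in> W \<Longrightarrow> coprime (g w) q"
  shows "(\<Sum>chi | dirichlet_char q chi. (cmod (\<Sum>w\<in>W. of_real (c w) * chi (g w)))\<^sup>2)
      = real (totient q) * (\<Sum>w\<in>W. \<Sum>v\<in>W. if [g w = g v] (mod q) then c w * c v else 0)"
proof -
  have "complex_of_real (\<Sum>chi | dirichlet_char q chi. (cmod (\<Sum>w\<in>W. of_real (c w) * chi (g w)))\<^sup>2)
      = (\<Sum>chi | dirichlet_char q chi. \<Sum>w\<in>W. \<Sum>v\<in>W.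
           of_real (c w * c v) * (chi (g w) * cnj (chi (g v))))"
    by (simp only: of_real_sum complex_norm_square cnj_sum complex_cnj_mult sum_product)
       (simp add: mult_ac)
  also have "\<dots> = (\<Sum>w\<in>W. \<Sum>chi | dirichlet_char q chi. \<Sum>v\<in>W.
           of_real (c w * c v) * (chi (g w) * cnj (chi (g v))))"
    by (rule sum.swap)
  also have "\<dots> = (\<Sum>w\<in>W. \<Sum>v\<in>W. \<Sum>chi | dirichlet_char q chi.
           of_real (c w * c v) * (chi (g w) * cnj (chi (g v))))"
    by (intro sum.cong refl sum.swap)
  also have "\<dots> = (\<Sum>w\<in>W. \<Sum>v\<in>W. of_real (c w * c v) *
        (if [g w = g v] (mod q) then of_nat (totient q) else 0))"
    by (intro sum.cong refl, subst sum_distrib_left[symmetric], subst dirichlet_char_orthogonality)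
       (use assms in auto)
  also have "\<dots> = complex_of_real (real (totient q) *
      (\<Sum>w\<in>W. \<Sum>v\<in>W. if [g w = g v] (mod q) then c w * c v else 0))"
    by (simp add: sum_distrib_left if_distrib mult_ac cong: if_cong)
  finally show ?thesis by (simp only: of_real_eq_iff)
qed

section \<open>Products of primes of prescribed type\<close>

text \<open>\<open>P i\<close> will be the primes of block \<open>i\<close>. A squarefree number
  built from the blocks is represented by its set \<open>A\<close> of prime factors, and
  \<open>l\<close> prescribes how many of them each block contributes.\<close>

definition typed_subsets :: "'i set \<Rightarrow> ('i \<Rightarrow> 'a set) \<Rightarrow> ('i \<Rightarrow> nat) \<Rightarrow> 'a set set" where
  "typed_subsets I P l = {A. A \<subseteq> (\<Union>i\<in>I. P i) \<and> (\<forall>i\<in>I. card (A \<inter> P i) = l i)}"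

lemma finite_typed_subsets:
  assumes "finite I" "\<And>i. i \<in> I \<Longrightarrow> finite (P i)"
  shows "finite (typed_subsets I P l)"
  by (rule finite_subset[of _ "Pow (\<Union>i\<in>I. P i)"]) (use assms in \<open>auto simp: typed_subsets_def\<close>)

lemma finite_typed_subset:
  assumes "finite I" "\<And>i. i \<in> I \<Longrightarrow> finite (P i)" "A \<in> typed_subsets I P l"
  shows "finite A"
  by (rule finite_subset[of _ "(\<Union>i\<in>I. P i)"]) (use assms in \<open>auto simp: typed_subsets_def\<close>)

lemma typed_subsets_Diff:
  assumes P: "\<And>i. i \<in> I \<Longrightarrow> finite (P i)"
    and "B \<in> typed_subsets I P k" "D \<in> typed_subsets I P m" "D \<subseteq> B"
    and "\<And>i. i \<in> I \<Longrightarrow> k i - m i = l i"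
  shows "B - D \<in> typed_subsets I P l"
proof -
  have "card ((B - D) \<inter> P i) = l i" if i: "i \<in> I" for i
  proof -
    have "card (B \<inter> P i - D \<inter> P i) = card (B \<inter> P i) - card (D \<inter> P i)"
      using assms(4) P[OF i] by (intro card_Diff_subset) auto
    moreover have "(B - D) \<inter> P i = B \<inter> P i - D \<inter> P i" by blast
    ultimately show ?thesis using assms i by (simp add: typed_subsets_def)
  qed
  then show ?thesis using assms(2) by (auto simp: typed_subsets_def)
qed

lemma typed_subsets_Un:
  assumes P: "\<And>i. i \<in> I \<Longrightarrow> finite (P i)"
    and "D \<in> typed_subsets I P m" "A \<in> typed_subsets I P l" "A \<inter> D = {}"
    and "\<And>i. i \<in> I \<Longrightarrow> m i + l i = k i"
  shows "D \<union> A \<in> typed_subsets I P k"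
proof -
  have "card ((D \<union> A) \<inter> P i) = k i" if i: "i \<in> I" for i
  proof -
    have "card (D \<inter> P i \<union> A \<inter> P i) = card (D \<inter> P i) + card (A \<inter> P i)"
      using assms(4) P[OF i] by (intro card_Un_disjoint) auto
    moreover have "(D \<union> A) \<inter> P i = D \<inter> P i \<union> A \<inter> P i" by blast
    ultimately show ?thesis using assms i by (simp add: typed_subsets_def)
  qed
  then show ?thesis using assms(2,3) by (auto simp: typed_subsets_def)
qed

text \<open>A set of given type splits uniquely into its parts in the disjoint blocks, so the sum
  factors into one elementary symmetric function per block.\<close>

lemma sum_typed_subsets:
  fixes w :: "'a \<Rightarrow> 'b :: comm_semiring_1"
  assumes "finite I" "\<And>i. i \<in> I \<Longrightarrow> finite (P i)" "disjoint_family_on P I"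
  shows "(\<Sum>A\<in>typed_subsets I P l. \<Prod>p\<in>A. w p)
       = (\<Prod>i\<in>I. \<Sum>B | B \<subseteq> P i \<and> card B = l i. \<Prod>p\<in>B. w p)"
  using assms
proof (induction I rule: finite_induct)
  case empty
  have "typed_subsets {} P l = {{}}" by (auto simp: typed_subsets_def)
  then show ?case by simp
next
  case (insert i I)
  have dis: "P i \<inter> P j = {}" if "j \<in> I" for j
    using insert that by (auto simp: disjoint_family_on_def)
  have dis': "P i \<inter> (\<Union>j\<in>I. P j) = {}" using dis by blast
  let ?Q = "{B. B \<subseteq> P i \<and> card B = l i}"
  have IH: "(\<Sum>A\<in>typed_subsets I P l. \<Prod>p\<in>A. w p)
       = (\<Prod>i\<in>I. \<Sum>B | B \<subseteq> P i \<and> card B = l i. \<Prod>p\<in>B. w p)"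
    using insert by (auto simp: disjoint_family_on_def)
  have "(\<Sum>A\<in>typed_subsets (insert i I) P l. \<Prod>p\<in>A. w p)
      = (\<Sum>(B, A)\<in>?Q \<times> typed_subsets I P l. (\<Prod>p\<in>B. w p) * (\<Prod>p\<in>A. w p))"
  proof (rule sum.reindex_bij_witness[of _ "\<lambda>(B, A). B \<union> A" "\<lambda>A. (A \<inter> P i, A - P i)"])
    fix A assume A: "A \<in> typed_subsets (insert i I) P l"
    then show "(case (A \<inter> P i, A - P i) of (B, A) \<Rightarrow> B \<union> A) = A" by auto
    have "(A - P i) \<inter> P j = A \<inter> P j" if "j \<in> I" for j using dis[OF that] by blast
    then show "(A \<inter> P i, A - P i) \<in> ?Q \<times> typed_subsets I P l"
      using A by (auto simp: typed_subsets_def)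
    have "finite A"
      by (rule finite_typed_subset[OF _ _ A]) (use insert in auto)
    then have "(\<Prod>p\<in>A. w p) = (\<Prod>p\<in>A \<inter> P i. w p) * (\<Prod>p\<in>A - P i. w p)"
      by (rule prod.Int_Diff)
    then show "(case (A \<inter> P i, A - P i) of (B, A) \<Rightarrow> (\<Prod>p\<in>B. w p) * (\<Prod>p\<in>A. w p)) = (\<Prod>p\<in>A. w p)"
      by simp
  next
    fix BA assume "BA \<in> ?Q \<times> typed_subsets I P l"
    then obtain B A where BA: "BA = (B, A)" "B \<subseteq> P i" "card B = l i" "A \<in> typed_subsets I P l" by auto
    then have A: "A \<subseteq> (\<Union>j\<in>I. P j)" by (auto simp: typed_subsets_def)
    have 1: "(B \<union> A) \<inter> P i = B" using BA A dis' by blast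
    have 2: "(B \<union> A) - P i = A" using BA A dis' by blast
    show "(case (case BA of (B, A) \<Rightarrow> B \<union> A) of A \<Rightarrow> (A \<inter> P i, A - P i)) = BA"
      using BA 1 2 by simp
    have "(B \<union> A) \<inter> P j = A \<inter> P j" if "j \<in> I" for j using BA dis[OF that] by blast
    then show "(case BA of (B, A) \<Rightarrow> B \<union> A) \<in> typed_subsets (insert i I) P l"
      using BA 1 by (auto simp: typed_subsets_def)
  qed
  also have "\<dots> = (\<Sum>B\<in>?Q. \<Prod>p\<in>B. w p) * (\<Sum>A\<in>typed_subsets I P l. \<Prod>p\<in>A. w p)"
    by (simp add: sum_product sum.cartesian_product)
  finally show ?case using IH insert by simp
qed

text \<open>Both sides count sets of size \<open>Suc l\<close> with a marked element; on the right
  the marked element has been removed from the set.\<close>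

lemma sum_subsets_card_Suc:
  fixes w :: "'a \<Rightarrow> real"
  assumes "finite S"
  shows "real (Suc l) * (\<Sum>B | B \<subseteq> S \<and> card B = Suc l. \<Prod>p\<in>B. w p)
    = (\<Sum>A | A \<subseteq> S \<and> card A = l. (\<Prod>p\<in>A. w p) * (\<Sum>p\<in>S - A. w p))"
proof -
  let ?X = "{A. A \<subseteq> S \<and> card A = l}" and ?Y = "{B. B \<subseteq> S \<and> card B = Suc l}"
  have fin: "finite A" if "A \<subseteq> S" for A using that assms finite_subset by blast
  have finX: "finite ?X" "finite ?Y" by (rule finite_subset[of _ "Pow S"]; use assms in auto)+
  have "(\<Sum>A\<in>?X. (\<Prod>p\<in>A. w p) * (\<Sum>p\<in>S - A. w p))
      = (\<Sum>(A, p)\<in>Sigma ?X (\<lambda>A. S - A). (\<Prod>p\<in>A. w p) * w p)"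
    using assms finX by (simp add: sum_distrib_left sum.Sigma)
  also have "\<dots> = (\<Sum>(B, p)\<in>Sigma ?Y (\<lambda>B. B). \<Prod>p\<in>B. w p)"
  proof (rule sum.reindex_bij_witness[of _ "\<lambda>(B, p). (B - {p}, p)" "\<lambda>(A, p). (insert p A, p)"])
    fix Ap assume "Ap \<in> Sigma ?X (\<lambda>A. S - A)"
    then obtain A p where Ap: "Ap = (A, p)" "A \<subseteq> S" "card A = l" "p \<in> S" "p \<notin> A" by auto
    then show "(case (case Ap of (A, p) \<Rightarrow> (insert p A, p)) of (B, p) \<Rightarrow> (B - {p}, p)) = Ap"
      "(case Ap of (A, p) \<Rightarrow> (insert p A, p)) \<in> Sigma ?Y (\<lambda>B. B)"
      "(case (case Ap of (A, p) \<Rightarrow> (insert p A, p)) of (B, p) \<Rightarrow> \<Prod>p\<in>B. w p)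
        = (case Ap of (A, p) \<Rightarrow> (\<Prod>p\<in>A. w p) * w p)"
      using fin[of A] by (auto simp: mult.commute)
  next
    fix Bp assume "Bp \<in> Sigma ?Y (\<lambda>B. B)"
    then show "(case (case Bp of (B, p) \<Rightarrow> (B - {p}, p)) of (A, p) \<Rightarrow> (insert p A, p)) = Bp"
      "(case Bp of (B, p) \<Rightarrow> (B - {p}, p)) \<in> Sigma ?X (\<lambda>A. S - A)"
      using fin by (auto simp: insert_absorb)
  qed
  also have "\<dots> = (\<Sum>B\<in>?Y. real (card B) * (\<Prod>p\<in>B. w p))"
    using fin finX by (subst sum.Sigma[symmetric]) auto
  also have "\<dots> = real (Suc l) * (\<Sum>B\<in>?Y. \<Prod>p\<in>B. w p)"
    by (simp add: sum_distrib_left)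
  finally show ?thesis by simp
qed

text \<open>An elementary symmetric function falls short of the power of the full sum, divided by
  \<open>fact l\<close>, only through repeated elements. Setting aside up to \<open>l\<close>
  elements of weight at most \<open>M\<close> still leaves mass \<open>s\<close> for the next
  choice.\<close>

lemma sum_subsets_card_ge:
  fixes w :: "'a \<Rightarrow> real"
  assumes S: "finite S" and w: "\<And>p. p \<in> S \<Longrightarrow> 0 \<le> w p \<and> w p \<le> M" and M: "M \<ge> 0"
    and "s \<ge> 0" "s + real l * M \<le> (\<Sum>p\<in>S. w p)"
  shows "s ^ l / fact l \<le> (\<Sum>B | B \<subseteq> S \<and> card B = l. \<Prod>p\<in>B. w p)"
  using assms(5)
proof (induction l)
  case 0
  have "{B. B \<subseteq> S \<and> card B = 0} = {{}}" using finite_subset[OF _ S] by (auto simp: card_eq_0_iff)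
  then show ?case by simp
next
  case (Suc l)
  let ?e = "\<lambda>l. \<Sum>B | B \<subseteq> S \<and> card B = l. \<Prod>p\<in>B. w p"
  have sle: "s + real l * M \<le> (\<Sum>p\<in>S. w p)" using Suc.prems M by (simp add: algebra_simps)
  then have IH: "s ^ l / fact l \<le> ?e l" by (rule Suc.IH)
  have "?e l * s \<le> (\<Sum>A | A \<subseteq> S \<and> card A = l. (\<Prod>p\<in>A. w p) * (\<Sum>p\<in>S - A. w p))"
    unfolding sum_distrib_right
  proof (rule sum_mono)
    fix A assume A: "A \<in> {A. A \<subseteq> S \<and> card A = l}"
    then have "(\<Sum>p\<in>A. w p) \<le> real (card A) * M" using w by (intro sum_bounded_above) auto
    moreover have "(\<Sum>p\<in>S - A. w p) = (\<Sum>p\<in>S. w p) - (\<Sum>p\<in>A. w p)"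
      using A S by (intro sum_diff) auto
    ultimately have "s \<le> (\<Sum>p\<in>S - A. w p)" using A sle by simp
    then show "(\<Prod>p\<in>A. w p) * s \<le> (\<Prod>p\<in>A. w p) * (\<Sum>p\<in>S - A. w p)"
      using A w by (intro mult_left_mono prod_nonneg) auto
  qed
  also have "\<dots> = real (Suc l) * ?e (Suc l)" by (rule sum_subsets_card_Suc[OF S, symmetric])
  finally have "s ^ l / fact l * s \<le> real (Suc l) * ?e (Suc l)"
    using mult_right_mono[OF IH assms(4)] by linarith
  then show ?case by (simp add: field_simps del: of_nat_Suc)
qed

text \<open>The right-hand side runs over pairs \<open>D \<union> A\<close>,
  \<open>D \<union> A'\<close> of sets of type \<open>k\<close> with common part \<open>D\<close>,
  that is over exchanges of \<open>l i\<close> primes in each block. One of the two inner sums is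
  replaced by its lower bound, \<open>s ^ l i / fact (l i)\<close> per block. With the other one,
  each \<open>B\<close> of type \<open>k\<close> arises once for every subset \<open>A\<close> of
  type \<open>l\<close>, which gives the binomial coefficients.\<close>

lemma typed_subsets_gain:
  fixes w :: "'a \<Rightarrow> real"
  assumes I: "finite I" and P: "\<And>i. i \<in> I \<Longrightarrow> finite (P i)" "disjoint_family_on P I"
    and w: "\<And>i p. i \<in> I \<Longrightarrow> p \<in> P i \<Longrightarrow> 0 \<le> w p \<and> w p \<le> M" and M: "M \<ge> 0"
    and lk: "\<And>i. i \<in> I \<Longrightarrow> l i \<le> k i"
    and s: "s \<ge> 0" "\<And>i. i \<in> I \<Longrightarrow> s + real (k i) * M \<le> (\<Sum>p\<in>P i. w p)"
  shows "(\<Prod>i\<in>I. real (k i choose l i) * (s ^ l i / fact (l i))) * (\<Sum>B\<in>typed_subsets I P k. \<Prod>p\<in>B. w p)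
     \<le> (\<Sum>D\<in>typed_subsets I P (\<lambda>i. k i - l i). (\<Prod>p\<in>D. w p) *
           (\<Sum>A | A \<in> typed_subsets I P l \<and> A \<inter> D = {}. \<Prod>p\<in>A. w p)\<^sup>2)"
proof -
  let ?W = "\<lambda>A. \<Prod>p\<in>A. w p" and ?T = "typed_subsets I P"
  let ?D = "?T (\<lambda>i. k i - l i)"
  let ?S = "\<lambda>D. \<Sum>A | A \<in> ?T l \<and> A \<inter> D = {}. ?W A"
  define \<alpha> where "\<alpha> = (\<Prod>i\<in>I. s ^ l i / fact (l i))"
  have \<alpha>0: "\<alpha> \<ge> 0" unfolding \<alpha>_def using s(1) by (intro prod_nonneg) auto
  have finT: "finite (?T m)" for m using I P(1) by (rule finite_typed_subsets)
  have fin: "finite A" if "A \<in> ?T m" for A m using finite_typed_subset[OF I P(1) that] by blast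
  have W0: "?W A \<ge> 0" if "A \<in> ?T m" for A m
    using that w by (intro prod_nonneg) (fastforce simp: typed_subsets_def)
  \<comment> \<open>Block \<open>i\<close> loses \<open>k i - l i\<close> primes to \<open>D\<close>
    and up to \<open>l i\<close> to the growing set \<open>A\<close>; together they explain the term
    \<open>k i * M\<close> in the hypothesis on \<open>s\<close>.\<close>
  have S\<alpha>: "\<alpha> \<le> ?S D" if D: "D \<in> ?D" for D
  proof -
    have "{A. A \<in> ?T l \<and> A \<inter> D = {}} = typed_subsets I (\<lambda>i. P i - D) l"
    proof (intro equalityI subsetI)
      fix A assume A: "A \<in> {A. A \<in> ?T l \<and> A \<inter> D = {}}"
      then have "A \<inter> (P i - D) = A \<inter> P i" for i by blast
      then show "A \<in> typed_subsets I (\<lambda>i. P i - D) l" using A by (auto simp: typed_subsets_def)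
    next
      fix A assume A: "A \<in> typed_subsets I (\<lambda>i. P i - D) l"
      then have AD: "A \<inter> D = {}" by (auto simp: typed_subsets_def)
      then have "A \<inter> (P i - D) = A \<inter> P i" for i by blast
      then show "A \<in> {A. A \<in> ?T l \<and> A \<inter> D = {}}" using A AD by (auto simp: typed_subsets_def)
    qed
    moreover have "disjoint_family_on (\<lambda>i. P i - D) I"
      using P(2) unfolding disjoint_family_on_def by blast
    ultimately have "?S D = (\<Prod>i\<in>I. \<Sum>B | B \<subseteq> P i - D \<and> card B = l i. ?W B)"
      using I P(1) by (subst sum_typed_subsets[symmetric]) auto
    also have "\<dots> \<ge> \<alpha>" unfolding \<alpha>_def
    proof (rule prod_mono, intro conjI)
      fix i assume i: "i \<in> I"
      show "0 \<le> s ^ l i / fact (l i)" using s(1) by simp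
      show "s ^ l i / fact (l i) \<le> (\<Sum>B | B \<subseteq> P i - D \<and> card B = l i. ?W B)"
      proof (rule sum_subsets_card_ge)
        have "(\<Sum>p\<in>D \<inter> P i. w p) \<le> real (card (D \<inter> P i)) * M"
          using w i by (intro sum_bounded_above) auto
        moreover have "card (D \<inter> P i) = k i - l i" using D i by (auto simp: typed_subsets_def)
        moreover have "(\<Sum>p\<in>P i - D. w p) = (\<Sum>p\<in>P i. w p) - (\<Sum>p\<in>D \<inter> P i. w p)"
          using P(1)[OF i] sum_diff[of "P i" "D \<inter> P i" w] by (simp add: Diff_Int)
        ultimately show "s + real (l i) * M \<le> (\<Sum>p\<in>P i - D. w p)"
          using s(2)[OF i] lk[OF i] by (simp add: of_nat_diff algebra_simps)
      qed (use P(1)[OF i] w i M s in auto)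
    qed
    finally show ?thesis .
  qed
  have cardC: "real (card {A. A \<in> ?T l \<and> A \<subseteq> B}) = (\<Prod>i\<in>I. real (k i choose l i))"
    if B: "B \<in> ?T k" for B
  proof -
    have "{A. A \<in> ?T l \<and> A \<subseteq> B} = typed_subsets I (\<lambda>i. B \<inter> P i) l"
    proof (intro equalityI subsetI)
      fix A assume A: "A \<in> {A. A \<in> ?T l \<and> A \<subseteq> B}"
      then have "A \<inter> (B \<inter> P i) = A \<inter> P i" for i by blast
      then show "A \<in> typed_subsets I (\<lambda>i. B \<inter> P i) l" using A by (auto simp: typed_subsets_def)
    next
      fix A assume A: "A \<in> typed_subsets I (\<lambda>i. B \<inter> P i) l"
      then have AB: "A \<subseteq> B" by (auto simp: typed_subsets_def)
      then have "A \<inter> (B \<inter> P i) = A \<inter> P i" for i by blast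
      then show "A \<in> {A. A \<in> ?T l \<and> A \<subseteq> B}" using A AB by (auto simp: typed_subsets_def)
    qed
    then have "real (card {A. A \<in> ?T l \<and> A \<subseteq> B}) = (\<Sum>A\<in>typed_subsets I (\<lambda>i. B \<inter> P i) l. \<Prod>p\<in>A. (1::real))"
      by simp
    also have "\<dots> = (\<Prod>i\<in>I. \<Sum>A | A \<subseteq> B \<inter> P i \<and> card A = l i. \<Prod>p\<in>A. (1::real))"
    proof (rule sum_typed_subsets)
      show "disjoint_family_on (\<lambda>i. B \<inter> P i) I"
        using P(2) unfolding disjoint_family_on_def by blast
    qed (use I P(1) in auto)
    also have "\<dots> = (\<Prod>i\<in>I. real (k i choose l i))"
    proof (rule prod.cong[OF refl])
      fix i assume i: "i \<in> I"
      have "finite (B \<inter> P i)" "card (B \<inter> P i) = k i" using P(1)[OF i] B i by (auto simp: typed_subsets_def)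
      then show "(\<Sum>A | A \<subseteq> B \<inter> P i \<and> card A = l i. \<Prod>p\<in>A. (1::real)) = real (k i choose l i)"
        using n_subsets[of "B \<inter> P i" "l i"] by simp
    qed
    finally show ?thesis .
  qed
  have "(\<Prod>i\<in>I. real (k i choose l i) * (s ^ l i / fact (l i))) * (\<Sum>B\<in>?T k. ?W B)
      = \<alpha> * (\<Sum>B\<in>?T k. (\<Prod>i\<in>I. real (k i choose l i)) * ?W B)"
    unfolding prod.distrib \<alpha>_def sum_distrib_left by (simp add: mult_ac)
  also have "(\<Sum>B\<in>?T k. (\<Prod>i\<in>I. real (k i choose l i)) * ?W B)
      = (\<Sum>B\<in>?T k. \<Sum>A | A \<in> ?T l \<and> A \<subseteq> B. ?W B)"
    by (intro sum.cong) (simp_all add: cardC)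
  also have "\<dots> = (\<Sum>(B, A)\<in>Sigma (?T k) (\<lambda>B. {A. A \<in> ?T l \<and> A \<subseteq> B}). ?W B)"
    using finT by (subst sum.Sigma) auto
  also have "\<dots> = (\<Sum>(D, A)\<in>Sigma ?D (\<lambda>D. {A. A \<in> ?T l \<and> A \<inter> D = {}}). ?W D * ?W A)"
  proof (rule sum.reindex_bij_witness[of _ "\<lambda>(D, A). (D \<union> A, A)" "\<lambda>(B, A). (B - A, A)"])
    fix BA assume "BA \<in> Sigma (?T k) (\<lambda>B. {A. A \<in> ?T l \<and> A \<subseteq> B})"
    then obtain B A where BA: "BA = (B, A)" "B \<in> ?T k" "A \<in> ?T l" "A \<subseteq> B" by auto
    then show "(case (case BA of (B, A) \<Rightarrow> (B - A, A)) of (D, A) \<Rightarrow> (D \<union> A, A)) = BA" by auto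
    have "B - A \<in> ?D" using BA by (intro typed_subsets_Diff[OF P(1)]) auto
    then show "(case BA of (B, A) \<Rightarrow> (B - A, A)) \<in> Sigma ?D (\<lambda>D. {A. A \<in> ?T l \<and> A \<inter> D = {}})"
      using BA by auto
    have "?W B = ?W (B - A) * ?W A"
      using prod.subset_diff[OF BA(4) fin[OF BA(2)]] by blast
    then show "(case (case BA of (B, A) \<Rightarrow> (B - A, A)) of (D, A) \<Rightarrow> ?W D * ?W A)
        = (case BA of (B, A) \<Rightarrow> ?W B)" using BA by simp
  next
    fix DA assume "DA \<in> Sigma ?D (\<lambda>D. {A. A \<in> ?T l \<and> A \<inter> D = {}})"
    then obtain D A where DA: "DA = (D, A)" "D \<in> ?D" "A \<in> ?T l" "A \<inter> D = {}" by auto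
    then show "(case (case DA of (D, A) \<Rightarrow> (D \<union> A, A)) of (B, A) \<Rightarrow> (B - A, A)) = DA" by auto
    have "D \<union> A \<in> ?T k" using DA lk by (intro typed_subsets_Un[OF P(1)]) auto
    then show "(case DA of (D, A) \<Rightarrow> (D \<union> A, A)) \<in> Sigma (?T k) (\<lambda>B. {A. A \<in> ?T l \<and> A \<subseteq> B})"
      using DA by auto
  qed
  also have "\<dots> = (\<Sum>D\<in>?D. ?W D * ?S D)"
    using finT by (subst sum.Sigma[symmetric]) (auto simp: sum_distrib_left)
  also have "\<alpha> * \<dots> = (\<Sum>D\<in>?D. ?W D * (\<alpha> * ?S D))"
    by (simp add: sum_distrib_left mult_ac)
  also have "\<dots> \<le> (\<Sum>D\<in>?D. ?W D * (?S D)\<^sup>2)"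
  proof (rule sum_mono)
    fix D assume D: "D \<in> ?D"
    then show "?W D * (\<alpha> * ?S D) \<le> ?W D * (?S D)\<^sup>2"
      using S\<alpha>[OF D] \<alpha>0 W0[OF D] unfolding power2_eq_square by (intro mult_left_mono mult_right_mono) auto
  qed
  finally show ?thesis .
qed

section \<open>The resonance sum\<close>

definition coprime_count :: "nat \<Rightarrow> real \<Rightarrow> nat" where
  "coprime_count q Y = card {k \<in> {1..nat \<lfloor>Y\<rfloor>}. coprime k q}"

definition mult_pairs :: "nat \<Rightarrow> real \<Rightarrow> nat \<Rightarrow> nat \<Rightarrow> (nat \<times> nat) set" where
  "mult_pairs q N n1 n2 =
     {(m1, m2). m1 \<in> {1..nat \<lfloor>N\<rfloor>} \<and> m2 \<in> {1..nat \<lfloor>N\<rfloor>} \<and> coprime m1 q \<and> coprime m2 q \<and> m1 * n1 = m2 * n2}"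

text \<open>The second moment counts congruences mod \<open>q\<close>; this is the part of it that
  comes from true equalities, and all of it when the products stay below \<open>q\<close>.\<close>

definition resonance :: "nat \<Rightarrow> real \<Rightarrow> nat set \<Rightarrow> real" where
  "resonance q N S = (\<Sum>n1\<in>S. \<Sum>n2\<in>S. 1 / sqrt (real n1) * (1 / sqrt (real n2)) * real (card (mult_pairs q N n1 n2)))"

text \<open>The bound \<open>X\<close> serves to control the principal character. The last clause is
  the comparability obtained by cutting at integral values of \<open>ln n\<close>, with 3 as an
  upper bound for \<open>exp 1\<close>.\<close>

definition resonator_set :: "nat \<Rightarrow> real \<Rightarrow> nat set \<Rightarrow> bool" where
  "resonator_set q X S \<longleftrightarrow> finite S \<and> S \<noteq> {} \<and> (\<forall>n\<in>S. n > 0 \<and> real n \<le> X \<and> coprime n q) \<and>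
     (\<forall>n1\<in>S. \<forall>n2\<in>S. real n1 \<le> 3 * real n2)"

lemma finite_mult_pairs: "finite (mult_pairs q N n1 n2)"
  by (rule finite_subset[of _ "{1..nat \<lfloor>N\<rfloor>} \<times> {1..nat \<lfloor>N\<rfloor>}"]) (auto simp: mult_pairs_def)

text \<open>With \<open>g = gcd n1 n2\<close>, each \<open>k\<close> yields the solution
  \<open>(k * (n2 div g), k * (n1 div g))\<close>; both entries are at most \<open>N\<close> as long
  as \<open>k\<close> is at most \<open>N * g / max n1 n2\<close>.\<close>

lemma card_mult_pairs_ge:
  assumes n: "n1 > 0" "n2 > 0" "coprime n1 q" "coprime n2 q" and N: "N \<ge> 0"
  shows "coprime_count q (N * real (gcd n1 n2) / real (max n1 n2)) \<le> card (mult_pairs q N n1 n2)"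
proof -
  define g where "g = gcd n1 n2"
  have g: "g > 0" "g dvd n1" "g dvd n2" using n by (auto simp: g_def)
  define a where "a = n1 div g"
  define b where "b = n2 div g"
  have ab: "n1 = g * a" "n2 = g * b" "a > 0" "b > 0"
    using g n by (auto simp: a_def b_def dvd_div_eq_0_iff intro!: Nat.gr0I)
  have cop: "coprime a q" "coprime b q" using n ab by auto
  define Y where "Y = N * real g / real (max n1 n2)"
  have le: "real k * real b \<le> N \<and> real k * real a \<le> N" if "k \<in> {1..nat \<lfloor>Y\<rfloor>}" for k
  proof -
    have "Y \<ge> 0" using N by (simp add: Y_def)
    then have "real k \<le> Y" using that by (simp add: le_nat_floor) linarith
    then have "real k * real (max n1 n2) \<le> N * real g"
      using n by (simp add: Y_def field_simps)
    moreover have "real k * real n1 \<le> real k * real (max n1 n2)" "real k * real n2 \<le> real k * real (max n1 n2)"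
      by (intro mult_left_mono; simp)+
    ultimately have "real g * (real k * real a) \<le> real g * N" "real g * (real k * real b) \<le> real g * N"
      using ab by (simp_all add: mult_ac)
    then show ?thesis using g by simp
  qed
  have "inj_on (\<lambda>k. (k * b, k * a)) {k \<in> {1..nat \<lfloor>Y\<rfloor>}. coprime k q}"
    using ab by (auto simp: inj_on_def)
  moreover have "(\<lambda>k. (k * b, k * a)) ` {k \<in> {1..nat \<lfloor>Y\<rfloor>}. coprime k q} \<subseteq> mult_pairs q N n1 n2"
  proof (rule image_subsetI)
    fix k assume "k \<in> {k \<in> {1..nat \<lfloor>Y\<rfloor>}. coprime k q}"
    then have k: "k \<in> {1..nat \<lfloor>Y\<rfloor>}" "coprime k q" by auto
    have "real (k * b) \<le> N" "real (k * a) \<le> N" using le[OF k(1)] by auto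
    then have "k * b \<le> nat \<lfloor>N\<rfloor>" "k * a \<le> nat \<lfloor>N\<rfloor>" by (simp_all only: le_nat_floor)
    moreover have "k * b \<ge> 1" "k * a \<ge> 1" using k ab by (simp_all add: Suc_le_eq)
    ultimately show "(k * b, k * a) \<in> mult_pairs q N n1 n2"
      using k cop ab by (auto simp: mult_pairs_def mult_ac)
  qed
  ultimately show ?thesis
    unfolding coprime_count_def Y_def[symmetric] g_def[symmetric]
    using finite_mult_pairs by (rule card_inj_on_le)
qed

text \<open>The identity \<open>gcd n1 n2 = (\<Sum>d | d dvd gcd n1 n2. totient d)\<close> turns the resonance
  into a sum of squares, so that overlaps between the pairs need not be controlled.\<close>

lemma resonance_ge_totient_sum:
  assumes S: "finite S" "\<And>n. n \<in> S \<Longrightarrow> n > 0 \<and> coprime n q"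
    and ratio: "\<And>n1 n2. n1 \<in> S \<Longrightarrow> n2 \<in> S \<Longrightarrow> real n1 \<le> 3 * real n2"
    and E: "finite E"
    and Z: "\<And>n d. n \<in> S \<Longrightarrow> d \<in> E \<Longrightarrow> d dvd n \<Longrightarrow> real n \<le> Z * real d"
    and Y: "\<And>Y. Y \<ge> Y0 \<Longrightarrow> Y \<le> N \<Longrightarrow> Y / K \<le> real (coprime_count q Y)"
    and N: "N \<ge> Y0 * Z" "Z > 0" "N \<ge> 0" "K > 0" "Y0 > 0"
  shows "N / (2 * K) * (\<Sum>d\<in>E. real (totient d) * (\<Sum>n | n \<in> S \<and> d dvd n. 1 / real n)\<^sup>2) \<le> resonance q N S"
proof -
  have pair: "N / (2 * K) * (\<Sum>d | d \<in> E \<and> d dvd n1 \<and> d dvd n2. real (totient d) * (1 / real n1 * (1 / real n2)))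
     \<le> 1 / sqrt (real n1) * (1 / sqrt (real n2)) * real (card (mult_pairs q N n1 n2))"
    if n12: "n1 \<in> S" "n2 \<in> S" for n1 n2
  proof (cases "{d. d \<in> E \<and> d dvd n1 \<and> d dvd n2} = {}")
    case False
    then obtain d where d: "d \<in> E" "d dvd n1" "d dvd n2" by blast
    have n: "n1 > 0" "n2 > 0" "coprime n1 q" "coprime n2 q" using S(2) n12 by auto
    define g where "g = gcd n1 n2"
    define m where "m = max (real n1) (real n2)"
    have m: "m > 0" "real (max n1 n2) = m" using n by (auto simp: m_def)
    have "d \<le> g" unfolding g_def using d n by (intro dvd_imp_le) auto
    then have "Z * real d \<le> Z * real g" using N by simp
    then have mZ: "m \<le> Z * real g" using Z[OF n12(1) d(1,2)] Z[OF n12(2) d(1,3)] by (simp add: m_def)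
    \<comment> \<open>Without a common divisor in \<open>E\<close> there is nothing to bound. With
      one, the gcd is at least \<open>m / Z\<close>, so the range of the multipliers is long enough
      for the assumed count of integers coprime to \<open>q\<close>.\<close>
    have "N * real g / m \<ge> Y0"
    proof -
      have "Y0 * m \<le> Y0 * (Z * real g)" using mZ N by (intro mult_left_mono) auto
      also have "\<dots> \<le> N * real g" using N(1) mult_right_mono[of "Y0 * Z" N "real g"] by simp
      finally show ?thesis using m by (simp add: field_simps)
    qed
    moreover have "N * real g / m \<le> N"
    proof -
      have "g \<le> n1" unfolding g_def using n by (intro dvd_imp_le) auto
      then have "real g \<le> m" by (simp add: m_def)
      then show ?thesis using m N(3) mult_left_mono[of "real g" m N] by (simp add: field_simps)
    qed
    ultimately have "N * real g / m / K \<le> real (coprime_count q (N * real g / m))" by (rule Y)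
    also have "\<dots> \<le> real (card (mult_pairs q N n1 n2))"
      using card_mult_pairs_ge[OF n N(3)] m unfolding g_def by simp
    finally have cnt: "N * real g / m / K \<le> real (card (mult_pairs q N n1 n2))" .
    \<comment> \<open>Only divisors in \<open>E\<close> enter, so the divisor sum of
      \<open>totient\<close> is at most the gcd.\<close>
    have "(\<Sum>d | d \<in> E \<and> d dvd n1 \<and> d dvd n2. totient d) \<le> (\<Sum>d | d dvd g. totient d)"
      using n by (intro sum_mono2) (auto simp: g_def)
    then have tot: "(\<Sum>d | d \<in> E \<and> d dvd n1 \<and> d dvd n2. real (totient d)) \<le> real g"
      unfolding totient_divisor_sum by (metis of_nat_le_iff of_nat_sum)
    \<comment> \<open>Comparability acts here: the count has the denominator
      \<open>max n1 n2\<close>, the weights have \<open>sqrt (n1 * n2)\<close>, and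
      \<open>m^2 \<le> 3 * n1 * n2\<close> bounds the former by twice the latter. This is the 2 in
      \<open>N / (2 * K)\<close>.\<close>
    define s where "s = sqrt (real n1) * sqrt (real n2)"
    have s: "s > 0" "s\<^sup>2 = real n1 * real n2" using n by (auto simp: s_def power_mult_distrib)
    have "m\<^sup>2 \<le> (2 * s)\<^sup>2"
    proof -
      have "m\<^sup>2 \<le> 3 * (real n1 * real n2)"
      proof (cases "n1 \<le> n2")
        case True
        then have "m\<^sup>2 = real n2 * real n2" by (simp add: m_def power2_eq_square)
        also have "\<dots> \<le> (3 * real n1) * real n2" using ratio[OF n12(2,1)] by (intro mult_right_mono) auto
        finally show ?thesis by simp
      next
        case False
        then have "m\<^sup>2 = real n1 * real n1" by (simp add: m_def power2_eq_square)
        also have "\<dots> \<le> real n1 * (3 * real n2)" using ratio[OF n12(1,2)] by (intro mult_left_mono) auto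
        finally show ?thesis by simp
      qed
      also have "\<dots> \<le> 4 * s\<^sup>2" using s by simp
      finally show ?thesis by simp
    qed
    then have ms: "m \<le> 2 * s" by (rule power2_le_imp_le) (use s(1) in simp)
    have "N / (2 * K) * (\<Sum>d | d \<in> E \<and> d dvd n1 \<and> d dvd n2. real (totient d) * (1 / real n1 * (1 / real n2)))
       = N / (2 * K) * (1 / s\<^sup>2) * (\<Sum>d | d \<in> E \<and> d dvd n1 \<and> d dvd n2. real (totient d))"
      unfolding s(2) sum_distrib_left by (simp add: mult_ac)
    also have "\<dots> \<le> N / (2 * K) * (1 / s\<^sup>2) * real g"
      using tot N by (intro mult_left_mono) auto
    also have "\<dots> = N * real g / (2 * s) / K * (1 / s)"
      using s(1) by (simp add: power2_eq_square)
    also have "\<dots> \<le> N * real g / m / K * (1 / s)"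
      using ms m N s by (intro mult_right_mono divide_right_mono divide_left_mono) auto
    also have "\<dots> \<le> real (card (mult_pairs q N n1 n2)) * (1 / s)"
      using cnt s by (intro mult_right_mono) auto
    finally show ?thesis by (simp add: s_def mult_ac)
  next
    case True
    show ?thesis unfolding True by simp
  qed
  have "N / (2 * K) * (\<Sum>d\<in>E. real (totient d) * (\<Sum>n | n \<in> S \<and> d dvd n. 1 / real n)\<^sup>2)
     = N / (2 * K) * (\<Sum>d\<in>E. \<Sum>n1\<in>S. \<Sum>n2\<in>S. if d dvd n1 \<and> d dvd n2 then real (totient d) * (1 / real n1 * (1 / real n2)) else 0)"
  proof -
    have "real (totient d) * (\<Sum>n | n \<in> S \<and> d dvd n. 1 / real n)\<^sup>2
        = (\<Sum>n1\<in>S. \<Sum>n2\<in>S. if d dvd n1 \<and> d dvd n2 then real (totient d) * (1 / real n1 * (1 / real n2)) else 0)" for d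
    proof -
      have "(\<Sum>n | n \<in> S \<and> d dvd n. 1 / real n) = (\<Sum>n\<in>S. if d dvd n then 1 / real n else 0)"
        using S(1) by (intro sum.mono_neutral_cong_left) auto
      then have "real (totient d) * (\<Sum>n | n \<in> S \<and> d dvd n. 1 / real n)\<^sup>2
         = (\<Sum>n1\<in>S. \<Sum>n2\<in>S. real (totient d) * ((if d dvd n1 then 1 / real n1 else 0) * (if d dvd n2 then 1 / real n2 else 0)))"
        by (simp only: power2_eq_square sum_product) (simp only: sum_distrib_left)
      also have "\<dots> = (\<Sum>n1\<in>S. \<Sum>n2\<in>S. if d dvd n1 \<and> d dvd n2 then real (totient d) * (1 / real n1 * (1 / real n2)) else 0)"
        by (intro sum.cong) auto
      finally show ?thesis .
    qed
    then show ?thesis by simp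
  qed
  also have "(\<Sum>d\<in>E. \<Sum>n1\<in>S. \<Sum>n2\<in>S. if d dvd n1 \<and> d dvd n2 then real (totient d) * (1 / real n1 * (1 / real n2)) else 0)
     = (\<Sum>n1\<in>S. \<Sum>d\<in>E. \<Sum>n2\<in>S. if d dvd n1 \<and> d dvd n2 then real (totient d) * (1 / real n1 * (1 / real n2)) else 0)"
    by (rule sum.swap)
  also have "\<dots> = (\<Sum>n1\<in>S. \<Sum>n2\<in>S. \<Sum>d\<in>E. if d dvd n1 \<and> d dvd n2 then real (totient d) * (1 / real n1 * (1 / real n2)) else 0)"
    by (intro sum.cong refl sum.swap)
  also have "\<dots> = (\<Sum>n1\<in>S. \<Sum>n2\<in>S. \<Sum>d | d \<in> E \<and> d dvd n1 \<and> d dvd n2. real (totient d) * (1 / real n1 * (1 / real n2)))"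
    using E by (intro sum.cong refl sum.mono_neutral_cong_right) auto
  also have "N / (2 * K) * \<dots> \<le> resonance q N S"
    unfolding resonance_def sum_distrib_left[of "N / (2 * K)"]
    by (intro sum_mono) (use pair in \<open>simp only: sum_distrib_left\<close>)
  finally show ?thesis .
qed

text \<open>For each \<open>d\<close>, Cauchy-Schwarz over the classes of equal
  \<open>\<lfloor>ln n\<rfloor>\<close> bounds the square of the full sum by the number of classes
  times the sum of the squares. Pairs from different classes are thus given up at the price
  \<open>ln X + 1\<close>, and by averaging some class does as well as the resulting total.\<close>

lemma exists_scale_resonance:
  assumes S: "finite S" "S \<noteq> {}" "\<And>n. n \<in> S \<Longrightarrow> n > 0 \<and> coprime n q"
    and X: "\<And>n. n \<in> S \<Longrightarrow> real n \<le> X" "X \<ge> 1"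
    and E: "finite E"
    and Z: "\<And>n d. n \<in> S \<Longrightarrow> d \<in> E \<Longrightarrow> d dvd n \<Longrightarrow> real n \<le> Z * real d"
    and Y: "\<And>Y. Y \<ge> Y0 \<Longrightarrow> Y \<le> N \<Longrightarrow> Y / K \<le> real (coprime_count q Y)"
    and N: "N \<ge> Y0 * Z" "Z > 0" "N \<ge> 0" "K > 0" "Y0 > 0"
    and c: "c * (\<Sum>n\<in>S. 1 / real n) \<le> (\<Sum>d\<in>E. real (totient d) * (\<Sum>n | n \<in> S \<and> d dvd n. 1 / real n)\<^sup>2)"
  shows "\<exists>S'. S' \<noteq> {} \<and> S' \<subseteq> S \<and> (\<forall>n1\<in>S'. \<forall>n2\<in>S'. real n1 \<le> 3 * real n2) \<and>
     N / (2 * K * (ln X + 1)) * c * (\<Sum>n\<in>S'. 1 / real n) \<le> resonance q N S'"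
proof -
  define j where "j n = nat \<lfloor>ln (real n)\<rfloor>" for n
  define J where "J = nat \<lfloor>ln X\<rfloor>"
  have J: "real (card {..J}) \<le> ln X + 1" using X(2) by (simp add: J_def)
  have jJ: "j n \<in> {..J}" if "n \<in> S" for n
    using X(1)[OF that] X(2) S(3)[OF that] by (auto simp: j_def J_def intro!: nat_mono floor_mono)
  define S' where "S' i = {n \<in> S. j n = i}" for i
  have fin: "finite (S' i)" for i using S by (simp add: S'_def)
  have ratio: "real n1 \<le> 3 * real n2" if "n1 \<in> S' i" "n2 \<in> S' i" for i n1 n2
  proof -
    have n: "n1 \<ge> 1" "n2 \<ge> 1" using that S(3) by (force simp: S'_def Suc_le_eq)+
    then have l: "ln (real n1) \<ge> 0" "ln (real n2) \<ge> 0" by simp_all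
    have "nat \<lfloor>ln (real n1)\<rfloor> = nat \<lfloor>ln (real n2)\<rfloor>" using that by (simp add: S'_def j_def)
    then have "\<lfloor>ln (real n1)\<rfloor> = \<lfloor>ln (real n2)\<rfloor>" using l by (simp add: nat_eq_iff)
    then have "ln (real n1) \<le> ln (real n2) + 1" by linarith
    then have "exp (ln (real n1)) \<le> exp (ln (real n2) + 1)" by simp
    then have "real n1 \<le> real n2 * exp 1" using n by (simp add: exp_add)
    also have "\<dots> \<le> real n2 * 3" using exp_le by (intro mult_left_mono) auto
    finally show ?thesis by simp
  qed
  define B where "B = N / (2 * K * (ln X + 1)) * c"
  have res: "N / (2 * K) * (\<Sum>d\<in>E. real (totient d) * (\<Sum>n | n \<in> S' i \<and> d dvd n. 1 / real n)\<^sup>2) \<le> resonance q N (S' i)" for i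
  proof (rule resonance_ge_totient_sum[where ?Y0.0 = Y0 and Z = Z])
    show "real n \<le> Z * real d" if "n \<in> S' i" "d \<in> E" "d dvd n" for n d
      using that Z by (auto simp: S'_def)
    show "n > 0 \<and> coprime n q" if "n \<in> S' i" for n using that S(3) by (auto simp: S'_def)
  qed (use fin ratio E Y N in auto)
  have split: "(\<Sum>n | n \<in> S \<and> P n. 1 / real n) = (\<Sum>i\<le>J. \<Sum>n | n \<in> S' i \<and> P n. 1 / real n)" for P
  proof -
    have "(\<Sum>n | n \<in> S \<and> P n. 1 / real n) = (\<Sum>i\<in>{..J}. \<Sum>n | n \<in> {n. n \<in> S \<and> P n} \<and> j n = i. 1 / real n)"
      using S(1) jJ by (intro sum.group[symmetric]) auto
    also have "\<dots> = (\<Sum>i\<le>J. \<Sum>n | n \<in> S' i \<and> P n. 1 / real n)"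
      by (intro sum.cong) (auto simp: S'_def)
    finally show ?thesis .
  qed
  have "B * (\<Sum>i\<le>J. \<Sum>n\<in>S' i. 1 / real n) = N / (2 * K) * (1 / (ln X + 1)) * (c * (\<Sum>n\<in>S. 1 / real n))"
    using split[of "\<lambda>_. True"] by (simp add: B_def)
  also have "\<dots> \<le> N / (2 * K) * (1 / (ln X + 1)) *
      (\<Sum>d\<in>E. real (totient d) * ((ln X + 1) * (\<Sum>i\<le>J. (\<Sum>n | n \<in> S' i \<and> d dvd n. 1 / real n)\<^sup>2)))"
  proof (rule mult_left_mono)
    have "(\<Sum>n | n \<in> S \<and> d dvd n. 1 / real n)\<^sup>2
        \<le> (ln X + 1) * (\<Sum>i\<le>J. (\<Sum>n | n \<in> S' i \<and> d dvd n. 1 / real n)\<^sup>2)" for d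
    proof -
      have "(\<Sum>n | n \<in> S \<and> d dvd n. 1 / real n)\<^sup>2 = (\<Sum>i\<le>J. \<Sum>n | n \<in> S' i \<and> d dvd n. 1 / real n)\<^sup>2"
        by (simp only: split)
      also have "\<dots> \<le> real (card {..J}) * (\<Sum>i\<le>J. (\<Sum>n | n \<in> S' i \<and> d dvd n. 1 / real n)\<^sup>2)"
        using Cauchy_Schwarz_ineq_sum[of "\<lambda>_. 1" "\<lambda>i. \<Sum>n | n \<in> S' i \<and> d dvd n. 1 / real n" "{..J}"] by simp
      also have "\<dots> \<le> (ln X + 1) * (\<Sum>i\<le>J. (\<Sum>n | n \<in> S' i \<and> d dvd n. 1 / real n)\<^sup>2)"
        using J by (intro mult_right_mono sum_nonneg) auto
      finally show ?thesis .
    qed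
    then have "(\<Sum>d\<in>E. real (totient d) * (\<Sum>n | n \<in> S \<and> d dvd n. 1 / real n)\<^sup>2)
       \<le> (\<Sum>d\<in>E. real (totient d) * ((ln X + 1) * (\<Sum>i\<le>J. (\<Sum>n | n \<in> S' i \<and> d dvd n. 1 / real n)\<^sup>2)))"
      by (intro sum_mono mult_left_mono) auto
    then show "c * (\<Sum>n\<in>S. 1 / real n) \<le> (\<Sum>d\<in>E. real (totient d) * ((ln X + 1) * (\<Sum>i\<le>J. (\<Sum>n | n \<in> S' i \<and> d dvd n. 1 / real n)\<^sup>2)))"
      using c by linarith
    show "0 \<le> N / (2 * K) * (1 / (ln X + 1))" using N X(2) by simp
  qed
  also have "\<dots> = N / (2 * K) * (\<Sum>d\<in>E. real (totient d) * (\<Sum>i\<le>J. (\<Sum>n | n \<in> S' i \<and> d dvd n. 1 / real n)\<^sup>2))"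
  proof -
    have "(\<Sum>d\<in>E. real (totient d) * ((ln X + 1) * (\<Sum>i\<le>J. (\<Sum>n | n \<in> S' i \<and> d dvd n. 1 / real n)\<^sup>2)))
       = (ln X + 1) * (\<Sum>d\<in>E. real (totient d) * (\<Sum>i\<le>J. (\<Sum>n | n \<in> S' i \<and> d dvd n. 1 / real n)\<^sup>2))"
      by (subst (2) sum_distrib_left) (intro sum.cong refl mult.left_commute)
    moreover have "ln X + 1 \<noteq> 0" using X(2) ln_ge_zero[of X] by linarith
    ultimately show ?thesis by simp
  qed
  also have "\<dots> = (\<Sum>i\<le>J. N / (2 * K) * (\<Sum>d\<in>E. real (totient d) * (\<Sum>n | n \<in> S' i \<and> d dvd n. 1 / real n)\<^sup>2))"
    unfolding sum_distrib_left by (rule sum.swap)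
  also have "\<dots> \<le> (\<Sum>i\<le>J. resonance q N (S' i))" by (intro sum_mono res)
  finally have tot: "(\<Sum>i\<le>J. B * (\<Sum>n\<in>S' i. 1 / real n)) \<le> (\<Sum>i\<le>J. resonance q N (S' i))"
    by (simp only: sum_distrib_left)
  have "\<exists>i\<le>J. S' i \<noteq> {} \<and> B * (\<Sum>n\<in>S' i. 1 / real n) \<le> resonance q N (S' i)"
  proof (rule ccontr)
    assume "\<not> ?thesis"
    then have lt: "resonance q N (S' i) < B * (\<Sum>n\<in>S' i. 1 / real n)" if "i \<le> J" "S' i \<noteq> {}" for i
      using that by force
    obtain n where n: "n \<in> S" using S(2) by blast
    then have n': "j n \<le> J" "S' (j n) \<noteq> {}" using jJ by (auto simp: S'_def)
    \<comment> \<open>Empty classes give \<open>0 = 0\<close>, so strictness has to come from a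
      class that meets \<open>S\<close>.\<close>
    have "(\<Sum>i\<le>J. resonance q N (S' i)) < (\<Sum>i\<le>J. B * (\<Sum>n\<in>S' i. 1 / real n))"
    proof (rule sum_strict_mono_ex1)
      show "\<forall>i\<in>{..J}. resonance q N (S' i) \<le> B * (\<Sum>n\<in>S' i. 1 / real n)"
      proof
        fix i assume "i \<in> {..J}"
        then show "resonance q N (S' i) \<le> B * (\<Sum>n\<in>S' i. 1 / real n)"
          using lt[of i] by (cases "S' i = {}") (auto simp: resonance_def)
      qed
      show "\<exists>i\<in>{..J}. resonance q N (S' i) < B * (\<Sum>n\<in>S' i. 1 / real n)"
        using lt[OF n'] n'(1) by blast
    qed simp
    then show False using tot by linarith
  qed
  then obtain i where i: "S' i \<noteq> {}" "B * (\<Sum>n\<in>S' i. 1 / real n) \<le> resonance q N (S' i)" by blast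
  show ?thesis
    by (rule exI[of _ "S' i"]) (use i ratio in \<open>auto simp: B_def S'_def\<close>)
qed

section \<open>Primes in intervals and integers coprime to \<open>q\<close>\<close>

lemma sum_primes_between:
  fixes x y :: real
  assumes C: "\<And>x. x \<ge> 1 \<Longrightarrow> \<bar>(\<Sum>p | prime p \<and> real p \<le> x. ln (real p) / real p) - ln x\<bar> \<le> C"
    and "1 \<le> x" "x \<le> y"
  shows "ln y - ln x - 2 * C \<le> (\<Sum>p | prime p \<and> x < real p \<and> real p \<le> y. ln (real p) / real p)"
proof -
  have "{p. prime p \<and> real p \<le> y} = {p. prime p \<and> real p \<le> x} \<union> {p. prime p \<and> x < real p \<and> real p \<le> y}"
    using assms by auto
  then have "(\<Sum>p | prime p \<and> real p \<le> y. ln (real p) / real p)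
      = (\<Sum>p | prime p \<and> real p \<le> x. ln (real p) / real p)
      + (\<Sum>p | prime p \<and> x < real p \<and> real p \<le> y. ln (real p) / real p)"
    using finite_primes_le[of x] finite_subset[OF _ finite_primes_le[of y]]
    by (subst sum.union_disjoint[symmetric]) auto
  then show ?thesis using C[of x] C[of y] assms by linarith
qed

lemma card_prime_divisors_gt:
  assumes "q > 0" "y \<ge> 1"
  shows "real (card {p. prime p \<and> p dvd q \<and> y < real p}) * ln y \<le> ln (real q)"
proof -
  let ?S = "{p. prime p \<and> p dvd q \<and> y < real p}"
  have fin: "finite ?S" by (rule finite_subset[of _ "{..q}"]) (use assms in \<open>auto dest: dvd_imp_le\<close>)
  have "\<Prod>?S dvd q" by (rule prod_primes_dvd[OF fin]) auto
  then have "\<Prod>?S \<le> q" using assms by (intro dvd_imp_le) auto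
  then have "real (\<Prod>?S) \<le> real q" by (simp only: of_nat_le_iff)
  then have "(\<Prod>p\<in>?S. real p) \<le> real q" by (simp only: of_nat_prod)
  moreover have "(\<Prod>p\<in>?S. y) \<le> (\<Prod>p\<in>?S. real p)" using assms by (intro prod_mono) auto
  ultimately have "y ^ card ?S \<le> real q" by simp
  then have "ln (y ^ card ?S) \<le> ln (real q)" using assms by (subst ln_le_cancel_iff) auto
  then show ?thesis using assms by (simp add: ln_realpow)
qed

text \<open>Only primes are counted. With \<open>ln D = 2 * C + 1\<close> Mertens gives the interval
  \<open>(Y / D, Y]\<close> a mass of at least 1, hence at least \<open>Y / (D * ln q)\<close>
  primes, and at most \<open>2 * ln q\<close> primes divide \<open>q\<close>. So weak a count is
  enough because powers of \<open>ln q\<close> are negligible against the gain.\<close>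

lemma coprime_count_ge:
  assumes C: "\<And>x. x \<ge> 1 \<Longrightarrow> \<bar>(\<Sum>p | prime p \<and> real p \<le> x. ln (real p) / real p) - ln x\<bar> \<le> C"
    and Y: "Y \<ge> exp (2 * C + 1)" "Y \<le> real q" and C0: "C > 0"
  shows "Y / (exp (2 * C + 1) * ln (real q)) - 2 * ln (real q) \<le> real (coprime_count q Y)"
proof -
  define D where "D = exp (2 * C + 1)"
  have D: "D > 1" "ln D = 2 * C + 1" using C0 by (simp_all add: D_def)
  have YD: "Y \<ge> D" using Y by (simp add: D_def)
  then have Y1: "Y > 1" "Y / D \<ge> 1" using D(1) by auto
  have q: "real q > 1" "ln Y \<le> ln (real q)" "ln Y > 0" using Y Y1 by auto
  \<comment> \<open>As \<open>exp (1/2) < 2\<close>, this cutoff for the prime divisors of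
    \<open>q\<close> excludes none of them, and its logarithm \<open>1/2\<close> yields the bound
    \<open>2 * ln q\<close>.\<close>
  have exp_half: "exp (1/2) < (2::real)"
  proof -
    have "exp (1/2) ^ 2 = exp (1::real)" by (simp flip: exp_double)
    also have "\<dots> < 2 ^ 2" using exp_le by simp
    finally show ?thesis by (rule power_less_imp_less_base) simp
  qed
  let ?P = "{p. prime p \<and> Y / D < real p \<and> real p \<le> Y}"
  have finP: "finite ?P" by (rule finite_subset[OF _ finite_primes_le[of Y]]) auto
  have "1 = ln Y - ln (Y / D) - 2 * C" using D Y1 by (simp add: ln_div)
  also have "\<dots> \<le> (\<Sum>p\<in>?P. ln (real p) / real p)"
    using Y1 D by (intro sum_primes_between C) (auto simp: field_simps)
  also have "\<dots> \<le> (\<Sum>p\<in>?P. ln (real q) / (Y / D))"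
  proof (rule sum_mono)
    fix p assume p: "p \<in> ?P"
    then have "ln (real p) \<le> ln Y" using prime_gt_0_nat Y1 by (subst ln_le_cancel_iff) auto
    then show "ln (real p) / real p \<le> ln (real q) / (Y / D)"
      using p q Y1 by (intro frac_le) auto
  qed
  finally have "1 \<le> real (card ?P) * (ln (real q) * D / Y)" by simp
  then have "Y / (D * ln (real q)) \<le> real (card ?P)"
    using Y1 q D by (simp add: field_simps)
  moreover have "card ?P \<le> card {k \<in> {1..nat \<lfloor>Y\<rfloor>}. coprime k q} + card {p. prime p \<and> p dvd q \<and> exp (1/2) < real p}"
  proof -
    have "?P \<subseteq> {k \<in> {1..nat \<lfloor>Y\<rfloor>}. coprime k q} \<union> {p. prime p \<and> p dvd q \<and> exp (1/2) < real p}"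
    proof
      fix p assume "p \<in> ?P"
      then have p: "prime p" "real p \<le> Y" by auto
      then have "p \<ge> 2" "p \<le> nat \<lfloor>Y\<rfloor>" using prime_ge_2_nat by (auto simp: le_nat_floor)
      moreover have "coprime p q \<or> p dvd q" using p prime_imp_coprime by blast
      ultimately show "p \<in> {k \<in> {1..nat \<lfloor>Y\<rfloor>}. coprime k q} \<union> {p. prime p \<and> p dvd q \<and> exp (1/2) < real p}"
        using p exp_half by auto
    qed
    moreover have "finite {p. prime p \<and> p dvd q \<and> exp (1/2) < real p}"
      by (rule finite_subset[of _ "{..q}"]) (use q in \<open>auto dest: dvd_imp_le\<close>)
    ultimately have "card ?P \<le> card ({k \<in> {1..nat \<lfloor>Y\<rfloor>}. coprime k q} \<union> {p. prime p \<and> p dvd q \<and> exp (1/2) < real p})"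
      by (intro card_mono) auto
    then show ?thesis using card_Un_le le_trans by blast
  qed
  moreover have "real (card {p. prime p \<and> p dvd q \<and> exp (1/2) < real p}) \<le> 2 * ln (real q)"
    using card_prime_divisors_gt[of q "exp (1/2)"] q by simp
  ultimately show ?thesis unfolding coprime_count_def D_def[symmetric] by linarith
qed

section \<open>From sets of primes to integers\<close>

lemma Prod_primes_dvd_iff:
  fixes A B :: "nat set"
  assumes "finite A" "finite B" "\<And>p. p \<in> A \<union> B \<Longrightarrow> prime p"
  shows "\<Prod>A dvd \<Prod>B \<longleftrightarrow> A \<subseteq> B"
proof
  assume d: "\<Prod>A dvd \<Prod>B"
  show "A \<subseteq> B"
  proof
    fix p assume p: "p \<in> A"
    then have "p dvd \<Prod>B" using d assms dvd_trans dvd_prodI[of A p "\<lambda>x. x"] by blast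
    then obtain r where "r \<in> B" "p dvd r" using assms p prime_dvd_prod_iff[of B p "\<lambda>x. x"] by auto
    then show "p \<in> B" using p assms primes_dvd_imp_eq by (metis UnI1 UnI2)
  qed
next
  assume "A \<subseteq> B"
  then show "\<Prod>A dvd \<Prod>B" using assms by (intro prod_dvd_prod_subset) auto
qed

lemma totient_Prod_primes:
  assumes "finite D" "\<And>p. p \<in> D \<Longrightarrow> prime p"
  shows "real (totient (\<Prod>D)) = (\<Prod>p\<in>D. real p - 1)"
  using assms
proof (induction D rule: finite_induct)
  case (insert p D)
  have "coprime p (\<Prod>D)"
    using insert by (intro prod_coprime_right) (metis insertCI primes_coprime)
  then have "totient (p * \<Prod>D) = (p - 1) * totient (\<Prod>D)"
    using insert by (simp add: totient_mult_coprime totient_prime)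
  moreover have "p \<ge> 1" using insert prime_ge_1_nat by blast
  ultimately show ?case using insert by (simp add: of_nat_diff)
qed simp

lemma prod_one_minus_ge:
  fixes x :: "'a \<Rightarrow> real"
  assumes "finite D" "\<And>p. p \<in> D \<Longrightarrow> 0 \<le> x p \<and> x p \<le> 1"
  shows "1 - (\<Sum>p\<in>D. x p) \<le> (\<Prod>p\<in>D. 1 - x p)"
  using assms
proof (induction D rule: finite_induct)
  case (insert p D)
  have "1 - x p - (\<Sum>p\<in>D. x p) \<le> (1 - x p) * (1 - (\<Sum>p\<in>D. x p))"
    using insert sum_nonneg[of D x] by (simp add: algebra_simps)
  also have "\<dots> \<le> (1 - x p) * (\<Prod>p\<in>D. 1 - x p)"
    using insert by (intro mult_left_mono) auto
  finally show ?case using insert by simp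
qed simp

lemma typed_subsets_ln_prod_le:
  assumes I: "finite I" and P: "\<And>i. i \<in> I \<Longrightarrow> finite (P i)" "disjoint_family_on P I"
    and pos: "\<And>i p. i \<in> I \<Longrightarrow> p \<in> P i \<Longrightarrow> p > 0 \<and> ln (real p) \<le> b i"
    and A: "A \<in> typed_subsets I P l"
  shows "ln (real (\<Prod>A)) \<le> (\<Sum>i\<in>I. real (l i) * b i)"
proof -
  have A': "A = (\<Union>i\<in>I. A \<inter> P i)" using A by (auto simp: typed_subsets_def)
  have finA: "finite A" using finite_typed_subset[OF I P(1) A] .
  have posA: "p > 0" if "p \<in> A" for p using that A pos by (auto simp: typed_subsets_def)
  have "ln (real (\<Prod>A)) = (\<Sum>p\<in>A. ln (real p))"
    unfolding of_nat_prod using finA posA by (subst ln_prod) auto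
  also have "\<dots> = (\<Sum>p\<in>(\<Union>i\<in>I. A \<inter> P i). ln (real p))" using A' by simp
  also have "\<dots> = (\<Sum>i\<in>I. \<Sum>p\<in>A \<inter> P i. ln (real p))"
    using I finA P(2) by (intro sum.UNION_disjoint) (auto simp: disjoint_family_on_def)
  also have "\<dots> \<le> (\<Sum>i\<in>I. real (card (A \<inter> P i)) * b i)"
    using pos by (intro sum_mono sum_bounded_above) auto
  also have "\<dots> = (\<Sum>i\<in>I. real (l i) * b i)"
    using A by (intro sum.cong) (auto simp: typed_subsets_def)
  finally show ?thesis .
qed

lemma real_le_of_ln_le: "m > 0 \<Longrightarrow> ln (real m) \<le> ln x \<Longrightarrow> x > 0 \<Longrightarrow> real m \<le> x"
  using ln_le_cancel_iff[of "real m" x] by simp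

text \<open>\<open>S\<close> consists of the products of type \<open>k\<close>, \<open>E\<close> of
  those of type \<open>k - l\<close>. A sum over multiples of \<open>d\<close> carries the factor
  \<open>1 / d\<close>; in its square one such factor cancels against \<open>totient d\<close>,
  which is at least \<open>d / 2\<close> because the primes are large and few, and the other is the
  weight of \<open>D\<close> in \<open>typed_subsets_gain\<close>. A quotient \<open>n / d\<close>
  has type \<open>l\<close>, hence is at most \<open>Z\<close>.\<close>

lemma exists_resonator:
  assumes I: "finite I" and P: "\<And>i. i \<in> I \<Longrightarrow> finite (P i)" "disjoint_family_on P I"
    and prm: "\<And>i p. i \<in> I \<Longrightarrow> p \<in> P i \<Longrightarrow> prime p \<and> \<not> p dvd q \<and> y0 \<le> real p \<and> ln (real p) \<le> b i"
    and y0: "y0 > 0"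
    and lk: "\<And>i. i \<in> I \<Longrightarrow> l i \<le> k i"
    and s: "s > 0" "\<And>i. i \<in> I \<Longrightarrow> s + real (k i) / y0 \<le> (\<Sum>p\<in>P i. 1 / real p)"
    and small: "(\<Sum>i\<in>I. real (k i) / y0) \<le> 1 / 2"
    and X: "(\<Sum>i\<in>I. real (k i) * b i) \<le> ln X" "X \<ge> 1"
    and Z: "(\<Sum>i\<in>I. real (l i) * b i) \<le> ln Z" "Z > 0"
    and Y: "\<And>Y. Y \<ge> Y0 \<Longrightarrow> Y \<le> N \<Longrightarrow> Y / K \<le> real (coprime_count q Y)"
    and N: "N \<ge> Y0 * Z" "N \<ge> 0" "K > 0" "Y0 > 0"
  shows "\<exists>S. resonator_set q X S \<and> N / (2 * K * (ln X + 1)) * ((\<Prod>i\<in>I. real (k i choose l i) * (s ^ l i / fact (l i))) / 2) * (\<Sum>n\<in>S. 1 / real n)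
       \<le> resonance q N S"
proof -
  let ?T = "typed_subsets I P"
  let ?W = "\<lambda>A. \<Prod>p\<in>A. 1 / real p"
  let ?D = "?T (\<lambda>i. k i - l i)"
  define S where "S = Prod ` ?T k"
  define E where "E = Prod ` ?D"
  have prA: "prime p" "\<not> p dvd q" "y0 \<le> real p" if "A \<in> ?T m" "p \<in> A" for A m p
    using that prm by (auto simp: typed_subsets_def)
  have finA: "finite A" if "A \<in> ?T m" for A m using finite_typed_subset[OF I P(1) that] .
  have finT: "finite (?T m)" for m using finite_typed_subsets[OF I P(1)] .
  have dvd: "\<Prod>A dvd \<Prod>B \<longleftrightarrow> A \<subseteq> B" if "A \<in> ?T m" "B \<in> ?T m'" for A B m m'
    using that finA prA by (intro Prod_primes_dvd_iff) auto
  have inj: "inj_on Prod (?T m)" for m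
    using dvd by (intro inj_onI) (metis dvd_refl subset_antisym)
  have W: "?W A = 1 / real (\<Prod>A)" for A by (simp add: prod_dividef)
  have pos: "\<Prod>A > 0" if "A \<in> ?T m" for A m using that prA(1) prime_gt_0_nat by (intro prod_pos) blast
  have cop: "coprime (\<Prod>A) q" if "A \<in> ?T m" for A m
    using that prA(1,2) prime_imp_coprime by (intro prod_coprime_left) blast
  have lnle: "ln (real (\<Prod>A)) \<le> (\<Sum>i\<in>I. real (m i) * b i)" if "A \<in> ?T m" for A m
    using prm prime_gt_0_nat by (intro typed_subsets_ln_prod_le[OF I P _ that]) auto
  let ?c = "\<Prod>i\<in>I. real (k i choose l i) * (s ^ l i / fact (l i))"
  have w01: "0 \<le> 1 / real p \<and> 1 / real p \<le> 1 / y0" if "i \<in> I" "p \<in> P i" for i p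
    using prm[OF that] y0 by (auto simp: frac_le)
  have gain: "?c * (\<Sum>B\<in>?T k. ?W B)
     \<le> (\<Sum>D\<in>?D. ?W D * (\<Sum>A | A \<in> ?T l \<and> A \<inter> D = {}. ?W A)\<^sup>2)"
    by (rule typed_subsets_gain[where M = "1 / y0"]) (use I P w01 y0 lk s in auto)
  have sumS: "(\<Sum>n\<in>S. 1 / real n) = (\<Sum>B\<in>?T k. ?W B)"
    unfolding S_def by (subst sum.reindex[OF inj]) (simp add: W)
  have "S \<noteq> {}"
  proof -
    have "0 < (\<Prod>i\<in>I. s ^ k i / fact (k i))" using s(1) by (intro prod_pos) auto
    also have "\<dots> \<le> (\<Prod>i\<in>I. \<Sum>B | B \<subseteq> P i \<and> card B = k i. ?W B)"
      by (intro prod_mono conjI sum_subsets_card_ge[where M = "1 / y0"]) (use P w01 y0 s in auto)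
    also have "\<dots> = (\<Sum>B\<in>?T k. ?W B)" using sum_typed_subsets[OF I P, where w = "\<lambda>p. 1 / real p"] by simp
    finally show ?thesis unfolding S_def by auto
  qed
  have key: "?c / 2 * (\<Sum>n\<in>S. 1 / real n)
      \<le> (\<Sum>d\<in>E. real (totient d) * (\<Sum>n | n \<in> S \<and> d dvd n. 1 / real n)\<^sup>2)"
  proof -
    have "real (totient (\<Prod>D)) * (\<Sum>n | n \<in> S \<and> \<Prod>D dvd n. 1 / real n)\<^sup>2
       \<ge> ?W D * (\<Sum>A | A \<in> ?T l \<and> A \<inter> D = {}. ?W A)\<^sup>2 / 2" if D: "D \<in> ?D" for D
    proof -
      have "{n \<in> S. \<Prod>D dvd n} = Prod ` {B \<in> ?T k. D \<subseteq> B}"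
        using dvd[OF D] by (auto simp: S_def)
      then have "(\<Sum>n | n \<in> S \<and> \<Prod>D dvd n. 1 / real n) = (\<Sum>B | B \<in> ?T k \<and> D \<subseteq> B. ?W B)"
        using inj[of k] by (simp only: W) (subst sum.reindex, auto simp: inj_on_def)
      also have "\<dots> = (\<Sum>A | A \<in> ?T l \<and> A \<inter> D = {}. ?W D * ?W A)"
      proof (rule sum.reindex_bij_witness[of _ "\<lambda>A. D \<union> A" "\<lambda>B. B - D"])
        fix B assume B: "B \<in> {B. B \<in> ?T k \<and> D \<subseteq> B}"
        then show "D \<union> (B - D) = B" by auto
        have "B - D \<in> ?T l" using B D lk by (intro typed_subsets_Diff[OF P(1)]) auto
        then show "B - D \<in> {A. A \<in> ?T l \<and> A \<inter> D = {}}" by auto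
        show "?W D * ?W (B - D) = ?W B"
          using B prod.subset_diff[of D B "\<lambda>p. 1 / real p"] finA[of B k] by (simp add: mult.commute)
      next
        fix A assume A: "A \<in> {A. A \<in> ?T l \<and> A \<inter> D = {}}"
        then show "D \<union> A - D = A" by auto
        have "D \<union> A \<in> ?T k" using A D lk by (intro typed_subsets_Un[OF P(1)]) auto
        then show "D \<union> A \<in> {B. B \<in> ?T k \<and> D \<subseteq> B}" by auto
      qed
      finally have sumn: "(\<Sum>n | n \<in> S \<and> \<Prod>D dvd n. 1 / real n) = ?W D * (\<Sum>A | A \<in> ?T l \<and> A \<inter> D = {}. ?W A)"
        by (simp only: sum_distrib_left)
      have p1: "real p > 1" if "p \<in> D" for p using prA(1)[OF D that] prime_gt_1_nat by auto
      have p1': "0 \<le> 1 / real p \<and> 1 / real p \<le> 1" if "p \<in> D" for p using p1[OF that] by simp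
      have "(\<Sum>p\<in>D. 1 / real p) \<le> real (card D) * (1 / y0)"
        using prA(3)[OF D] y0 by (intro sum_bounded_above) (simp add: frac_le)
      also have "card D \<le> (\<Sum>i\<in>I. card (D \<inter> P i))"
      proof -
        have "D = (\<Union>i\<in>I. D \<inter> P i)" using D by (auto simp: typed_subsets_def)
        then show ?thesis using card_UN_le[OF I, of "\<lambda>i. D \<inter> P i"] by simp
      qed
      also have "(\<Sum>i\<in>I. card (D \<inter> P i)) \<le> (\<Sum>i\<in>I. k i)"
        using D by (intro sum_mono) (auto simp: typed_subsets_def)
      also have "real (\<Sum>i\<in>I. k i) * (1 / y0) \<le> 1 / 2" using small by (simp add: sum_divide_distrib)
      finally have sumD: "(\<Sum>p\<in>D. 1 / real p) \<le> 1 / 2" using y0 by (simp add: divide_right_mono)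
      have "1 / 2 \<le> 1 - (\<Sum>p\<in>D. 1 / real p)" using sumD by simp
      also have "\<dots> \<le> (\<Prod>p\<in>D. 1 - 1 / real p)"
        using finA[OF D] p1' by (rule prod_one_minus_ge)
      also have "\<dots> = (\<Prod>p\<in>D. (real p - 1) * (1 / real p))"
      proof (rule prod.cong[OF refl])
        fix p assume "p \<in> D"
        then show "1 - 1 / real p = (real p - 1) * (1 / real p)" using p1[of p] by (simp add: field_simps)
      qed
      also have "\<dots> = real (totient (\<Prod>D)) * ?W D"
        using totient_Prod_primes[of D] finA[OF D] prA(1)[OF D] by (simp only: prod.distrib)
      finally have half: "1 / 2 \<le> real (totient (\<Prod>D)) * ?W D" .
      let ?X = "?W D * (\<Sum>A | A \<in> ?T l \<and> A \<inter> D = {}. ?W A)\<^sup>2"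
      have "?X \<ge> 0" by (intro mult_nonneg_nonneg prod_nonneg) auto
      then have "1 / 2 * ?X \<le> (real (totient (\<Prod>D)) * ?W D) * ?X" using half by (rule mult_right_mono[rotated])
      then show ?thesis unfolding sumn by (simp add: power2_eq_square mult_ac)
    qed
    then have "(\<Sum>D\<in>?D. ?W D * (\<Sum>A | A \<in> ?T l \<and> A \<inter> D = {}. ?W A)\<^sup>2 / 2)
       \<le> (\<Sum>D\<in>?D. real (totient (\<Prod>D)) * (\<Sum>n | n \<in> S \<and> \<Prod>D dvd n. 1 / real n)\<^sup>2)"
      by (intro sum_mono)
    also have "\<dots> = (\<Sum>d\<in>E. real (totient d) * (\<Sum>n | n \<in> S \<and> d dvd n. 1 / real n)\<^sup>2)"
      unfolding E_def by (subst sum.reindex[OF inj]) simp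
    finally show ?thesis using gain unfolding sumS by (simp add: sum_divide_distrib[symmetric])
  qed
  have "\<exists>S'. S' \<noteq> {} \<and> S' \<subseteq> S \<and> (\<forall>n1\<in>S'. \<forall>n2\<in>S'. real n1 \<le> 3 * real n2) \<and>
     N / (2 * K * (ln X + 1)) * (?c / 2) * (\<Sum>n\<in>S'. 1 / real n) \<le> resonance q N S'"
  proof (rule exists_scale_resonance[where E = E and Z = Z and ?Y0.0 = Y0])
    show "real n \<le> X" if n: "n \<in> S" for n
    proof -
      obtain B where B: "B \<in> ?T k" "n = \<Prod>B" using n unfolding S_def by blast
      then have "ln (real n) \<le> ln X" using lnle[OF B(1)] X(1) by simp
      then show ?thesis using B(2) pos[OF B(1)] X(2) by (intro real_le_of_ln_le) auto
    qed
    show "real n \<le> Z * real d" if nd: "n \<in> S" "d \<in> E" "d dvd n" for n d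
    proof -
      obtain B D where BD: "B \<in> ?T k" "n = \<Prod>B" "D \<in> ?D" "d = \<Prod>D" using nd unfolding S_def E_def by blast
      then have sub: "D \<subseteq> B" using dvd nd by auto
      have A: "B - D \<in> ?T l" using BD sub lk by (intro typed_subsets_Diff[OF P(1)]) auto
      then have "ln (real (\<Prod>(B - D))) \<le> ln Z" using lnle[OF A] Z(1) by linarith
      then have "real (\<Prod>(B - D)) \<le> Z" using pos[OF A] Z(2) by (intro real_le_of_ln_le)
      moreover have "n = \<Prod>(B - D) * d" using BD prod.subset_diff[OF sub finA[OF BD(1)], of "\<lambda>x. x"] by simp
      ultimately show ?thesis by (simp add: mult_right_mono)
    qed
    show "n > 0 \<and> coprime n q" if "n \<in> S" for n using that pos cop unfolding S_def by blast
  qed (use \<open>S \<noteq> {}\<close> key finT X Y N Z in \<open>auto simp: S_def E_def\<close>)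
  then obtain S' where S': "S' \<noteq> {}" "S' \<subseteq> S" "\<forall>n1\<in>S'. \<forall>n2\<in>S'. real n1 \<le> 3 * real n2"
     "N / (2 * K * (ln X + 1)) * (?c / 2) * (\<Sum>n\<in>S'. 1 / real n) \<le> resonance q N S'" by blast
  have "n > 0 \<and> real n \<le> X \<and> coprime n q" if n: "n \<in> S'" for n
  proof -
    obtain B where B: "B \<in> ?T k" "n = \<Prod>B" using n S'(2) unfolding S_def by blast
    then have "ln (real n) \<le> ln X" using lnle[OF B(1)] X(1) by simp
    then have "real n \<le> X" using B(2) pos[OF B(1)] X(2) by (intro real_le_of_ln_le) auto
    then show ?thesis using B pos cop by auto
  qed
  moreover have "finite S'" using finite_subset[OF S'(2)] finT by (simp add: S_def)
  ultimately show ?thesis using S' unfolding resonator_set_def by blast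
qed

section \<open>Choice of the resonator\<close>

lemma ln_fact_le:
  assumes "l \<ge> 1"
  shows "ln (fact l) \<le> (real l + 1) * ln (real l) - real l + 1"
  using assms
proof (induction l rule: dec_induct)
  case (step l)
  have l: "real l > 0" using step by simp
  have "ln (real l / real (Suc l)) \<le> real l / real (Suc l) - 1"
    using l by (intro ln_le_minus_one) simp
  also have "\<dots> = - 1 / real (Suc l)" by (simp add: field_simps)
  finally have "(ln (real (Suc l)) - ln (real l)) \<ge> 1 / real (Suc l)"
    using l by (simp add: ln_div)
  then have "real (Suc l) * (ln (real (Suc l)) - ln (real l)) \<ge> real (Suc l) * (1 / real (Suc l))"
    by (intro mult_left_mono) auto
  then have "real (Suc l) * (ln (real (Suc l)) - ln (real l)) \<ge> 1" by simp
  moreover have "ln (fact (Suc l)) = ln (real (Suc l)) + ln (fact l)" by (simp add: ln_mult del: of_nat_Suc)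
  ultimately show ?case using step.IH by (simp add: algebra_simps)
qed simp

lemma binomial_ge_power_diff:
  assumes "l \<le> k"
  shows "(real k - real l) ^ l / fact l \<le> real (k choose l)"
proof -
  have "(real k - real l) ^ l = (\<Prod>i = 0..<l. real k - real l)" by simp
  also have "\<dots> \<le> (\<Prod>i = 0..<l. real k - real i)"
    using assms by (intro prod_mono) auto
  finally show ?thesis
    by (simp add: binomial_gbinomial gbinomial_prod_rev divide_right_mono)
qed

text \<open>The right-hand side is about \<open>(t ^ l / fact l)\<^sup>2\<close>, which is maximal near \<open>l = t\<close>;
  the value \<open>exp (2 * t)\<close> there is the source of the exponent of the theorem.\<close>

lemma block_gain:
  fixes s t :: real
  assumes s: "0 < s" "s \<le> 1" and t: "t \<ge> 4"
    and k: "k = nat \<lfloor>t\<^sup>2 / s\<rfloor>" and l: "l = nat \<lfloor>t\<rfloor>"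
  shows "l \<le> k" and "exp (2 * t - 2 * ln t - 8) \<le> real (k choose l) * (s ^ l / fact l)"
proof -
  have "t\<^sup>2 \<ge> 0" by simp
  then have kl: "real k > t\<^sup>2 / s - 1" "real l \<le> t" "real l > t - 1" "l \<ge> 1"
    using s t by (auto simp: k l le_nat_iff)
  have "t \<le> t * t" using t by simp
  moreover have "t\<^sup>2 \<le> t\<^sup>2 / s" using s mult_left_le_one_le[of "t\<^sup>2" s] by (simp add: field_simps)
  ultimately have "t \<le> t\<^sup>2 / s" by (simp add: power2_eq_square)
  then show lk: "l \<le> k" unfolding k l by (intro nat_mono floor_mono)
  \<comment> \<open>Rounding \<open>k\<close> and taking off \<open>l\<close> loses at most
    \<open>s + t \<le> 2 * t\<close> against the ideal \<open>t^2\<close>.\<close>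
  have "(real k - real l) * s \<ge> t\<^sup>2 - 2 * t"
  proof -
    have "real k * s > t\<^sup>2 - s" using kl(1) s by (simp add: field_simps)
    moreover have "real l * s \<le> t" using kl(2) s t mult_mono[of "real l" t s 1] by simp
    ultimately have "(real k - real l) * s \<ge> t\<^sup>2 - s - t" by (simp add: algebra_simps)
    then show ?thesis using s t by linarith
  qed
  then have base: "t\<^sup>2 * (1 - 2 / t) \<le> (real k - real l) * s"
    using t by (simp add: right_diff_distrib power2_eq_square)
  have pos: "1 - 2 / t > 0" using t by (simp add: field_simps)
  have "ln (1 - 2 / t) \<ge> - (2 / t) - 2 * (2 / t)\<^sup>2"
    using t by (intro ln_one_minus_pos_lower_bound) (auto simp: field_simps)
  moreover have "2 * (2 / t)\<^sup>2 \<le> 2 / t"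
    using t by (simp add: power2_eq_square field_simps)
  ultimately have ln1: "ln (1 - 2 / t) \<ge> - (4 / t)" by simp
  have "ln (t\<^sup>2 * (1 - 2 / t)) = 2 * ln t + ln (1 - 2 / t)"
    using t pos by (simp add: ln_mult ln_realpow)
  then have lnb: "ln (t\<^sup>2 * (1 - 2 / t)) \<ge> 2 * ln t - 4 / t" using ln1 by simp
  have lnl: "ln (real l) \<le> ln t" using kl by simp
  \<comment> \<open>The 8 is made of 4 from the factor \<open>1 - 2 / t\<close> raised to the power
    \<open>l \<le> t\<close>, 2 from \<open>l > t - 1\<close>, and 2 from the constant in the bound
    for \<open>ln (fact l)\<close>.\<close>
  have "2 * t - 2 * ln t - 8 \<le> real l * (2 * ln t - 4 / t) - 2 * ((real l + 1) * ln (real l) - real l + 1)"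
  proof -
    have "real l * (4 / t) \<le> 4" using kl(2) t by (simp add: field_simps)
    moreover have "real l * ln (real l) \<le> real l * ln t" using lnl by (intro mult_left_mono) auto
    ultimately show ?thesis using lnl kl(3) by (simp add: algebra_simps)
  qed
  also have "\<dots> \<le> real l * ln (t\<^sup>2 * (1 - 2 / t)) - 2 * ln (fact l)"
    using lnb ln_fact_le[OF kl(4)] mult_left_mono[OF lnb, of "real l"] by simp
  finally have "exp (2 * t - 2 * ln t - 8) \<le> exp (real l * ln (t\<^sup>2 * (1 - 2 / t)) - 2 * ln (fact l))" by simp
  also have "\<dots> = (t\<^sup>2 * (1 - 2 / t)) ^ l / (fact l * fact l)"
    using t pos by (simp add: exp_diff exp_of_nat_mult exp_double power2_eq_square)
  also have "\<dots> \<le> ((real k - real l) * s) ^ l / (fact l * fact l)"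
    using base pos by (intro divide_right_mono power_mono) auto
  also have "\<dots> = (real k - real l) ^ l / fact l * (s ^ l / fact l)"
    by (simp add: power_mult_distrib)
  also have "\<dots> \<le> real (k choose l) * (s ^ l / fact l)"
    using binomial_ge_power_diff[OF lk] s by (intro mult_right_mono) auto
  finally show "exp (2 * t - 2 * ln t - 8) \<le> real (k choose l) * (s ^ l / fact l)" .
qed

text \<open>From \<open>Y \<ge> (ln q)^3\<close> on, the main term \<open>Y / (D * ln q)\<close> can
  absorb the constant \<open>D\<close> and the \<open>2 * ln q\<close> lost to divisors of
  \<open>q\<close>, at the cost of one more logarithm in the denominator.\<close>

lemma coprime_count_eventually:
  "\<forall>\<^sub>F q in sequentially. \<forall>Y. (ln (real q)) ^ 3 \<le> Y \<and> Y \<le> real q \<longrightarrow> Y / (ln (real q))\<^sup>2 \<le> real (coprime_count q Y)"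
proof -
  obtain C where C: "C > 0" "\<And>x. x \<ge> 1 \<Longrightarrow> \<bar>(\<Sum>p | prime p \<and> real p \<le> x. ln (real p) / real p) - ln x\<bar> \<le> C"
    using mertens by blast
  define D where "D = exp (2 * C + 1)"
  have D: "D > 1" using C by (simp add: D_def)
  have "filterlim (\<lambda>q. ln (real q)) at_top sequentially" by real_asymp
  then have "\<forall>\<^sub>F q in sequentially. ln (real q) \<ge> 3 * D" unfolding filterlim_at_top by blast
  then show ?thesis
  proof eventually_elim
    case (elim q)
    define L where "L = ln (real q)"
    have L: "L \<ge> 3 * D" "L > 1" using elim D by (simp_all add: L_def)
    show ?case unfolding L_def[symmetric]
    proof (intro allI impI)
      fix Y assume Y: "L ^ 3 \<le> Y \<and> Y \<le> real q"
      have "L \<le> L ^ 3" using L power_increasing[of 1 3 L] by simp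
      then have "Y \<ge> exp (2 * C + 1)" using Y L D unfolding D_def[symmetric] by linarith
      then have cc: "Y / (D * L) - 2 * L \<le> real (coprime_count q Y)"
        using coprime_count_ge[OF C(2), of Y q] C(1) Y unfolding D_def L_def by blast
      have "2 * L \<le> L ^ 3 * (1 / (D * L) - 1 / L\<^sup>2)"
      proof -
        have "L ^ 3 * (1 / (D * L) - 1 / L\<^sup>2) = L * (L / D - 1)"
          using L D by (simp add: field_simps power2_eq_square power3_eq_cube)
        moreover have "L / D \<ge> 3" using L D by (simp add: field_simps)
        ultimately show ?thesis using L mult_left_mono[of 2 "L / D - 1" L] by simp
      qed
      also have "\<dots> \<le> Y * (1 / (D * L) - 1 / L\<^sup>2)"
      proof (rule mult_right_mono)
        have "D * L \<le> L * L" using L D by (intro mult_right_mono) auto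
        then show "0 \<le> 1 / (D * L) - 1 / L\<^sup>2" using L D by (simp add: frac_le power2_eq_square)
      qed (use Y in simp)
      finally show "Y / L\<^sup>2 \<le> real (coprime_count q Y)" using cc by (simp add: algebra_simps)
    qed
  qed
qed

text \<open>Replacing \<open>ln p\<close> by its maximum on the block yields
  \<open>eta / (1 + eta)\<close> in place of \<open>ln (1 + eta)\<close>, a loss of second order in
  \<open>eta\<close>. The primes of this range that divide \<open>q\<close> exceed
  \<open>ln q\<close> and number at most \<open>ln q / U\<close>, so they contribute at most
  \<open>1 / U\<close>.\<close>

lemma sum_inverse_primes_block:
  assumes C: "\<And>x. x \<ge> 1 \<Longrightarrow> \<bar>(\<Sum>p | prime p \<and> real p \<le> x. ln (real p) / real p) - ln x\<bar> \<le> C"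
    and q: "real q > 1" "ln (real q) > 1" and U: "U = ln (ln (real q))"
    and a: "a \<ge> 1" "eta > 0" "C > 0" and Ularge: "U > 0"
  shows "eta / (1 + eta) - (2 * C + 1) / U
    \<le> (\<Sum>p | prime p \<and> \<not> p dvd q \<and> exp (a * U) < real p \<and> real p \<le> exp ((1 + eta) * a * U). 1 / real p)"
proof -
  define x where "x = exp (a * U)"
  define y where "y = exp ((1 + eta) * a * U)"
  have L: "exp U = ln (real q)" using q by (simp add: U)
  have Ux: "U \<le> a * U" using a Ularge by simp
  then have xL: "ln (real q) \<le> x" unfolding x_def L[symmetric] by simp
  have "a * U \<le> (1 + eta) * a * U" using a Ularge by (simp add: algebra_simps)
  then have xy: "1 \<le> x" "x \<le> y" using a Ularge by (simp_all add: x_def y_def)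
  let ?A = "{p. prime p \<and> x < real p \<and> real p \<le> y}" and ?B = "{p. prime p \<and> p dvd q \<and> x < real p}"
  let ?P = "{p. prime p \<and> \<not> p dvd q \<and> x < real p \<and> real p \<le> y}"
  have finA: "finite ?A" by (rule finite_subset[OF _ finite_primes_le[of y]]) auto
  have finP: "finite ?P" by (rule finite_subset[OF _ finA]) auto
  have finB: "finite ?B" by (rule finite_subset[of _ "{..q}"]) (use q in \<open>auto dest: dvd_imp_le\<close>)
  have lny: "ln y = (1 + eta) * a * U" "ln x = a * U" by (simp_all add: x_def y_def)
  have lny0: "ln y > 0" unfolding lny using a Ularge by simp
  have "eta * a * U - 2 * C \<le> (\<Sum>p\<in>?A. ln (real p) / real p)"
    using sum_primes_between[OF C xy] lny by (simp add: algebra_simps)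
  also have "\<dots> \<le> (\<Sum>p\<in>?A. ln y * (1 / real p))"
  proof (rule sum_mono)
    fix p assume p: "p \<in> ?A"
    then have "ln (real p) \<le> ln y" using xy by (subst ln_le_cancel_iff) auto
    then show "ln (real p) / real p \<le> ln y * (1 / real p)" by (simp add: divide_right_mono)
  qed
  also have "\<dots> = ln y * (\<Sum>p\<in>?A. 1 / real p)" by (simp add: sum_distrib_left)
  finally have "(eta * a * U - 2 * C) / ln y \<le> (\<Sum>p\<in>?A. 1 / real p)"
    using lny0 by (simp add: field_simps)
  moreover have "(eta * a * U - 2 * C) / ln y \<ge> eta / (1 + eta) - 2 * C / U"
  proof -
    have "eta * a * U / ln y = eta / (1 + eta)" unfolding lny
      using a Ularge mult_divide_mult_cancel_right[of "a * U" eta "1 + eta"] by (simp add: mult.assoc)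
    moreover have "2 * C / ln y \<le> 2 * C / U"
    proof -
      have "U \<le> ln y" unfolding lny using Ux \<open>a * U \<le> (1 + eta) * a * U\<close> by linarith
      then show ?thesis using a Ularge by (intro divide_left_mono) auto
    qed
    ultimately show ?thesis by (simp add: diff_divide_distrib)
  qed
  moreover have "(\<Sum>p\<in>?A. 1 / real p) \<le> (\<Sum>p\<in>?P. 1 / real p) + (\<Sum>p\<in>?B. 1 / real p)"
  proof -
    have "(\<Sum>p\<in>?A. 1 / real p) \<le> (\<Sum>p\<in>?P \<union> ?B. 1 / real p)"
      using finP finB by (intro sum_mono2) auto
    also have "\<dots> = (\<Sum>p\<in>?P. 1 / real p) + (\<Sum>p\<in>?B. 1 / real p)"
      using finP finB by (intro sum.union_disjoint) auto
    finally show ?thesis .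
  qed
  moreover have "(\<Sum>p\<in>?B. 1 / real p) \<le> 1 / U"
  proof -
    have "(\<Sum>p\<in>?B. 1 / real p) \<le> real (card ?B) * (1 / ln (real q))"
      using xL q by (intro sum_bounded_above frac_le) auto
    moreover have "real (card ?B) * U \<le> ln (real q)"
    proof -
      have "real (card ?B) * U \<le> real (card ?B) * ln x" using Ux lny by (intro mult_left_mono) auto
      also have "\<dots> \<le> ln (real q)" using q xy by (intro card_prime_divisors_gt) auto
      finally show ?thesis .
    qed
    then have "real (card ?B) * (1 / ln (real q)) \<le> 1 / U"
      using q Ularge by (simp add: field_simps)
    ultimately show ?thesis by linarith
  qed
  ultimately have "eta / (1 + eta) - 2 * C / U - 1 / U \<le> (\<Sum>p\<in>?P. 1 / real p)" by linarith
  then show ?thesis unfolding x_def y_def by (simp add: add_divide_distrib)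
qed

text \<open>\<open>L\<close> stands for \<open>ln q\<close>. The third clause makes room in
  \<open>N\<close> for the exchanged primes: the triple logarithm beats the constant
  \<open>c\<close>. The fourth keeps all logarithmic losses below the permitted one, and the fifth
  makes every \<open>t i\<close> at least 4.\<close>

lemma real_eventually_conditions:
  fixes c d e J k K M :: real
  assumes "d > 0" "e > 0" "M > 0"
  shows "\<forall>\<^sub>F L in at_top. L \<ge> 6 \<and> ln L \<ge> K \<and>
     3 * ln L + c * sqrt (L * ln L) \<le> sqrt (L * ln L) * ln (ln L) \<and>
     J * (2 * ln L + k) + 4 * ln L \<le> d * sqrt (e * L / ln L) \<and>
     4 \<le> M * sqrt (e * L / ln L)"
proof (intro eventually_conj)
  show "\<forall>\<^sub>F L in at_top. L \<ge> (6::real)" by (rule eventually_ge_at_top)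
  show "\<forall>\<^sub>F L::real in at_top. ln L \<ge> K" by real_asymp
  show "\<forall>\<^sub>F L::real in at_top. 3 * ln L + c * sqrt (L * ln L) \<le> sqrt (L * ln L) * ln (ln L)"
    by real_asymp
  show "\<forall>\<^sub>F L::real in at_top. J * (2 * ln L + k) + 4 * ln L \<le> d * sqrt (e * L / ln L)"
    using assms by real_asymp
  show "\<forall>\<^sub>F L::real in at_top. 4 \<le> M * sqrt (e * L / ln L)"
    using assms by real_asymp
qed

text \<open>\<open>t i\<close> is taken proportional to \<open>1 / a i\<close>, the optimum under
  the size budget, and scaled so that the budget \<open>ln X\<close> is used up.
  \<open>delta\<close> pays for stopping after finitely many blocks, for their positive width and
  for logarithmic factors; the last are affordable because
  \<open>ln X \<ge> eps * ln q\<close>.\<close>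

theorem resonator_exists:
  fixes delta eps :: real
  assumes delta: "0 < delta" "delta \<le> 1" and eps: "0 < eps"
  shows "\<forall>\<^sub>F q in sequentially. \<forall>X N. 0 < X \<and> eps * ln (real q) \<le> ln X \<and> ln X \<le> ln (real q) \<and>
     0 < N \<and> N \<le> real q \<and> sqrt (ln (real q) * ln (ln (real q))) * ln (ln (ln (real q))) \<le> ln N \<longrightarrow>
     (\<exists>S. resonator_set q X S \<and> N * exp (2 * (1 - delta) * sqrt (ln X / ln (ln (real q)))) * (\<Sum>n\<in>S. 1 / real n) \<le> resonance q N S)"
proof -
  obtain C where C: "C > 0" "\<And>x. x \<ge> 1 \<Longrightarrow> \<bar>(\<Sum>p | prime p \<and> real p \<le> x. ln (real p) / real p) - ln x\<bar> \<le> C"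
    using mertens by blast
  define eta where "eta = delta / 8"
  define r where "r = 1 / (1 + eta)"
  have eta: "eta > 0" "eta \<le> 1" using delta by (simp_all add: eta_def)
  have r: "0 < r" "r < 1" using eta by (simp_all add: r_def)
  \<comment> \<open>Stopping the geometric series after \<open>J\<close> blocks costs the factor
    \<open>1 - r ^ J\<close>, and the width of the blocks costs \<open>r^2\<close>. Each is at least
    \<open>1 - delta / 2\<close>, the second one by the choice of \<open>eta\<close>.\<close>
  obtain J where J: "r ^ J < delta / 2" using real_arch_pow_inv[of "delta / 2" r] r delta by auto
  then have J1: "J \<ge> 1" using delta by (cases J) auto
  define a where "a i = (1 + eta) ^ i" for i :: nat
  have a: "a i \<ge> 1" for i using eta by (simp add: a_def)
  have a_Suc: "a (Suc i) = (1 + eta) * a i" for i by (simp add: a_def)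
  \<comment> \<open>Below the limiting block mass \<open>eta / (1 + eta)\<close> by the margin
    \<open>eta^2 / (1 + eta)^2\<close>, which covers the errors in Mertens' theorem and the
    \<open>k i\<close> primes already in use.\<close>
  define s where "s = eta / (1 + eta)\<^sup>2"
  have "(1 + eta)\<^sup>2 \<ge> 1" using eta by simp
  then have s: "0 < s" "s \<le> 1" using eta by (simp_all add: s_def field_simps) (simp add: power2_eq_square algebra_simps)
  \<comment> \<open>\<open>lam * B\<close> will be the sum of the \<open>t i\<close>, and
    \<open>lam^2 * (1 + eta) * B * U\<close> the bound for the logarithm of the resonator
    elements.\<close>
  define B where "B = s * (\<Sum>i<J. 1 / a i)"
  have sB: "s \<le> B"
  proof -
    have "(\<Sum>i\<in>{0}. 1 / a i) \<le> (\<Sum>i<J. 1 / a i)"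
      using J1 a by (intro sum_mono2) (auto intro: order_trans[of 0 1])
    then have "1 \<le> (\<Sum>i<J. 1 / a i)" by (simp add: a_def)
    then show ?thesis using s mult_left_mono[of 1 "\<Sum>i<J. 1 / a i" s] by (simp add: B_def)
  qed
  then have B: "B > 0" using s by simp
  have B_eq: "B / (1 + eta) = (1 - r ^ J) * r\<^sup>2"
  proof -
    have "(\<Sum>i<J. 1 / a i) = (\<Sum>i<J. r ^ i)" by (simp add: a_def r_def power_one_over)
    also have "\<dots> = (1 - r ^ J) / (1 - r)" using r by (subst sum_gp_strict) auto
    also have "1 - r = eta / (1 + eta)" using eta by (simp add: r_def field_simps)
    finally show ?thesis using eta by (simp add: B_def s_def r_def power2_eq_square)
  qed
  have B_ge: "sqrt (B / (1 + eta)) \<ge> 1 - delta / 2"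
  proof -
    have "(1 + eta)\<^sup>2 * (1 - delta / 2) \<le> (1 + delta / 2) * (1 - delta / 2)"
    proof (rule mult_right_mono)
      have "delta * delta \<le> delta" using delta by (simp add: mult_left_le)
      moreover have "(1 + eta)\<^sup>2 = 1 + delta / 4 + delta * delta / 64"
        by (simp add: eta_def power2_eq_square algebra_simps)
      ultimately show "(1 + eta)\<^sup>2 \<le> 1 + delta / 2" using delta by linarith
    qed (use delta in simp)
    also have "\<dots> \<le> 1" by (simp add: algebra_simps)
    finally have "1 - delta / 2 \<le> r\<^sup>2"
      using eta by (simp add: r_def power_one_over field_simps)
    then have "(1 - delta / 2) * (1 - delta / 2) \<le> (1 - r ^ J) * r\<^sup>2"
      using J delta by (intro mult_mono) auto
    then have "(1 - delta / 2)\<^sup>2 \<le> B / (1 + eta)" by (simp only: B_eq power2_eq_square)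
    then show ?thesis by (rule real_le_rsqrt)
  qed
  \<comment> \<open>Makes \<open>lam = \<kappa> * sqrt (ln X / U)\<close> the solution of
    \<open>lam^2 * (1 + eta) * B * U = ln X\<close>.\<close>
  define \<kappa> where "\<kappa> = 1 / sqrt ((1 + eta) * B)"
  have \<kappa>: "\<kappa> > 0" "\<kappa>\<^sup>2 = 1 / ((1 + eta) * B)" using eta B by (simp_all add: \<kappa>_def power_one_over)
  \<comment> \<open>The first entry puts \<open>(2 * C + 2) / U\<close> below the margin left in
    \<open>s\<close>; the second gives \<open>J / U \<le> 1 / 2\<close>, the bound needed for the
    totients.\<close>
  define K0 where "K0 = max (max ((2 * C + 2) * (1 + eta)\<^sup>2 / eta\<^sup>2) (2 * real J)) 1"
  have "filterlim (\<lambda>q. ln (real q)) at_top sequentially" by real_asymp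
  moreover have "\<kappa> * s / (1 + eta) ^ J > 0" using \<kappa> s eta by simp
  note real_eventually_conditions[OF delta(1) eps this, of K0 "real J * s * (1 + eta) * \<kappa>" "real J" "2 * \<bar>ln \<kappa>\<bar> + 8"]
  ultimately have "\<forall>\<^sub>F q in sequentially. (\<lambda>L. L \<ge> 6 \<and> ln L \<ge> K0 \<and>
     3 * ln L + real J * s * (1 + eta) * \<kappa> * sqrt (L * ln L) \<le> sqrt (L * ln L) * ln (ln L) \<and>
     real J * (2 * ln L + (2 * \<bar>ln \<kappa>\<bar> + 8)) + 4 * ln L \<le> delta * sqrt (eps * L / ln L) \<and>
     4 \<le> \<kappa> * s / (1 + eta) ^ J * sqrt (eps * L / ln L)) (ln (real q))"
    by (rule eventually_compose_filterlim[rotated])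
  with coprime_count_eventually show ?thesis
  proof eventually_elim
    case (elim q)
    define L where "L = ln (real q)"
    define U where "U = ln L"
    have L: "L \<ge> 6" "U \<ge> K0"
      "3 * U + real J * s * (1 + eta) * \<kappa> * sqrt (L * U) \<le> sqrt (L * U) * ln U"
      "real J * (2 * U + (2 * \<bar>ln \<kappa>\<bar> + 8)) + 4 * U \<le> delta * sqrt (eps * L / U)"
      "4 \<le> \<kappa> * s / (1 + eta) ^ J * sqrt (eps * L / U)"
      and cc: "\<And>Y. L ^ 3 \<le> Y \<Longrightarrow> Y \<le> real q \<Longrightarrow> Y / L\<^sup>2 \<le> real (coprime_count q Y)"
      using elim by (auto simp: L_def U_def)
    have "real q > 0" using L(1) by (cases "q = 0") (auto simp: L_def)
    then have q: "real q > 1" "ln (real q) > 1"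
      using L(1) ln_gt_zero_iff[of "real q"] unfolding L_def by linarith+
    have U: "U \<ge> (2 * C + 2) * (1 + eta)\<^sup>2 / eta\<^sup>2" "U \<ge> 2 * real J" "U \<ge> 1"
      using L(2) by (simp_all add: K0_def)
    have eU: "exp U = L" using L(1) by (simp add: U_def)
    show ?case unfolding L_def[symmetric] U_def[symmetric]
    proof (intro allI impI)
      fix X N :: real
      assume "0 < X \<and> eps * L \<le> ln X \<and> ln X \<le> L \<and> 0 < N \<and> N \<le> real q \<and> sqrt (L * U) * ln U \<le> ln N"
      then have X: "0 < X" "eps * L \<le> ln X" "ln X \<le> L"
        and N: "0 < N" "N \<le> real q" "sqrt (L * U) * ln U \<le> ln N" by auto
      have lnX: "ln X > 0" using X(2) eps L(1) mult_pos_pos[of eps L] by linarith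
      then have X1: "X \<ge> 1" using X(1) by (simp add: ln_ge_zero_iff[symmetric] del: ln_ge_zero_iff)
      define \<Lambda> where "\<Lambda> = sqrt (ln X / U)"
      define lam where "lam = \<kappa> * \<Lambda>"
      have \<Lambda>: "\<Lambda> > 0" "sqrt (eps * L / U) \<le> \<Lambda>" "\<Lambda> \<le> sqrt (L / U)" "\<Lambda>\<^sup>2 = ln X / U"
        using lnX U(3) X by (auto simp: \<Lambda>_def divide_right_mono)
      have lam: "lam > 0" using \<kappa> \<Lambda> by (simp add: lam_def)
      have lam2: "lam\<^sup>2 * ((1 + eta) * B * U) = ln X"
        using \<kappa>(2) \<Lambda>(4) eta B U(3) by (simp add: lam_def power_mult_distrib)
      define t where "t i = lam * s / a i" for i
      define k where "k i = nat \<lfloor>(t i)\<^sup>2 / s\<rfloor>" for i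
      define l where "l i = nat \<lfloor>t i\<rfloor>" for i
      define b where "b i = (1 + eta) * a i * U" for i
      define P where "P i = {p. prime p \<and> \<not> p dvd q \<and> exp (a i * U) < real p \<and> real p \<le> exp ((1 + eta) * a i * U)}" for i
      have t_ge: "t i \<ge> 4" if "i < J" for i
      proof -
        have "4 \<le> \<kappa> * s / (1 + eta) ^ J * \<Lambda>"
          using L(5) \<Lambda>(2) \<kappa> s eta by (smt (verit, ccfv_SIG) mult_left_mono divide_nonneg_pos mult_pos_pos zero_less_power)
        also have "\<dots> = lam * s / a J" by (simp add: lam_def a_def)
        also have "\<dots> \<le> t i"
          unfolding t_def using lam s a[of i] eta that
          by (intro divide_left_mono) (auto simp: a_def power_increasing)
        finally show ?thesis .
      qed
      have t_le: "t i \<le> lam" for i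
      proof -
        have "lam * s \<le> lam" using lam s by (simp add: mult_left_le)
        also have "\<dots> \<le> lam * a i" using lam a[of i] by simp
        finally show ?thesis using a[of i] by (simp add: t_def field_simps)
      qed
      have sum_t: "(\<Sum>i<J. t i) = lam * B" by (simp add: t_def B_def sum_distrib_left)
      have k_le: "real (k i) \<le> lam\<^sup>2 * s / (a i)\<^sup>2" for i
      proof -
        have "(t i)\<^sup>2 / s = lam\<^sup>2 * s / (a i)\<^sup>2"
          using s by (simp add: t_def power_divide power_mult_distrib power2_eq_square)
        then show ?thesis unfolding k_def using s by (simp add: of_nat_floor)
      qed
      have l_le: "real (l i) \<le> t i" if "i < J" for i
        unfolding l_def using t_ge[OF that] by (intro of_nat_floor) simp
      \<comment> \<open>A single block already obeys the size budget, so
        \<open>k i * U \<le> L\<close>; since its primes are at least \<open>L\<close>, those in use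
        carry at most \<open>1 / U\<close> of the mass.\<close>
      have kL: "real (k i) / L \<le> 1 / U" for i
      proof -
        have "1 \<le> (a i)\<^sup>2" using a[of i] by simp
        then have "lam\<^sup>2 * s / (a i)\<^sup>2 \<le> lam\<^sup>2 * s / 1" using s by (intro divide_left_mono) auto
        then have "real (k i) \<le> lam\<^sup>2 * s" using k_le[of i] by simp
        then have "real (k i) * U \<le> lam\<^sup>2 * s * U" using U(3) by (intro mult_right_mono) auto
        also have "\<dots> \<le> lam\<^sup>2 * ((1 + eta) * B * U)"
        proof -
          have "1 * s \<le> (1 + eta) * B" using eta s sB by (intro mult_mono) auto
          then have "lam\<^sup>2 * (s * U) \<le> lam\<^sup>2 * ((1 + eta) * B * U)"
            using U(3) by (intro mult_left_mono mult_right_mono) auto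
          then show ?thesis by (simp add: mult.assoc)
        qed
        also have "\<dots> \<le> L" using lam2 X(3) by simp
        finally show ?thesis using L(1) U(3) by (simp add: field_simps)
      qed
      \<comment> \<open>\<open>t i * b i\<close> has the same value for all blocks, and the
        exchanged part has logarithm at most \<open>J\<close> times that value.\<close>
      define Z where "Z = exp (real J * s * (1 + eta) * \<kappa> * sqrt (L * U))"
      have "\<exists>S. resonator_set q X S \<and> N / (2 * L\<^sup>2 * (ln X + 1)) * ((\<Prod>i\<in>{..<J}. real (k i choose l i) * (s ^ l i / fact (l i))) / 2) * (\<Sum>n\<in>S. 1 / real n)
           \<le> resonance q N S"
      proof (rule exists_resonator[where P = P and b = b and ?y0.0 = L and Z = Z and ?Y0.0 = "L ^ 3"])
        show "finite (P i)" for i unfolding P_def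
          by (rule finite_subset[OF _ finite_primes_le[of "exp ((1 + eta) * a i * U)"]]) auto
        have lt: "P i \<inter> P j = {}" if "i < j" for i j
        proof -
          have "(1 + eta) * a i \<le> a j"
            using power_increasing[of "Suc i" j "1 + eta"] that eta by (simp add: a_def)
          then have "exp ((1 + eta) * a i * U) \<le> exp (a j * U)" using U(3) by (simp add: mult_right_mono)
          then have "real p' < real p" if "p' \<in> P i" "p \<in> P j" for p p'
            using that unfolding P_def mem_Collect_eq by linarith
          then show ?thesis by blast
        qed
        show "disjoint_family_on P {..<J}"
          unfolding disjoint_family_on_def using lt by (metis inf_commute linorder_neqE_nat)
        show "prime p \<and> \<not> p dvd q \<and> L \<le> real p \<and> ln (real p) \<le> b i" if "p \<in> P i" for i p
        proof -
          have p: "prime p" "\<not> p dvd q" "exp (a i * U) < real p" "real p \<le> exp ((1 + eta) * a i * U)"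
            using that by (auto simp: P_def)
          have "exp U \<le> exp (a i * U)" using a[of i] U(3) by simp
          then have "L \<le> real p" using p(3) eU by linarith
          moreover have "ln (real p) \<le> ln (exp ((1 + eta) * a i * U))"
            using p(4) prime_gt_0_nat[OF p(1)] by (subst ln_le_cancel_iff) auto
          ultimately show ?thesis using p by (simp add: b_def)
        qed
        show "l i \<le> k i" if "i \<in> {..<J}" for i
          using block_gain(1)[OF s t_ge k_def l_def] that by blast
        show "s + real (k i) / L \<le> (\<Sum>p\<in>P i. 1 / real p)" if "i \<in> {..<J}" for i
        proof -
          have "eta / (1 + eta) - (2 * C + 1) / U \<le> (\<Sum>p\<in>P i. 1 / real p)"
            unfolding P_def
            by (rule sum_inverse_primes_block[OF C(2)]) (use q U a eta C in \<open>auto simp: U_def L_def\<close>)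
          moreover have "s + (2 * C + 2) / U \<le> eta / (1 + eta)"
          proof -
            have "(2 * C + 2) / U \<le> eta\<^sup>2 / (1 + eta)\<^sup>2"
              using U(1,3) eta by (simp add: field_simps)
            moreover have "eta / (1 + eta) = s + eta\<^sup>2 / (1 + eta)\<^sup>2"
            proof -
              have "eta / (1 + eta) = eta * (1 + eta) / (1 + eta)\<^sup>2" using eta by (simp add: power2_eq_square)
              also have "\<dots> = s + eta\<^sup>2 / (1 + eta)\<^sup>2"
                by (simp add: s_def add_divide_distrib[symmetric] power2_eq_square algebra_simps)
              finally show ?thesis .
            qed
            ultimately show ?thesis by linarith
          qed
          moreover have "(2 * C + 2) / U = (2 * C + 1) / U + 1 / U" by (simp add: add_divide_distrib[symmetric])
          ultimately show ?thesis using kL[of i] by linarith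
        qed
        show "(\<Sum>i<J. real (k i) / L) \<le> 1 / 2"
        proof -
          have "(\<Sum>i<J. real (k i) / L) \<le> (\<Sum>i<J. 1 / U)" by (intro sum_mono kL)
          also have "\<dots> \<le> 1 / 2" using U(2,3) by (simp add: field_simps)
          finally show ?thesis .
        qed
        show "(\<Sum>i<J. real (k i) * b i) \<le> ln X"
        proof -
          have "(\<Sum>i<J. real (k i) * b i) \<le> (\<Sum>i<J. lam\<^sup>2 * s / (a i)\<^sup>2 * b i)"
          proof (intro sum_mono mult_right_mono k_le)
            fix i show "0 \<le> b i" using eta a[of i] U(3) by (simp add: b_def)
          qed
          also have "\<dots> = (\<Sum>i<J. lam\<^sup>2 * (1 + eta) * U * s * (1 / a i))"
          proof (rule sum.cong[OF refl])
            fix i show "lam\<^sup>2 * s / (a i)\<^sup>2 * b i = lam\<^sup>2 * (1 + eta) * U * s * (1 / a i)"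
              using a[of i] by (simp add: b_def power2_eq_square)
          qed
          also have "\<dots> = lam\<^sup>2 * ((1 + eta) * B * U)"
            unfolding B_def sum_distrib_left[symmetric] by (simp only: mult_ac)
          finally show ?thesis using lam2 by simp
        qed
        show "(\<Sum>i<J. real (l i) * b i) \<le> ln Z"
        proof -
          have "(\<Sum>i<J. real (l i) * b i) \<le> (\<Sum>i<J. t i * b i)"
          proof (intro sum_mono mult_right_mono)
            fix i assume "i \<in> {..<J}"
            then show "real (l i) \<le> t i" using l_le by simp
            show "0 \<le> b i" using eta a[of i] U(3) by (simp add: b_def)
          qed
          also have "\<dots> = (\<Sum>i<J. lam * s * (1 + eta) * U)"
          proof (rule sum.cong[OF refl])
            fix i show "t i * b i = lam * s * (1 + eta) * U" using a[of i] by (simp add: b_def t_def)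
          qed
          also have "\<dots> = real J * s * (1 + eta) * \<kappa> * (\<Lambda> * U)" by (simp add: lam_def)
          also have "\<dots> \<le> real J * s * (1 + eta) * \<kappa> * sqrt (L * U)"
          proof (rule mult_left_mono)
            have "\<Lambda> * U \<le> sqrt (L / U) * U" using \<Lambda>(3) U(3) by (intro mult_right_mono) auto
            also have "\<dots> = sqrt (L / U * U\<^sup>2)" using U(3) by (subst real_sqrt_mult) simp
            also have "L / U * U\<^sup>2 = L * U" using U(3) by (simp add: power2_eq_square)
            finally show "\<Lambda> * U \<le> sqrt (L * U)" .
          qed (use s eta \<kappa> in auto)
          finally show ?thesis by (simp add: Z_def)
        qed
        show "L ^ 3 * Z \<le> N"
        proof -
          have "L ^ 3 * Z = exp (3 * U + real J * s * (1 + eta) * \<kappa> * sqrt (L * U))"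
            unfolding exp_add Z_def eU[symmetric] by (simp add: exp_of_nat_mult[symmetric])
          also have "\<dots> \<le> exp (ln N)" using L(3) N(3) by simp
          finally show ?thesis using N(1) by simp
        qed
        show "Y / L\<^sup>2 \<le> real (coprime_count q Y)" if "L ^ 3 \<le> Y" "Y \<le> N" for Y
          using cc[of Y] that N(2) by simp
      qed (use s L(1) X1 N(1) in \<open>auto simp: Z_def\<close>)
      moreover have "N * exp (2 * (1 - delta) * \<Lambda>)
          \<le> N / (2 * L\<^sup>2 * (ln X + 1)) * ((\<Prod>i\<in>{..<J}. real (k i choose l i) * (s ^ l i / fact (l i))) / 2)"
      proof -
        \<comment> \<open>Of the loss \<open>2 * delta * \<Lambda>\<close>, one half covers
          \<open>B / (1 + eta) < 1\<close>, the other half the logarithmic terms. Among these,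
          \<open>4 * U\<close> is a reserve of \<open>L ^ 4\<close> for the factor
          \<open>2 * L^2 * (ln X + 1) * 2\<close> in the denominator.\<close>
        have "2 * (1 - delta) * \<Lambda> + 4 * U \<le> (\<Sum>i<J. 2 * t i - 2 * ln (t i) - 8)"
        proof -
          have "(\<Sum>i<J. 2 * t i - 2 * ln lam - 8) \<le> (\<Sum>i<J. 2 * t i - 2 * ln (t i) - 8)"
          proof (rule sum_mono)
            fix i assume "i \<in> {..<J}"
            then have "ln (t i) \<le> ln lam" using t_le[of i] t_ge[of i] lam by (subst ln_le_cancel_iff) auto
            then show "2 * t i - 2 * ln lam - 8 \<le> 2 * t i - 2 * ln (t i) - 8" by simp
          qed
          moreover have "(\<Sum>i<J. 2 * t i - 2 * ln lam - 8) = 2 * (lam * B) - real J * (2 * ln lam + 8)"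
            unfolding sum_subtractf sum_distrib_left[symmetric] sum_t by (simp add: algebra_simps)
          moreover have "lam * B = \<Lambda> * sqrt (B / (1 + eta))"
          proof -
            have "sqrt (B / (1 + eta)) = \<kappa> * B"
            proof (rule real_sqrt_unique)
              show "(\<kappa> * B)\<^sup>2 = B / (1 + eta)"
                unfolding power_mult_distrib \<kappa>(2) using B eta by (simp add: power2_eq_square)
            qed (use \<kappa> B in simp)
            then show ?thesis by (simp add: lam_def)
          qed
          moreover have "\<Lambda> * (1 - delta / 2) \<le> \<Lambda> * sqrt (B / (1 + eta))"
            using B_ge \<Lambda>(1) by (intro mult_left_mono) auto
          moreover have "real J * (2 * ln lam + 8) + 4 * U \<le> delta * \<Lambda>"
          proof -
            have "ln \<Lambda> \<le> U"
            proof -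
              have "L / U \<le> L\<^sup>2"
              proof -
                have "L * 1 \<le> L * (L * U)" using L(1) U(3) mult_mono[of 1 L 1 U] by (intro mult_left_mono) auto
                then show ?thesis using U(3) by (simp add: field_simps power2_eq_square)
              qed
              then have "sqrt (L / U) \<le> L" using L(1) by (intro real_le_lsqrt) auto
              then have "\<Lambda> \<le> L" using \<Lambda>(3) by linarith
              then show ?thesis unfolding U_def using \<Lambda>(1) L(1) by simp
            qed
            then have "ln lam \<le> U + \<bar>ln \<kappa>\<bar>" using \<kappa>(1) \<Lambda>(1) by (simp add: lam_def ln_mult)
            then have "real J * (2 * ln lam + 8) \<le> real J * (2 * U + (2 * \<bar>ln \<kappa>\<bar> + 8))"
              by (intro mult_left_mono) auto
            moreover have "delta * sqrt (eps * L / U) \<le> delta * \<Lambda>"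
              using \<Lambda>(2) delta by (intro mult_left_mono) auto
            ultimately show ?thesis using L(4) by linarith
          qed
          ultimately show ?thesis by (simp add: algebra_simps)
        qed
        then have "exp (2 * (1 - delta) * \<Lambda> + 4 * U) \<le> exp (\<Sum>i<J. 2 * t i - 2 * ln (t i) - 8)" by simp
        also have "\<dots> = (\<Prod>i<J. exp (2 * t i - 2 * ln (t i) - 8))" by (simp add: exp_sum)
        also have "\<dots> \<le> (\<Prod>i<J. real (k i choose l i) * (s ^ l i / fact (l i)))"
          using block_gain(2)[OF s t_ge k_def l_def] by (intro prod_mono) auto
        finally have prod: "exp (2 * (1 - delta) * \<Lambda>) * L ^ 4 \<le> (\<Prod>i<J. real (k i choose l i) * (s ^ l i / fact (l i)))"
          unfolding exp_add eU[symmetric] by (simp add: exp_of_nat_mult[symmetric])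
        have "2 * L\<^sup>2 * (ln X + 1) * 2 \<le> L ^ 4"
        proof -
          have "2 * L\<^sup>2 * (ln X + 1) * 2 \<le> L\<^sup>2 * (4 * (L + 1))" using X(3) mult_left_mono[of "4 * (ln X + 1)" "4 * (L + 1)" "L\<^sup>2"]
            by (simp add: algebra_simps)
          also have "\<dots> \<le> L\<^sup>2 * L\<^sup>2"
          proof (rule mult_left_mono)
            have "6 * L \<le> L * L" using L(1) by (intro mult_right_mono) auto
            moreover have "4 * (L + 1) \<le> 6 * L" using L(1) by simp
            ultimately show "4 * (L + 1) \<le> L\<^sup>2" unfolding power2_eq_square by (rule order_trans[rotated])
          qed simp
          also have "\<dots> = L ^ 4" by (simp flip: power_add)
          finally show ?thesis .
        qed
        then have "exp (2 * (1 - delta) * \<Lambda>) * (2 * L\<^sup>2 * (ln X + 1) * 2)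
            \<le> (\<Prod>i<J. real (k i choose l i) * (s ^ l i / fact (l i)))"
          using prod mult_left_mono[of "2 * L\<^sup>2 * (ln X + 1) * 2" "L ^ 4" "exp (2 * (1 - delta) * \<Lambda>)"]
          by (meson exp_ge_zero order_trans)
        moreover have "2 * L\<^sup>2 * (ln X + 1) > 0" using L(1) lnX by simp
        ultimately have "exp (2 * (1 - delta) * \<Lambda>)
            \<le> (\<Prod>i<J. real (k i choose l i) * (s ^ l i / fact (l i))) / 2 / (2 * L\<^sup>2 * (ln X + 1))"
          by (simp add: pos_le_divide_eq mult_ac)
        then have "N * exp (2 * (1 - delta) * \<Lambda>)
            \<le> N * ((\<Prod>i<J. real (k i choose l i) * (s ^ l i / fact (l i))) / 2 / (2 * L\<^sup>2 * (ln X + 1)))"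
          using N(1) by (intro mult_left_mono) auto
        then show ?thesis by simp
      qed
      ultimately show "\<exists>S. resonator_set q X S \<and> N * exp (2 * (1 - delta) * sqrt (ln X / U)) * (\<Sum>n\<in>S. 1 / real n) \<le> resonance q N S"
        unfolding \<Lambda>_def[symmetric]
        by (elim exE conjE, intro exI conjI)
           (assumption+, erule order_trans[rotated], rule mult_right_mono, assumption, simp add: sum_nonneg)
    qed
  qed
qed

section \<open>Short sums\<close>

definition resonator_sum :: "nat set \<Rightarrow> (nat \<Rightarrow> complex) \<Rightarrow> complex" where
  "resonator_sum S chi = (\<Sum>n\<in>S. of_real (1 / sqrt (real n)) * chi n)"

definition char_sum :: "real \<Rightarrow> (nat \<Rightarrow> complex) \<Rightarrow> complex" where
  "char_sum N chi = (\<Sum>n\<in>{1..nat \<lfloor>N\<rfloor>}. chi n)"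

lemma norm_char_sum_le:
  assumes "dirichlet_char q chi" "N \<ge> 0"
  shows "cmod (char_sum N chi) \<le> N"
proof -
  have "cmod (char_sum N chi) \<le> (\<Sum>n\<in>{1..nat \<lfloor>N\<rfloor>}. 1)"
    unfolding char_sum_def using dirichlet_char_norm_le[OF assms(1)] by (intro sum_norm_le) auto
  also have "\<dots> \<le> N" using assms(2) by (simp add: of_nat_floor)
  finally show ?thesis .
qed

lemma norm_char_sum_le_Delta:
  assumes "dirichlet_char q chi" "chi \<noteq> principal_char q"
  shows "cmod (char_sum N chi) \<le> Delta N q"
  unfolding Delta_def char_sum_def
proof (rule cSup_upper)
  show "bdd_above {cmod (\<Sum>n\<in>{1..nat \<lfloor>N\<rfloor>}. chi n) | chi. dirichlet_char q chi \<and> chi \<noteq> principal_char q}"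
  proof (rule bdd_aboveI)
    fix x assume "x \<in> {cmod (\<Sum>n\<in>{1..nat \<lfloor>N\<rfloor>}. chi n) | chi. dirichlet_char q chi \<and> chi \<noteq> principal_char q}"
    then obtain psi where psi: "dirichlet_char q psi" "x = cmod (\<Sum>n\<in>{1..nat \<lfloor>N\<rfloor>}. psi n)" by blast
    have "x \<le> (\<Sum>n\<in>{1..nat \<lfloor>N\<rfloor>}. 1)"
      unfolding psi(2) using dirichlet_char_norm_le[OF psi(1)] by (intro sum_norm_le) auto
    then show "x \<le> real (nat \<lfloor>N\<rfloor>)" by simp
  qed
qed (use assms in blast)

text \<open>Guarantees that \<open>Delta\<close> is a supremum over a nonempty set; without this
  even its sign would be unclear.\<close>

lemma exists_nonprincipal_char:
  assumes "q > 1" "totient q > 1"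
  shows "\<exists>chi. dirichlet_char q chi \<and> chi \<noteq> principal_char q"
proof (rule ccontr)
  assume "\<not> ?thesis"
  then have "{chi. dirichlet_char q chi} \<subseteq> {principal_char q}" by blast
  then have "card {chi. dirichlet_char q chi} \<le> card {principal_char q}" by (intro card_mono) auto
  then show False using card_dirichlet_chars assms by simp
qed

lemma Delta_nonneg:
  assumes "q > 1" "totient q > 1"
  shows "Delta N q \<ge> 0"
  using exists_nonprincipal_char[OF assms] norm_char_sum_le_Delta norm_ge_zero order_trans by metis

section \<open>Second moments of the weighted character sums\<close>

lemma resonance_eq_sum:
  fixes q :: nat and N :: real
  assumes "finite S"
  defines "W \<equiv> {m \<in> {1..nat \<lfloor>N\<rfloor>}. coprime m q} \<times> S"
  shows "resonance q N S = (\<Sum>w\<in>W. \<Sum>v\<in>W. if fst w * snd w = fst v * snd v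
           then 1 / sqrt (real (snd w)) * (1 / sqrt (real (snd v))) else 0)"
proof -
  let ?C = "{m \<in> {1..nat \<lfloor>N\<rfloor>}. coprime m q}"
  let ?r = "\<lambda>n. 1 / sqrt (real n)"
  have cp: "(\<Sum>w\<in>W. F w) = (\<Sum>m\<in>?C. \<Sum>n\<in>S. F (m, n))" for F :: "nat \<times> nat \<Rightarrow> real"
    by (simp add: W_def sum.cartesian_product)
  have "?r n1 * ?r n2 * real (card (mult_pairs q N n1 n2))
      = (\<Sum>m1\<in>?C. \<Sum>m2\<in>?C. if m1 * n1 = m2 * n2 then ?r n1 * ?r n2 else 0)" for n1 n2
  proof -
    have "(\<Sum>m1\<in>?C. \<Sum>m2\<in>?C. if m1 * n1 = m2 * n2 then ?r n1 * ?r n2 else 0)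
        = (\<Sum>m\<in>?C \<times> ?C. if fst m * n1 = snd m * n2 then ?r n1 * ?r n2 else 0)"
      by (simp add: sum.cartesian_product case_prod_unfold)
    also have "\<dots> = (\<Sum>m\<in>mult_pairs q N n1 n2. ?r n1 * ?r n2)"
      by (rule sum.mono_neutral_cong_right) (auto simp: mult_pairs_def)
    finally show ?thesis by simp
  qed
  then have "resonance q N S = (\<Sum>n1\<in>S. \<Sum>n2\<in>S. \<Sum>m1\<in>?C. \<Sum>m2\<in>?C. if m1 * n1 = m2 * n2 then ?r n1 * ?r n2 else 0)"
    unfolding resonance_def by simp
  also have "\<dots> = (\<Sum>n1\<in>S. \<Sum>m1\<in>?C. \<Sum>n2\<in>S. \<Sum>m2\<in>?C. if m1 * n1 = m2 * n2 then ?r n1 * ?r n2 else 0)"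
    by (intro sum.cong refl sum.swap)
  also have "\<dots> = (\<Sum>m1\<in>?C. \<Sum>n1\<in>S. \<Sum>n2\<in>S. \<Sum>m2\<in>?C. if m1 * n1 = m2 * n2 then ?r n1 * ?r n2 else 0)"
    by (rule sum.swap)
  also have "\<dots> = (\<Sum>m1\<in>?C. \<Sum>n1\<in>S. \<Sum>m2\<in>?C. \<Sum>n2\<in>S. if m1 * n1 = m2 * n2 then ?r n1 * ?r n2 else 0)"
    by (intro sum.cong refl sum.swap)
  also have "\<dots> = (\<Sum>w\<in>W. \<Sum>v\<in>W. if fst w * snd w = fst v * snd v then ?r (snd w) * ?r (snd v) else 0)"
    unfolding cp fst_conv snd_conv by (rule refl)
  finally show ?thesis .
qed

lemma char_sum_times_resonator:
  assumes "finite S" "dirichlet_char q chi"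
  shows "char_sum N chi * resonator_sum S chi
     = (\<Sum>w\<in>{m \<in> {1..nat \<lfloor>N\<rfloor>}. coprime m q} \<times> S. of_real (1 / sqrt (real (snd w))) * chi (fst w * snd w))"
proof -
  have "char_sum N chi = (\<Sum>m\<in>{m \<in> {1..nat \<lfloor>N\<rfloor>}. coprime m q}. chi m)"
    unfolding char_sum_def using dirichlet_char_eq_0[OF assms(2)] by (intro sum.mono_neutral_right) auto
  then have "char_sum N chi * resonator_sum S chi
     = (\<Sum>m\<in>{m \<in> {1..nat \<lfloor>N\<rfloor>}. coprime m q}. \<Sum>n\<in>S. chi m * (of_real (1 / sqrt (real n)) * chi n))"
    by (simp only: resonator_sum_def sum_product)
  also have "\<dots> = (\<Sum>w\<in>{m \<in> {1..nat \<lfloor>N\<rfloor>}. coprime m q} \<times> S. of_real (1 / sqrt (real (snd w))) * chi (fst w * snd w))"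
    by (simp add: sum.cartesian_product case_prod_unfold dirichlet_char_mult[OF assms(2)] mult_ac)
  finally show ?thesis .
qed

lemma second_moment_eq:
  fixes q :: nat and N :: real
  assumes "q > 1" "finite S" "\<And>n. n \<in> S \<Longrightarrow> coprime n q"
  defines "W \<equiv> {m \<in> {1..nat \<lfloor>N\<rfloor>}. coprime m q} \<times> S"
  shows "(\<Sum>chi | dirichlet_char q chi. (cmod (char_sum N chi * resonator_sum S chi))\<^sup>2)
     = real (totient q) * (\<Sum>w\<in>W. \<Sum>v\<in>W. if [fst w * snd w = fst v * snd v] (mod q)
           then 1 / sqrt (real (snd w)) * (1 / sqrt (real (snd v))) else 0)"
proof -
  have "(\<Sum>chi | dirichlet_char q chi. (cmod (char_sum N chi * resonator_sum S chi))\<^sup>2)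
     = (\<Sum>chi | dirichlet_char q chi. (cmod (\<Sum>w\<in>W. of_real (1 / sqrt (real (snd w))) * chi (fst w * snd w)))\<^sup>2)"
    by (rule sum.cong) (simp_all only: mem_Collect_eq W_def char_sum_times_resonator[OF assms(2)])
  also have "\<dots> = real (totient q) * (\<Sum>w\<in>W. \<Sum>v\<in>W. if [fst w * snd w = fst v * snd v] (mod q)
           then 1 / sqrt (real (snd w)) * (1 / sqrt (real (snd v))) else 0)"
    by (rule dirichlet_char_parseval[OF assms(1)]) (use assms(2,3) in \<open>auto simp: W_def\<close>)
  finally show ?thesis .
qed

text \<open>Congruences that are not equalities are discarded; all weights are nonnegative.\<close>

lemma second_moment_ge:
  assumes "q > 1" "finite S" "\<And>n. n \<in> S \<Longrightarrow> coprime n q"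
  shows "real (totient q) * resonance q N S
    \<le> (\<Sum>chi | dirichlet_char q chi. (cmod (char_sum N chi * resonator_sum S chi))\<^sup>2)"
  unfolding resonance_eq_sum[OF assms(2)]
proof (subst second_moment_eq[OF assms(1,2)])
  show "coprime n q" if "n \<in> S" for n using assms(3) that .
qed (intro mult_left_mono sum_mono; auto)

text \<open>Under the size condition all products are below \<open>q\<close>, so congruent ones are
  equal. The exact value is wanted where the moment has to be bounded from above by the
  resonance.\<close>

lemma second_moment_eq_resonance:
  assumes "q > 1" "finite S" "\<And>n. n \<in> S \<Longrightarrow> coprime n q"
    and small: "\<And>n. n \<in> S \<Longrightarrow> N * real n < real q" and N: "N \<ge> 0"
  shows "(\<Sum>chi | dirichlet_char q chi. (cmod (char_sum N chi * resonator_sum S chi))\<^sup>2)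
    = real (totient q) * resonance q N S"
proof -
  let ?W = "{m \<in> {1..nat \<lfloor>N\<rfloor>}. coprime m q} \<times> S"
  have "fst w * snd w < q" if "w \<in> ?W" for w
  proof -
    have "real (fst w) \<le> N" using that N by (auto simp: le_nat_iff le_floor_iff)
    then have "real (fst w) * real (snd w) \<le> N * real (snd w)" by (intro mult_right_mono) auto
    also have "\<dots> < real q" using that by (intro small) auto
    finally have "real (fst w * snd w) < real q" by simp
    then show ?thesis by (simp only: of_nat_less_iff)
  qed
  then have "[fst w * snd w = fst v * snd v] (mod q) \<longleftrightarrow> fst w * snd w = fst v * snd v"
    if "w \<in> ?W" "v \<in> ?W" for v w
    using that by (simp add: cong_def)
  then have "(\<Sum>w\<in>?W. \<Sum>v\<in>?W. if [fst w * snd w = fst v * snd v] (mod q)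
        then 1 / sqrt (real (snd w)) * (1 / sqrt (real (snd v))) else 0) = resonance q N S"
    unfolding resonance_eq_sum[OF assms(2)] by (intro sum.cong refl) simp
  moreover have "(\<Sum>chi | dirichlet_char q chi. (cmod (char_sum N chi * resonator_sum S chi))\<^sup>2)
     = real (totient q) * (\<Sum>w\<in>?W. \<Sum>v\<in>?W. if [fst w * snd w = fst v * snd v] (mod q)
           then 1 / sqrt (real (snd w)) * (1 / sqrt (real (snd v))) else 0)"
    by (rule second_moment_eq) (use assms in auto)
  ultimately show ?thesis by simp
qed

lemma resonator_moment:
  assumes "q > 1" "finite S" "\<And>n. n \<in> S \<Longrightarrow> coprime n q \<and> n < q"
  shows "(\<Sum>chi | dirichlet_char q chi. (cmod (resonator_sum S chi))\<^sup>2)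
    = real (totient q) * (\<Sum>n\<in>S. 1 / real n)"
proof -
  have "(\<Sum>chi | dirichlet_char q chi. (cmod (resonator_sum S chi))\<^sup>2)
    = real (totient q) * (\<Sum>n\<in>S. \<Sum>n'\<in>S. if [n = n'] (mod q) then 1 / sqrt (real n) * (1 / sqrt (real n')) else 0)"
    unfolding resonator_sum_def
    by (rule dirichlet_char_parseval) (use assms in auto)
  also have "(\<Sum>n\<in>S. \<Sum>n'\<in>S. if [n = n'] (mod q) then 1 / sqrt (real n) * (1 / sqrt (real n')) else 0)
     = (\<Sum>n\<in>S. \<Sum>n'\<in>S. if n = n' then 1 / sqrt (real n) * (1 / sqrt (real n')) else 0)"
    using assms(3) by (intro sum.cong refl) (simp add: cong_def)
  also have "\<dots> = (\<Sum>n\<in>S. 1 / real n)"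
    using assms(2) by (simp add: sum.delta')
  finally show ?thesis .
qed

text \<open>Bounds the resonator at the principal character: Cauchy-Schwarz, and \<open>S\<close>
  has at most \<open>X\<close> elements.\<close>

lemma resonator_l1_sq_le:
  assumes "finite S" "\<And>n. n \<in> S \<Longrightarrow> n > 0 \<and> real n \<le> X" "X \<ge> 0"
  shows "(\<Sum>n\<in>S. 1 / sqrt (real n))\<^sup>2 \<le> X * (\<Sum>n\<in>S. 1 / real n)"
proof -
  have "(\<Sum>n\<in>S. 1 / sqrt (real n))\<^sup>2 \<le> real (card S) * (\<Sum>n\<in>S. 1 / real n)"
    using Cauchy_Schwarz_ineq_sum[of "\<lambda>_. 1" "\<lambda>n. 1 / sqrt (real n)" S]
    by (simp add: power_divide)
  moreover have "card S \<le> card {1..nat \<lfloor>X\<rfloor>}"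
    using assms by (intro card_mono) (auto simp: le_nat_floor Suc_le_eq)
  then have "real (card S) \<le> real (nat \<lfloor>X\<rfloor>)" by simp
  then have "real (card S) \<le> X" using assms(3) of_nat_floor[of X] by linarith
  then have "real (card S) * (\<Sum>n\<in>S. 1 / real n) \<le> X * (\<Sum>n\<in>S. 1 / real n)"
    by (intro mult_right_mono sum_nonneg) auto
  ultimately show ?thesis by linarith
qed

lemma norm_resonator_sum_le:
  assumes "dirichlet_char q chi"
  shows "cmod (resonator_sum S chi) \<le> (\<Sum>n\<in>S. 1 / sqrt (real n))"
  unfolding resonator_sum_def
  using dirichlet_char_norm_le[OF assms] by (intro sum_norm_le) (simp add: norm_mult norm_divide divide_right_mono)

text \<open>Non-principal characters are bounded by \<open>Delta\<close> times the second moment of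
  the resonator. The principal one contributes at most \<open>N^2 * X\<close> where the others have
  a factor \<open>totient q\<close>; this is what limits the resonator to size about
  \<open>q / N\<close>.\<close>

lemma Delta_sq_ge:
  assumes q: "q > 1" and S: "finite S" "\<And>n. n \<in> S \<Longrightarrow> n > 0 \<and> real n \<le> X \<and> coprime n q"
    and X: "0 \<le> X" "X < real q" and N: "N \<ge> 0"
  shows "real (totient q) * resonance q N S
    \<le> ((Delta N q)\<^sup>2 * real (totient q) + N\<^sup>2 * X) * (\<Sum>n\<in>S. 1 / real n)"
proof -
  let ?X = "{chi. dirichlet_char q chi}"
  let ?f = "\<lambda>chi. (cmod (char_sum N chi * resonator_sum S chi))\<^sup>2"
  have fin: "finite ?X" by (rule finite_dirichlet_chars)
  have p: "dirichlet_char q (principal_char q)" using q dirichlet_char_principal by simp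
  have nq: "n < q" if "n \<in> S" for n using S(2)[OF that] X(2) by linarith
  have "real (totient q) * resonance q N S \<le> (\<Sum>chi\<in>?X. ?f chi)"
    using S by (intro second_moment_ge q) auto
  also have "\<dots> = ?f (principal_char q) + (\<Sum>chi\<in>?X - {principal_char q}. ?f chi)"
    using fin p by (intro sum.remove) auto
  also have "\<dots> \<le> N\<^sup>2 * (X * (\<Sum>n\<in>S. 1 / real n)) + (\<Sum>chi\<in>?X - {principal_char q}. (Delta N q)\<^sup>2 * (cmod (resonator_sum S chi))\<^sup>2)"
  proof (rule add_mono)
    have "?f (principal_char q) \<le> N\<^sup>2 * (\<Sum>n\<in>S. 1 / sqrt (real n))\<^sup>2"
      unfolding norm_mult power_mult_distrib
      using norm_char_sum_le[OF p N] norm_resonator_sum_le[OF p] by (intro mult_mono power_mono) auto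
    also have "\<dots> \<le> N\<^sup>2 * (X * (\<Sum>n\<in>S. 1 / real n))"
      using S X by (intro mult_left_mono resonator_l1_sq_le) auto
    finally show "?f (principal_char q) \<le> N\<^sup>2 * (X * (\<Sum>n\<in>S. 1 / real n))" .
    show "(\<Sum>chi\<in>?X - {principal_char q}. ?f chi) \<le> (\<Sum>chi\<in>?X - {principal_char q}. (Delta N q)\<^sup>2 * (cmod (resonator_sum S chi))\<^sup>2)"
    proof (rule sum_mono)
      fix chi assume "chi \<in> ?X - {principal_char q}"
      then show "?f chi \<le> (Delta N q)\<^sup>2 * (cmod (resonator_sum S chi))\<^sup>2"
        unfolding norm_mult power_mult_distrib
        using norm_char_sum_le_Delta[of q chi N] by (intro mult_right_mono power_mono) auto
    qed
  qed
  also have "(\<Sum>chi\<in>?X - {principal_char q}. (Delta N q)\<^sup>2 * (cmod (resonator_sum S chi))\<^sup>2)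
      \<le> (\<Sum>chi\<in>?X. (Delta N q)\<^sup>2 * (cmod (resonator_sum S chi))\<^sup>2)"
    using fin by (intro sum_mono2) auto
  also have "\<dots> = (Delta N q)\<^sup>2 * (real (totient q) * (\<Sum>n\<in>S. 1 / real n))"
    using resonator_moment[OF q S(1)] S(2) nq by (simp add: sum_distrib_left[symmetric])
  finally show ?thesis by (simp add: algebra_simps)
qed

lemma exp_gain_dominates:
  fixes delta eps :: real
  assumes "delta > 0" "eps > 0"
  shows "\<forall>\<^sub>F q in sequentially. ln (real q) \<ge> 3 \<and> ln (ln (ln (real q))) \<ge> 1 \<and>
     2 * ln (ln (real q)) + 1 \<le> delta * sqrt (eps * ln (real q) / ln (ln (real q)))"
proof (intro eventually_conj)
  show "\<forall>\<^sub>F q in sequentially. ln (real q) \<ge> 3" by real_asymp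
  show "\<forall>\<^sub>F q in sequentially. ln (ln (ln (real q))) \<ge> 1" by real_asymp
  show "\<forall>\<^sub>F q in sequentially. 2 * ln (ln (real q)) + 1 \<le> delta * sqrt (eps * ln (real q) / ln (ln (real q)))"
    using assms by real_asymp
qed

lemma totient_eq_coprime_count: "totient q = coprime_count q (real q)"
  by (simp add: coprime_count_def totient_def totatives_def Suc_le_eq conj_ac)

lemma cube_le_eventually: "\<forall>\<^sub>F q in sequentially. (ln (real q)) ^ 3 \<le> real q"
  by real_asymp

text \<open>Nonnegativity of \<open>Delta\<close> is included for every real \<open>N\<close>
  because the conclusion also ranges over nonpositive \<open>N\<close>.\<close>

theorem Delta_short_ge:
  fixes delta eps :: real
  assumes delta: "0 < delta" "delta \<le> 1" and eps: "0 < eps"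
  shows "\<forall>\<^sub>F q in sequentially. (\<forall>N. Delta N q \<ge> 0) \<and> (\<forall>N > 0. eps * ln (real q) \<le> ln (real q / N) \<and>
     4 * sqrt (ln (real q) * ln (ln (real q))) * ln (ln (ln (real q))) < ln N \<longrightarrow>
     sqrt N * exp ((1 - delta) * sqrt (ln (real q / N) / ln (ln (real q)))) \<le> Delta N q)"
proof -
  have d2: "0 < delta / 2" "delta / 2 \<le> 1" using delta by auto
  show ?thesis
    using resonator_exists[OF d2 eps] coprime_count_eventually exp_gain_dominates[OF delta(1) eps] cube_le_eventually
  proof eventually_elim
    case (elim q)
    define L where "L = ln (real q)"
    define U where "U = ln L"
    have L: "L \<ge> 3" "ln U \<ge> 1" "2 * U + 1 \<le> delta * sqrt (eps * L / U)" "L ^ 3 \<le> real q"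
      and cc: "\<And>Y. L ^ 3 \<le> Y \<Longrightarrow> Y \<le> real q \<Longrightarrow> Y / L\<^sup>2 \<le> real (coprime_count q Y)"
      using elim by (auto simp: L_def U_def)
    have "real q > 0" using L(1) by (cases "q = 0") (auto simp: L_def)
    then have q: "real q > 1" using L(1) ln_gt_zero_iff[of "real q"] unfolding L_def by linarith
    have U: "U > 0" using L(1) by (simp add: U_def)
    have eU: "exp U = L" using L(1) by (simp add: U_def)
    have phi: "real q / L\<^sup>2 \<le> real (totient q)"
      unfolding totient_eq_coprime_count using cc L(4) by simp
    have "L * L\<^sup>2 \<le> real q" using L(4) by (simp add: power2_eq_square power3_eq_cube)
    then have "L \<le> real q / L\<^sup>2" using L(1) by (simp add: pos_le_divide_eq)
    then have "real (totient q) > 1" using phi L(1) by linarith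
    then have tot: "totient q > 1" by simp
    have nonneg: "Delta N q \<ge> 0" for N using Delta_nonneg q tot by simp
    show ?case unfolding L_def[symmetric] U_def[symmetric]
    proof (intro conjI allI impI nonneg)
      fix N :: real
      assume N0: "N > 0" and "eps * L \<le> ln (real q / N) \<and> 4 * sqrt (L * U) * ln U < ln N"
      then have N: "eps * L \<le> ln (real q / N)" "4 * sqrt (L * U) * ln U < ln N" by auto
      \<comment> \<open>At this size the principal character contributes
        \<open>N^2 * X = N * q\<close>, which is within the factor \<open>L^2\<close> of
        \<open>N * totient q\<close>.\<close>
      define X where "X = real q / N"
      define \<Lambda> where "\<Lambda> = sqrt (ln X / U)"
      have lnX: "ln X = L - ln N" using N0 q by (simp add: X_def L_def ln_div)
      have sq0: "sqrt (L * U) * ln U \<ge> 0" using L U by (intro mult_nonneg_nonneg) (simp, linarith)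
      then have lnN: "ln N > 0" "sqrt (L * U) * ln U \<le> ln N" using N(2) by linarith+
      then have N1: "N > 1" using N0 by (simp add: ln_gt_zero_iff)
      have "eps * L > 0" using eps L(1) by simp
      then have "ln N \<le> ln (real q)" using N(1) lnX unfolding X_def[symmetric] L_def by linarith
      then have Nq: "N \<le> real q" using N0 q by simp
      have X: "X > 0" "X < real q" using N1 q by (simp_all add: X_def field_simps)
      obtain S where S: "finite S" "S \<noteq> {}" "\<And>n. n \<in> S \<Longrightarrow> n > 0 \<and> real n \<le> X \<and> coprime n q"
        and res: "N * exp (2 * (1 - delta / 2) * \<Lambda>) * (\<Sum>n\<in>S. 1 / real n) \<le> resonance q N S"
      proof -
        have "0 < X \<and> eps * L \<le> ln X \<and> ln X \<le> L \<and> 0 < N \<and> N \<le> real q \<and> sqrt (L * U) * ln U \<le> ln N"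
          using X N N0 Nq lnN lnX by (simp add: X_def)
        from elim(1)[folded L_def, folded U_def, rule_format, OF this] that
        show thesis unfolding \<Lambda>_def resonator_set_def by (elim exE conjE) simp
      qed
      define s where "s = (\<Sum>n\<in>S. 1 / real n)"
      have s: "s > 0" unfolding s_def using S by (intro sum_pos) auto
      have "real (totient q) * (N * exp (2 * (1 - delta / 2) * \<Lambda>) * s) \<le> real (totient q) * resonance q N S"
        using res unfolding s_def by (intro mult_left_mono) auto
      also have "\<dots> \<le> ((Delta N q)\<^sup>2 * real (totient q) + N\<^sup>2 * X) * s"
        unfolding s_def using q S X N0 by (intro Delta_sq_ge) auto
      finally have "real (totient q) * N * exp (2 * (1 - delta / 2) * \<Lambda>) * s
          \<le> ((Delta N q)\<^sup>2 * real (totient q) + N\<^sup>2 * X) * s" by (simp add: mult_ac)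
      then have "real (totient q) * N * exp (2 * (1 - delta / 2) * \<Lambda>) \<le> (Delta N q)\<^sup>2 * real (totient q) + N\<^sup>2 * X"
        using s by (rule mult_right_le_imp_le)
      also have "N\<^sup>2 * X \<le> real (totient q) * (N * L\<^sup>2)"
      proof -
        have "N\<^sup>2 * X = N * real q" using N0 by (simp add: X_def power2_eq_square)
        also have "real q \<le> real (totient q) * L\<^sup>2" using phi L(1) by (simp add: pos_divide_le_eq)
        finally show ?thesis using N0 by (simp add: mult_ac)
      qed
      finally have "real (totient q) * (N * exp (2 * (1 - delta / 2) * \<Lambda>)) \<le> real (totient q) * ((Delta N q)\<^sup>2 + N * L\<^sup>2)"
        by (simp add: algebra_simps)
      then have D: "N * exp (2 * (1 - delta / 2) * \<Lambda>) \<le> (Delta N q)\<^sup>2 + N * L\<^sup>2"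
        by (rule mult_left_le_imp_le) (use \<open>real (totient q) > 1\<close> in linarith)
      \<comment> \<open>One half of \<open>delta\<close> was spent on the resonator; the other half
        absorbs the \<open>L^2\<close> from the principal character.\<close>
      have "exp (2 * (1 - delta) * \<Lambda>) + L\<^sup>2 \<le> exp (2 * (1 - delta / 2) * \<Lambda>)"
      proof -
        have "sqrt (eps * L / U) \<le> \<Lambda>" unfolding \<Lambda>_def using N(1) U by (simp add: X_def divide_right_mono)
        then have "delta * sqrt (eps * L / U) \<le> delta * \<Lambda>" using delta by (intro mult_left_mono) auto
        then have "exp (2 * U + 1) \<le> exp (delta * \<Lambda>)" using L(3) by simp
        moreover have "exp (2 * U + 1) = L\<^sup>2 * exp 1" by (simp add: exp_add exp_double eU)
        moreover have "L\<^sup>2 * 2 \<le> L\<^sup>2 * exp 1" using exp_ge_add_one_self[of 1] by (intro mult_left_mono) auto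
        moreover have "L\<^sup>2 \<ge> 1" using L(1) by simp
        ultimately have big: "1 + L\<^sup>2 \<le> exp (delta * \<Lambda>)" by linarith
        have "\<Lambda> \<ge> 0" using \<open>eps * L > 0\<close> N(1) U by (simp add: \<Lambda>_def X_def)
        then have one: "1 \<le> exp (2 * (1 - delta) * \<Lambda>)" using delta by simp
        have "exp (2 * (1 - delta) * \<Lambda>) + L\<^sup>2 \<le> exp (2 * (1 - delta) * \<Lambda>) * (1 + L\<^sup>2)"
          using mult_right_mono[OF one, of "L\<^sup>2"] by (simp add: algebra_simps)
        also have "\<dots> \<le> exp (2 * (1 - delta) * \<Lambda>) * exp (delta * \<Lambda>)" using big by (intro mult_left_mono) auto
        also have "\<dots> = exp (2 * (1 - delta / 2) * \<Lambda>)" by (simp add: exp_add[symmetric] algebra_simps)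
        finally show ?thesis .
      qed
      then have "N * (exp (2 * (1 - delta) * \<Lambda>) + L\<^sup>2) \<le> N * exp (2 * (1 - delta / 2) * \<Lambda>)"
        using N0 by (intro mult_left_mono) auto
      then have "N * exp (2 * (1 - delta) * \<Lambda>) \<le> (Delta N q)\<^sup>2" using D by (simp add: algebra_simps)
      also have "N * exp (2 * (1 - delta) * \<Lambda>) = (sqrt N * exp ((1 - delta) * \<Lambda>))\<^sup>2"
        using N0 by (simp add: power_mult_distrib exp_double[symmetric] mult_ac)
      finally have "sqrt N * exp ((1 - delta) * \<Lambda>) \<le> Delta N q" using nonneg by (rule power2_le_imp_le)
      then show "sqrt N * exp ((1 - delta) * sqrt (ln (real q / N) / U)) \<le> Delta N q"
        by (simp add: \<Lambda>_def X_def)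
    qed
  qed
qed

section \<open>Long sums to prime moduli\<close>

definition unit_root :: "nat \<Rightarrow> nat \<Rightarrow> complex" where
  "unit_root q a = cis (2 * pi * real a / real q)"

definition gauss_sum :: "nat \<Rightarrow> (nat \<Rightarrow> complex) \<Rightarrow> complex" where
  "gauss_sum q chi = (\<Sum>a\<in>totatives q. chi a * unit_root q a)"

section \<open>Roots of unity and the size of Gauss sums\<close>

lemma unit_root_power: "unit_root q a ^ b = unit_root q (a * b)"
  unfolding unit_root_def Complex.DeMoivre by (simp add: mult_ac)

lemma unit_root_add: "unit_root q (a + b) = unit_root q a * unit_root q b"
  by (simp add: unit_root_def cis_mult algebra_simps add_divide_distrib)

lemma unit_root_multiple:
  assumes "q > 0"
  shows "unit_root q (q * k) = 1"
proof -
  have "2 * pi * real (q * k) / real q = 2 * pi * real k" using assms by simp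
  then show ?thesis unfolding unit_root_def by (simp only: cis_multiple_2pi[OF Ints_of_nat])
qed

lemma unit_root_mod: "q > 0 \<Longrightarrow> unit_root q (a mod q) = unit_root q a"
  using unit_root_add[of q "a mod q" "q * (a div q)"] unit_root_multiple[of q "a div q"] by simp

lemma norm_unit_root [simp]: "cmod (unit_root q a) = 1"
  by (simp add: unit_root_def)

lemma unit_root_eq_iff: "q > 0 \<Longrightarrow> unit_root q a = unit_root q b \<longleftrightarrow> a mod q = b mod q"
  using complex_root_unity_eq[of q a b] by (simp add: unit_root_def cis_conv_exp mult_ac)

lemma sum_unit_root:
  assumes "q > 0" "a < q" "a' < q"
  shows "(\<Sum>b<q. unit_root q (a * b) * cnj (unit_root q (a' * b))) = (if a = a' then of_nat q else 0)"
proof -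
  define z where "z = unit_root q a * cnj (unit_root q a')"
  have cnj1: "unit_root q x * cnj (unit_root q x) = 1" for x
    by (simp add: complex_norm_square[symmetric])
  have "(\<Sum>b<q. unit_root q (a * b) * cnj (unit_root q (a' * b))) = (\<Sum>b<q. z ^ b)"
    by (simp add: z_def power_mult_distrib unit_root_power flip: complex_cnj_power)
  also have "\<dots> = (if a = a' then of_nat q else 0)"
  proof (cases "a = a'")
    case True
    then show ?thesis using cnj1 by (simp add: z_def)
  next
    case False
    have "z \<noteq> 1"
    proof
      assume "z = 1"
      then have "unit_root q a * (cnj (unit_root q a') * unit_root q a') = unit_root q a'"
        by (simp add: z_def mult.assoc[symmetric])
      then have "unit_root q a = unit_root q a'" using cnj1[of a'] by (simp add: mult.commute)
      then show False using False assms by (simp add: unit_root_eq_iff)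
    qed
    moreover have "z ^ q = 1"
      using unit_root_multiple[OF assms(1), of a] unit_root_multiple[OF assms(1), of a']
      by (simp add: z_def power_mult_distrib unit_root_power mult.commute flip: complex_cnj_power)
    ultimately show ?thesis using False by (simp add: sum_gp_strict)
  qed
  finally show ?thesis .
qed

text \<open>For \<open>b\<close> coprime to \<open>q\<close> the twisted sum \<open>E b\<close> has
  the modulus of the Gauss sum, while Parseval over all \<open>b\<close> mod \<open>q\<close> gives
  the total \<open>totient q * q\<close>. As an upper bound this covers the principal character
  too.\<close>

lemma norm_gauss_sum_le:
  assumes q: "prime q" and chi: "dirichlet_char q chi"
  shows "cmod (gauss_sum q chi) \<le> sqrt (real q)"
proof -
  have q1: "q > 1" using q prime_gt_1_nat by blast
  define E where "E b = (\<Sum>a\<in>totatives q. chi a * unit_root q (a * b))" for b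
  have lt: "a < q" if "a \<in> totatives q" for a using totatives_less[OF that] q1 by simp
  have E_eq: "cmod (E b) = cmod (gauss_sum q chi)" if b: "b \<in> totatives q" for b
  proof -
    have cop: "coprime b q" using b by (simp add: totatives_def)
    have "gauss_sum q chi = (\<Sum>a\<in>totatives q. chi (a * b) * unit_root q (a * b))"
      unfolding gauss_sum_def
      by (rule sum_totatives_mult[symmetric]) (use q1 cop dirichlet_char_mod[OF chi] unit_root_mod in auto)
    also have "\<dots> = chi b * E b"
      by (simp add: E_def sum_distrib_left dirichlet_char_mult[OF chi] mult_ac)
    finally show ?thesis using dirichlet_char_norm[OF chi cop] by (simp add: norm_mult)
  qed
  have "complex_of_real (\<Sum>b<q. (cmod (E b))\<^sup>2) = (\<Sum>b<q. \<Sum>a\<in>totatives q. \<Sum>a'\<in>totatives q.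
      chi a * cnj (chi a') * (unit_root q (a * b) * cnj (unit_root q (a' * b))))"
    by (simp only: of_real_sum complex_norm_square E_def cnj_sum complex_cnj_mult sum_product) (simp add: mult_ac)
  also have "\<dots> = (\<Sum>a\<in>totatives q. \<Sum>b<q. \<Sum>a'\<in>totatives q.
      chi a * cnj (chi a') * (unit_root q (a * b) * cnj (unit_root q (a' * b))))" by (rule sum.swap)
  also have "\<dots> = (\<Sum>a\<in>totatives q. \<Sum>a'\<in>totatives q. \<Sum>b<q.
      chi a * cnj (chi a') * (unit_root q (a * b) * cnj (unit_root q (a' * b))))"
    by (intro sum.cong refl sum.swap)
  also have "\<dots> = (\<Sum>a\<in>totatives q. \<Sum>a'\<in>totatives q. chi a * cnj (chi a') * (if a = a' then of_nat q else 0))"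
    using q1 by (intro sum.cong refl) (simp add: sum_distrib_left[symmetric] sum_unit_root lt)
  also have "\<dots> = (\<Sum>a\<in>totatives q. of_nat q)"
  proof (intro sum.cong refl)
    fix a assume a: "a \<in> totatives q"
    then have "chi a * cnj (chi a) = 1"
      using dirichlet_char_norm[OF chi, of a] by (simp add: totatives_def complex_norm_square[symmetric])
    then show "(\<Sum>a'\<in>totatives q. chi a * cnj (chi a') * (if a = a' then of_nat q else 0)) = of_nat q"
      using a by (simp add: if_distrib sum.delta' cong: if_cong)
  qed
  also have "\<dots> = complex_of_real (real (totient q) * real q)" by (simp add: totient_def)
  finally have "(\<Sum>b<q. (cmod (E b))\<^sup>2) = real (totient q) * real q" by (simp only: of_real_eq_iff)
  moreover have "(\<Sum>b\<in>totatives q. (cmod (E b))\<^sup>2) \<le> (\<Sum>b<q. (cmod (E b))\<^sup>2)"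
    using lt by (intro sum_mono2) auto
  moreover have "(\<Sum>b\<in>totatives q. (cmod (E b))\<^sup>2) = real (totient q) * (cmod (gauss_sum q chi))\<^sup>2"
    using E_eq by (simp add: totient_def)
  ultimately have "real (totient q) * (cmod (gauss_sum q chi))\<^sup>2 \<le> real (totient q) * real q" by simp
  moreover have "real (totient q) > 0" using q1 by simp
  ultimately have "(cmod (gauss_sum q chi))\<^sup>2 \<le> real q" by simp
  then show ?thesis by (rule real_le_rsqrt)
qed

section \<open>Bounds for cosine sums\<close>

lemma sin_ge_third:
  assumes "0 \<le> x" "x \<le> pi / 2"
  shows "x / 3 \<le> sin (x::real)"
proof -
  have "\<bar>sin x - (\<Sum>m<3. sin_coeff m * x ^ m)\<bar> \<le> inverse (fact 3) * \<bar>x\<bar> ^ 3"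
    by (rule Maclaurin_sin_bound)
  moreover have "(\<Sum>m<3. sin_coeff m * x ^ m) = x"
    by (simp add: numeral_3_eq_3 sin_coeff_def)
  ultimately have "\<bar>sin x - x\<bar> \<le> x ^ 3 / 6"
    using assms(1) by (simp add: fact_numeral)
  moreover have "x ^ 3 \<le> x * 4"
  proof -
    have "x \<le> 2" using assms pi_less_4 by linarith
    then have "x * x \<le> 2 * 2" using assms(1) by (intro mult_mono) auto
    then have "x * (x * x) \<le> x * 4" using assms(1) by (intro mult_left_mono) auto
    then show ?thesis by (simp add: power3_eq_cube mult.assoc)
  qed
  ultimately show ?thesis by linarith
qed

text \<open>The crude \<open>sin x \<ge> x / 3\<close> suffices because \<open>pi > 3\<close>;
  beyond \<open>1 / 2\<close> the reflection of \<open>t\<close> to \<open>1 - t\<close>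
  applies.\<close>

lemma sin_pi_ge:
  fixes t d :: real
  assumes "0 \<le> d" "d \<le> t" "t \<le> 1 - d"
  shows "d \<le> sin (pi * t)"
proof (cases "t \<le> 1 / 2")
  case True
  have "3 * t \<le> pi * t" using assms pi_gt3 by (intro mult_right_mono) auto
  moreover have "pi * t / 3 \<le> sin (pi * t)"
    using True assms by (intro sin_ge_third) auto
  ultimately show ?thesis using assms by linarith
next
  case False
  define u where "u = 1 - t"
  have "pi * u = pi - pi * t" by (simp add: u_def algebra_simps)
  then have "sin (pi * u) = sin (pi * t)" by simp
  moreover have "3 * u \<le> pi * u" using assms pi_gt3 by (intro mult_right_mono) (auto simp: u_def)
  moreover have "pi * u / 3 \<le> sin (pi * u)"
    using False assms by (intro sin_ge_third) (auto simp: u_def field_simps)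
  moreover have "d \<le> u" using assms by (simp add: u_def)
  ultimately show ?thesis by linarith
qed

text \<open>Multiplied by \<open>2 * sin (pi * t)\<close> the sum telescopes, and the sine is at
  least \<open>d\<close>.\<close>

lemma cos_sum_bound:
  fixes t d :: real
  assumes "0 < d" "d \<le> t" "t \<le> 1 - d"
  shows "\<bar>\<Sum>m=1..M. cos (2 * pi * t * real m)\<bar> \<le> 1 / d"
proof -
  have "2 * sin (pi * t) * (\<Sum>m=1..M. cos (2 * pi * t * real m)) = sin (2 * pi * t * real M + pi * t) - sin (pi * t)"
  proof (induction M)
    case (Suc M)
    have "2 * sin (pi * t) * cos (2 * pi * t * real (Suc M))
        = sin (2 * pi * t * real (Suc M) + pi * t) - sin (2 * pi * t * real M + pi * t)"
    proof -
      define x where "x = 2 * pi * t * real (Suc M)"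
      define y where "y = pi * t"
      have "2 * pi * t * real M + pi * t = x - y" by (simp add: x_def y_def algebra_simps)
      moreover have "2 * sin y * cos x = sin (x + y) - sin (x - y)" by (simp add: sin_add sin_diff)
      ultimately show ?thesis by (simp only: x_def y_def)
    qed
    then show ?case using Suc by (simp add: distrib_left)
  qed simp
  then have "\<bar>2 * sin (pi * t) * (\<Sum>m=1..M. cos (2 * pi * t * real m))\<bar> \<le> 2"
    using sin_le_one[of "pi * t"] sin_ge_minus_one[of "pi * t"]
      sin_le_one[of "2 * pi * t * real M + pi * t"] sin_ge_minus_one[of "2 * pi * t * real M + pi * t"]
    by linarith
  moreover have s: "d \<le> sin (pi * t)" using assms by (intro sin_pi_ge) auto
  ultimately have "sin (pi * t) * \<bar>\<Sum>m=1..M. cos (2 * pi * t * real m)\<bar> \<le> 1"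
    using assms(1) by (simp add: abs_mult)
  moreover have "d * \<bar>\<Sum>m=1..M. cos (2 * pi * t * real m)\<bar> \<le> sin (pi * t) * \<bar>\<Sum>m=1..M. cos (2 * pi * t * real m)\<bar>"
    using s by (intro mult_right_mono) auto
  ultimately show ?thesis using assms(1) by (simp add: pos_le_divide_eq mult.commute)
qed

text \<open>The Hermitian product of \<open>char_sum M\<close> with the dual sum, weighted by the
  squared modulus of the resonator: conjugating the sum of length \<open>H\<close> over the
  conjugate character gives \<open>char_sum H chi\<close> itself, so that only the Gauss sum and one
  resonator carry \<open>cnj\<close>.\<close>

definition gauss_moment :: "nat \<Rightarrow> real \<Rightarrow> real \<Rightarrow> nat set \<Rightarrow> complex" where
  "gauss_moment q M H S = (\<Sum>chi | dirichlet_char q chi.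
     char_sum H chi * (resonator_sum S chi * (cnj (resonator_sum S chi) * (char_sum M chi * cnj (gauss_sum q chi)))))"

text \<open>Once the Gauss sum is expanded, orthogonality leaves only the \<open>a\<close> with
  \<open>n2 * a\<close> congruent to \<open>m * k * n1\<close>, that is \<open>a = m * y\<close> mod
  \<open>q\<close> with \<open>y\<close> the residue of \<open>k * n1 / n2\<close>. What remains
  over \<open>m\<close> is an exponential sum of frequency \<open>y / q\<close>.\<close>

lemma gauss_moment_eq:
  assumes q: "q > 1" and S: "finite S" "\<And>n. n \<in> S \<Longrightarrow> coprime n q"
    and M: "\<And>m. m \<in> {1..nat \<lfloor>M\<rfloor>} \<Longrightarrow> coprime m q" and H: "\<And>k. k \<in> {1..nat \<lfloor>H\<rfloor>} \<Longrightarrow> coprime k q"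
    and y: "\<And>k n1 n2. k \<in> {1..nat \<lfloor>H\<rfloor>} \<Longrightarrow> n1 \<in> S \<Longrightarrow> n2 \<in> S \<Longrightarrow> [y k n1 n2 * n2 = k * n1] (mod q)"
  shows "gauss_moment q M H S = of_nat (totient q) * (\<Sum>k\<in>{1..nat \<lfloor>H\<rfloor>}. \<Sum>n1\<in>S. \<Sum>n2\<in>S. \<Sum>m\<in>{1..nat \<lfloor>M\<rfloor>}.
      of_real (1 / sqrt (real n1) * (1 / sqrt (real n2))) * cnj (unit_root q (m * y k n1 n2)))"
proof -
  let ?K = "{1..nat \<lfloor>H\<rfloor>}" and ?A = "{1..nat \<lfloor>M\<rfloor>}" and ?T = "totatives q"
  let ?r = "\<lambda>n1 n2. complex_of_real (1 / sqrt (real n1) * (1 / sqrt (real n2)))"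
  have "gauss_moment q M H S = (\<Sum>chi | dirichlet_char q chi. \<Sum>k\<in>?K. \<Sum>n1\<in>S. \<Sum>n2\<in>S. \<Sum>m\<in>?A. \<Sum>a\<in>?T.
      ?r n1 n2 * cnj (unit_root q a) * (chi (m * k * n1) * cnj (chi (n2 * a))))"
    unfolding gauss_moment_def
  proof (intro sum.cong refl)
    fix chi assume "chi \<in> {chi. dirichlet_char q chi}"
    then have chi: "dirichlet_char q chi" by simp
    have "char_sum H chi * (resonator_sum S chi * (cnj (resonator_sum S chi) * (char_sum M chi * cnj (gauss_sum q chi))))
      = (\<Sum>k\<in>?K. \<Sum>n1\<in>S. \<Sum>n2\<in>S. \<Sum>m\<in>?A. \<Sum>a\<in>?T.
          chi k * (of_real (1 / sqrt (real n1)) * chi n1 * (cnj (of_real (1 / sqrt (real n2)) * chi n2) * (chi m * cnj (chi a * unit_root q a)))))"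
      by (simp only: char_sum_def resonator_sum_def gauss_sum_def cnj_sum sum_product) (simp only: sum_distrib_left)
    also have "\<dots> = (\<Sum>k\<in>?K. \<Sum>n1\<in>S. \<Sum>n2\<in>S. \<Sum>m\<in>?A. \<Sum>a\<in>?T.
      ?r n1 n2 * cnj (unit_root q a) * (chi (m * k * n1) * cnj (chi (n2 * a))))"
      by (intro sum.cong refl) (simp add: dirichlet_char_mult[OF chi] mult_ac)
    finally show "char_sum H chi * (resonator_sum S chi * (cnj (resonator_sum S chi) * (char_sum M chi * cnj (gauss_sum q chi))))
      = (\<Sum>k\<in>?K. \<Sum>n1\<in>S. \<Sum>n2\<in>S. \<Sum>m\<in>?A. \<Sum>a\<in>?T.
      ?r n1 n2 * cnj (unit_root q a) * (chi (m * k * n1) * cnj (chi (n2 * a))))" .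
  qed
  also have "\<dots> = (\<Sum>k\<in>?K. \<Sum>n1\<in>S. \<Sum>n2\<in>S. \<Sum>m\<in>?A. \<Sum>a\<in>?T. \<Sum>chi | dirichlet_char q chi.
      ?r n1 n2 * cnj (unit_root q a) * (chi (m * k * n1) * cnj (chi (n2 * a))))"
    by (rule trans[OF sum.swap], rule sum.cong[OF refl])+ (rule refl)
  also have "\<dots> = (\<Sum>k\<in>?K. \<Sum>n1\<in>S. \<Sum>n2\<in>S. \<Sum>m\<in>?A. of_nat (totient q) * (?r n1 n2 * cnj (unit_root q (m * y k n1 n2))))"
  proof (intro sum.cong refl)
    fix k n1 n2 m assume k: "k \<in> ?K" and n: "n1 \<in> S" "n2 \<in> S" and m: "m \<in> ?A"
    let ?a = "(m * y k n1 n2) mod q"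
    have cop: "coprime (m * k * n1) q" using S M H k n m by simp
    have yk: "[y k n1 n2 * n2 = k * n1] (mod q)" by (rule y[OF k n])
    have eq: "[m * k * n1 = n2 * a] (mod q) \<longleftrightarrow> a = ?a" if a: "a \<in> ?T" for a
    proof -
      have "[m * k * n1 = (m * y k n1 n2) * n2] (mod q)"
        using cong_scalar_left[OF cong_sym[OF yk], of m] by (simp add: mult.assoc)
      then have "[m * k * n1 = n2 * a] (mod q) \<longleftrightarrow> [(m * y k n1 n2) * n2 = a * n2] (mod q)"
        by (metis cong_sym cong_trans mult.commute)
      also have "\<dots> \<longleftrightarrow> [m * y k n1 n2 = a] (mod q)"
        using S(2)[OF n(2)] by (simp add: cong_mult_rcancel_nat)
      also have "\<dots> \<longleftrightarrow> a = ?a" using totatives_less[OF a] q by (auto simp: cong_def)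
      finally show ?thesis .
    qed
    have aT: "?a \<in> ?T"
    proof -
      have "coprime (y k n1 n2 * n2) q" using cong_imp_coprime[OF cong_sym[OF yk]] H[OF k] S(2)[OF n(1)] by simp
      then have "coprime ?a q" using M[OF m] q by simp
      moreover then have "?a \<noteq> 0" using q by (intro notI) simp
      moreover have "?a < q" using q by simp
      ultimately show ?thesis by (simp add: totatives_def)
    qed
    have "(\<Sum>a\<in>?T. \<Sum>chi | dirichlet_char q chi. ?r n1 n2 * cnj (unit_root q a) * (chi (m * k * n1) * cnj (chi (n2 * a))))
       = (\<Sum>a\<in>?T. if a = ?a then of_nat (totient q) * (?r n1 n2 * cnj (unit_root q a)) else 0)"
    proof (intro sum.cong refl)
      fix a assume a: "a \<in> ?T"
      then have "coprime (n2 * a) q" using S(2)[OF n(2)] by (simp add: totatives_def)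
      then have "(\<Sum>chi | dirichlet_char q chi. chi (m * k * n1) * cnj (chi (n2 * a))) = (if a = ?a then of_nat (totient q) else 0)"
        using dirichlet_char_orthogonality[OF q cop] eq[OF a] by presburger
      then show "(\<Sum>chi | dirichlet_char q chi. ?r n1 n2 * cnj (unit_root q a) * (chi (m * k * n1) * cnj (chi (n2 * a))))
         = (if a = ?a then of_nat (totient q) * (?r n1 n2 * cnj (unit_root q a)) else 0)"
        unfolding sum_distrib_left[symmetric] by simp
    qed
    also have "\<dots> = of_nat (totient q) * (?r n1 n2 * cnj (unit_root q ?a))"
      using aT by (subst sum.delta) auto
    finally show "(\<Sum>a\<in>?T. \<Sum>chi | dirichlet_char q chi. ?r n1 n2 * cnj (unit_root q a) * (chi (m * k * n1) * cnj (chi (n2 * a))))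
       = of_nat (totient q) * (?r n1 n2 * cnj (unit_root q (m * y k n1 n2)))"
      using q by (simp add: unit_root_mod)
  qed
  finally show ?thesis by (simp only: sum_distrib_left)
qed

text \<open>Only the solutions with \<open>m1 = m2\<close> and \<open>n1 = n2\<close> are used. By
  this comparison the resonance absorbs the far frequencies and the principal character.\<close>

lemma resonance_ge_diagonal:
  assumes "finite S" "\<And>n. n \<in> S \<Longrightarrow> n > 0" "\<And>k. k \<in> {1..nat \<lfloor>H\<rfloor>} \<Longrightarrow> coprime k q"
  shows "real (nat \<lfloor>H\<rfloor>) * (\<Sum>n\<in>S. 1 / real n) \<le> resonance q H S"
  unfolding resonance_def sum_distrib_left
proof (rule sum_mono)
  fix n assume n: "n \<in> S"
  let ?f = "\<lambda>n2. 1 / sqrt (real n) * (1 / sqrt (real n2)) * real (card (mult_pairs q H n n2))"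
  have "(\<lambda>m. (m, m)) ` {1..nat \<lfloor>H\<rfloor>} \<subseteq> mult_pairs q H n n"
    using assms(3) by (auto simp: mult_pairs_def)
  then have "card ((\<lambda>m. (m, m)) ` {1..nat \<lfloor>H\<rfloor>}) \<le> card (mult_pairs q H n n)"
    using finite_mult_pairs by (intro card_mono)
  then have "nat \<lfloor>H\<rfloor> \<le> card (mult_pairs q H n n)" by (simp add: card_image inj_on_def)
  then have "real (nat \<lfloor>H\<rfloor>) * (1 / real n) \<le> ?f n"
    by (simp add: divide_right_mono)
  also have "\<dots> = (\<Sum>n2\<in>{n}. ?f n2)" by simp
  also have "\<dots> \<le> (\<Sum>n2\<in>S. ?f n2)" using assms(1) n by (intro sum_mono2) auto
  finally show "real (nat \<lfloor>H\<rfloor>) * (1 / real n) \<le> (\<Sum>n2\<in>S. ?f n2)" .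
qed

text \<open>Here \<open>y\<close> is not a true quotient, so \<open>y * n2\<close> has wrapped
  around: it is at least \<open>q\<close>, and \<open>(q - y) * n2 + k * n1\<close> is a positive
  multiple of \<open>q\<close>. With \<open>n2 \<le> X\<close> and \<open>k * n1 \<le> q / 2\<close>
  this keeps \<open>y / q\<close> at distance at least \<open>1 / (2 * X)\<close> from both 0 and
  1.\<close>

lemma cos_sum_far:
  fixes X :: real
  assumes "[y * n2 = k * n1] (mod q)" "y * n2 \<noteq> k * n1" "y < q" "k * n1 > 0" "n2 > 0"
    and X: "X \<ge> 1" "real n2 \<le> X" "2 * real (k * n1) \<le> real q"
  shows "\<bar>\<Sum>m=1..M. cos (2 * pi * (real y / real q) * real m)\<bar> \<le> 2 * X"
proof -
  have q: "real q > 0" using assms(3) by simp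
  have small: "k * n1 < q"
  proof -
    have "2 * real (k * n1) \<le> real q" "real (k * n1) > 0" using X(3) assms(4) by auto
    then have "real (k * n1) < real q" by linarith
    then show ?thesis by (simp only: of_nat_less_iff)
  qed
  have "q \<le> y * n2"
  proof (rule ccontr)
    assume "\<not> q \<le> y * n2"
    then show False using assms(1,2) small by (simp add: cong_def)
  qed
  then have "real q \<le> real y * real n2" by (metis of_nat_le_iff of_nat_mult)
  also have "\<dots> \<le> real y * X" using X by (intro mult_left_mono) auto
  finally have low: "1 / (2 * X) \<le> real y / real q" using X(1) q by (simp add: field_simps)
  have "[(q - y) * n2 + k * n1 = (q - y) * n2 + y * n2] (mod q)"
    using assms(1) by (intro cong_add) (auto simp: cong_sym)
  also have "(q - y) * n2 + y * n2 = q * n2" using assms(3) by (simp flip: distrib_right)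
  also have "[q * n2 = 0] (mod q)" by (simp add: cong_def)
  finally have "q dvd (q - y) * n2 + k * n1" by (simp add: cong_0_iff)
  then have "q \<le> (q - y) * n2 + k * n1" using assms(4) by (intro dvd_imp_le) auto
  then have "real q \<le> real ((q - y) * n2 + k * n1)" by (simp only: of_nat_le_iff)
  then have "real q \<le> (real q - real y) * real n2 + real (k * n1)"
    using assms(3) by (simp add: of_nat_diff)
  also have "(real q - real y) * real n2 \<le> (real q - real y) * X"
    using X assms(3) by (intro mult_left_mono) auto
  finally have "real q \<le> 2 * X * (real q - real y)" using X(3) by (simp add: algebra_simps)
  then have "1 / (2 * X) \<le> (real q - real y) / real q" using X(1) q by (simp add: field_simps)
  then have high: "real y / real q \<le> 1 - 1 / (2 * X)" using q by (simp add: diff_divide_distrib)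
  show ?thesis using cos_sum_bound[OF _ low high] X(1) by simp
qed

text \<open>All angles are at most \<open>pi / 3\<close>, where the cosine is at least
  \<open>1 / 2\<close>.\<close>

lemma cos_sum_near:
  fixes N :: real
  assumes "6 * real y \<le> N" "real M \<le> real q / N" "N > 0" "q > 0"
  shows "real M / 2 \<le> (\<Sum>m=1..M. cos (2 * pi * (real y / real q) * real m))"
proof -
  have "(\<Sum>m=1..M. 1 / 2) \<le> (\<Sum>m=1..M. cos (2 * pi * (real y / real q) * real m))"
  proof (rule sum_mono)
    fix m assume "m \<in> {1..M}"
    then have "real m \<le> real q / N" using assms(2) by (meson atLeastAtMost_iff of_nat_le_iff order_trans)
    then have "real m * (6 * real y) \<le> real q / N * N" using assms by (intro mult_mono) auto
    then have "6 * (real y / real q * real m) \<le> 1" using assms by (simp add: field_simps)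
    then have "2 * pi * (real y / real q) * real m \<le> pi / 3"
      using mult_left_mono[of "6 * (real y / real q * real m)" 1 "pi / 3"] by (simp add: mult_ac)
    then have "cos (pi / 3) \<le> cos (2 * pi * (real y / real q) * real m)"
      by (intro cos_monotone_0_pi_le) auto
    then show "1 / 2 \<le> cos (2 * pi * (real y / real q) * real m)" by (simp add: cos_60)
  qed
  then show ?thesis by simp
qed

text \<open>Where \<open>y * n2 = k * n1\<close>, comparability and the length \<open>N / 18\<close>
  give \<open>y \<le> 3 * k \<le> N / 6\<close>, so the cosine sum is at least half its length.
  Every other cosine sum is at most \<open>2 * X\<close> in modulus, and
  \<open>16 * X^2 * N \<le> q\<close> keeps their total below half of the main term.\<close>

lemma Re_gauss_moment_ge:
  fixes N X :: real
  assumes q: "prime q" and S: "finite S" "\<And>n. n \<in> S \<Longrightarrow> n > 0 \<and> real n \<le> X \<and> coprime n q"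
    and ratio: "\<And>n1 n2. n1 \<in> S \<Longrightarrow> n2 \<in> S \<Longrightarrow> real n1 \<le> 3 * real n2"
    and N: "1 < N" "N \<le> real q" and X: "X \<ge> 1" "16 * X\<^sup>2 * N \<le> real q"
  shows "real (totient q) * (real (nat \<lfloor>real q / N\<rfloor>) / 4) * resonance q (N / 18) S
    \<le> Re (gauss_moment q (real q / N) (N / 18) S)"
proof -
  let ?H = "N / 18" and ?M = "real q / N"
  let ?K = "{1..nat \<lfloor>?H\<rfloor>}" and ?A = "{1..nat \<lfloor>?M\<rfloor>}"
  let ?r = "\<lambda>n1 n2. 1 / sqrt (real n1) * (1 / sqrt (real n2))"
  have q1: "q > 1" using q prime_gt_1_nat by blast
  have copq: "coprime m q" if "0 < m" "m < q" for m
    using q that by (metis coprime_commute nat_dvd_not_less prime_imp_coprime)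
  have KH: "real k \<le> ?H" if "k \<in> ?K" for k using that N by (auto simp: le_nat_iff le_floor_iff)
  have copK: "coprime k q" if k: "k \<in> ?K" for k
  proof -
    have "real k < real q" using KH[OF k] N by simp
    then show ?thesis using k by (intro copq) auto
  qed
  have copA: "coprime m q" if m: "m \<in> ?A" for m
  proof -
    have "real m \<le> ?M" using m N by (auto simp: le_nat_iff le_floor_iff)
    also have "?M < real q" using N q1 by (simp add: field_simps)
    finally show ?thesis using m by (intro copq) auto
  qed
  have ex_y: "\<exists>y. y < q \<and> [y * n2 = k * n1] (mod q)" if n2: "n2 \<in> S" for k n1 n2
  proof -
    obtain x where x: "[n2 * x = Suc 0] (mod q)" using cong_solve_coprime_nat S(2)[OF n2] by blast
    have "[(k * n1 * x) mod q * n2 = k * n1 * x * n2] (mod q)"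
      by (intro cong_mult) (simp_all add: cong_def)
    also have "k * n1 * x * n2 = k * n1 * (n2 * x)" by simp
    also have "[k * n1 * (n2 * x) = k * n1 * Suc 0] (mod q)" using x by (rule cong_scalar_left)
    finally show ?thesis using q1 by (intro exI[of _ "(k * n1 * x) mod q"]) simp
  qed
  define y where "y k n1 n2 = (SOME y. y < q \<and> [y * n2 = k * n1] (mod q))" for k n1 n2
  have y: "y k n1 n2 < q \<and> [y k n1 n2 * n2 = k * n1] (mod q)" if "n2 \<in> S" for k n1 n2
    unfolding y_def by (rule someI_ex[OF ex_y[OF that]])
  let ?C = "\<lambda>k n1 n2. \<Sum>m\<in>?A. cos (2 * pi * (real (y k n1 n2) / real q) * real m)"
  have Re: "Re (gauss_moment q ?M ?H S) = real (totient q) * (\<Sum>k\<in>?K. \<Sum>n1\<in>S. \<Sum>n2\<in>S. ?r n1 n2 * ?C k n1 n2)"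
  proof -
    have "Re (gauss_moment q ?M ?H S) = real (totient q) * (\<Sum>k\<in>?K. \<Sum>n1\<in>S. \<Sum>n2\<in>S. \<Sum>m\<in>?A.
      ?r n1 n2 * Re (cnj (unit_root q (m * y k n1 n2))))"
      by (subst gauss_moment_eq[where y = y]) (use q1 S copA copK y in \<open>auto simp del: of_real_divide of_real_mult\<close>)
    also have "\<dots> = real (totient q) * (\<Sum>k\<in>?K. \<Sum>n1\<in>S. \<Sum>n2\<in>S. ?r n1 n2 * ?C k n1 n2)"
      unfolding sum_distrib_left[where A = ?A]
      by (intro arg_cong[where f = "\<lambda>x. real (totient q) * x"] sum.cong refl) (simp add: unit_root_def mult_ac)
    finally show ?thesis .
  qed
  define m0 where "m0 = real (nat \<lfloor>?M\<rfloor>)"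
  have nat_floor: "x / 2 \<le> real (nat \<lfloor>x\<rfloor>) \<and> real (nat \<lfloor>x\<rfloor>) \<le> x" if "x \<ge> 2" for x :: real
    using that by linarith
  have m0: "?M / 2 \<le> m0" "m0 \<le> ?M"
  proof -
    have "16 * X\<^sup>2 \<le> ?M" using X N by (simp add: field_simps)
    moreover have "X\<^sup>2 \<ge> 1" using X(1) by simp
    ultimately have "?M \<ge> 2" by linarith
    then show "?M / 2 \<le> m0" "m0 \<le> ?M" unfolding m0_def using nat_floor by blast+
  qed
  let ?I = "\<lambda>k n1 n2. \<exists>x\<in>?K. k * n1 = x * n2"
  \<comment> \<open>A quotient \<open>y\<close> above \<open>N / 18\<close> is not counted by
    \<open>resonance\<close>, but its cosine sum is still at least \<open>m0 / 2\<close>, so it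
    needs no case of its own.\<close>
  have C_ge: "m0 / 2 * of_bool (?I k n1 n2) - 2 * X \<le> ?C k n1 n2"
    if k: "k \<in> ?K" and n: "n1 \<in> S" "n2 \<in> S" for k n1 n2
  proof (cases "y k n1 n2 * n2 = k * n1")
    case True
    have n2: "real n2 > 0" using S(2)[OF n(2)] by simp
    have "real (y k n1 n2) * real n2 = real k * real n1" using True by (metis of_nat_mult)
    also have "\<dots> \<le> real k * (3 * real n2)" using ratio[OF n] by (intro mult_left_mono) auto
    finally have "real (y k n1 n2) \<le> 3 * real k" using n2 by simp
    then have "6 * real (y k n1 n2) \<le> N" using KH[OF k] by simp
    then have "m0 / 2 \<le> ?C k n1 n2" unfolding m0_def
      by (intro cos_sum_near) (use N q1 m0(2) in \<open>auto simp: m0_def\<close>)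
    then show ?thesis using X(1) m0_def by (auto simp: of_bool_def)
  next
    case False
    have notI: "\<not> ?I k n1 n2"
    proof
      assume "?I k n1 n2"
      then obtain x where x: "x \<in> ?K" "k * n1 = x * n2" by blast
      have "real x < real q" using KH[OF x(1)] N by simp
      then have "x < q" by simp
      moreover have "[y k n1 n2 = x] (mod q)"
        using y[OF n(2), of k n1] S(2)[OF n(2)] x(2) by (simp add: cong_mult_rcancel_nat)
      ultimately have "y k n1 n2 = x" using y[OF n(2), of k n1] by (simp add: cong_def)
      then show False using False x(2) by simp
    qed
    have "2 * real (k * n1) \<le> real q"
    proof -
      have "real k * real n1 \<le> N / 18 * X" using KH[OF k] S(2)[OF n(1)] N by (intro mult_mono) auto
      moreover have "N * X \<le> 16 * X\<^sup>2 * N"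
      proof -
        have "N * X * 1 \<le> N * X * (16 * X)" using N X by (intro mult_left_mono) auto
        then show ?thesis by (simp add: power2_eq_square mult_ac)
      qed
      moreover have "N * X \<ge> 0" using N X by simp
      ultimately have "2 * (real k * real n1) \<le> real q" using X(2) by linarith
      then show ?thesis by simp
    qed
    then have "\<bar>?C k n1 n2\<bar> \<le> 2 * X"
      using k y[OF n(2), of k n1] False S(2) n X(1) by (intro cos_sum_far[of _ n2 k n1]) auto
    then show ?thesis using notI by simp
  qed
  let ?G = "resonance q ?H S" and ?s = "\<Sum>n\<in>S. 1 / real n"
  have G_le: "?G \<le> (\<Sum>k\<in>?K. \<Sum>n1\<in>S. \<Sum>n2\<in>S. ?r n1 n2 * of_bool (?I k n1 n2))"
  proof -
    have "real (card (mult_pairs q ?H n1 n2)) \<le> (\<Sum>k\<in>?K. of_bool (?I k n1 n2))" if "n2 \<in> S" for n1 n2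
    proof -
      have "inj_on fst (mult_pairs q ?H n1 n2)"
        using S(2)[OF that] by (auto simp: inj_on_def mult_pairs_def)
      moreover have "fst ` mult_pairs q ?H n1 n2 \<subseteq> {k \<in> ?K. ?I k n1 n2}"
        by (auto simp: mult_pairs_def)
      moreover have "finite {k \<in> ?K. ?I k n1 n2}" by simp
      ultimately have "card (mult_pairs q ?H n1 n2) \<le> card {k \<in> ?K. ?I k n1 n2}"
        by (rule card_inj_on_le)
      also have "real (card {k \<in> ?K. ?I k n1 n2}) = (\<Sum>k\<in>?K. of_bool (?I k n1 n2))"
        by (simp add: sum_of_bool_eq Int_def)
      finally show ?thesis by simp
    qed
    then have "?G \<le> (\<Sum>n1\<in>S. \<Sum>n2\<in>S. ?r n1 n2 * (\<Sum>k\<in>?K. of_bool (?I k n1 n2)))"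
      unfolding resonance_def by (intro sum_mono mult_left_mono) auto
    also have "\<dots> = (\<Sum>n1\<in>S. \<Sum>n2\<in>S. \<Sum>k\<in>?K. ?r n1 n2 * of_bool (?I k n1 n2))"
      by (simp only: sum_distrib_left)
    also have "\<dots> = (\<Sum>n1\<in>S. \<Sum>k\<in>?K. \<Sum>n2\<in>S. ?r n1 n2 * of_bool (?I k n1 n2))"
      by (intro sum.cong refl sum.swap)
    also have "\<dots> = (\<Sum>k\<in>?K. \<Sum>n1\<in>S. \<Sum>n2\<in>S. ?r n1 n2 * of_bool (?I k n1 n2))"
      by (rule sum.swap)
    finally show ?thesis .
  qed
  have r_sum: "(\<Sum>k\<in>?K. \<Sum>n1\<in>S. \<Sum>n2\<in>S. ?r n1 n2) \<le> real (nat \<lfloor>?H\<rfloor>) * (X * ?s)"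
  proof -
    have "(\<Sum>n1\<in>S. \<Sum>n2\<in>S. ?r n1 n2) = (\<Sum>n\<in>S. 1 / sqrt (real n))\<^sup>2"
      by (simp only: power2_eq_square sum_product)
    also have "\<dots> \<le> X * ?s" using S X(1) by (intro resonator_l1_sq_le) auto
    finally show ?thesis by (simp add: mult_left_mono)
  qed
  \<comment> \<open>By the diagonal bound the error is at most \<open>2 * X^2\<close> times the
    resonance, and \<open>2 * X^2 \<le> m0 / 4\<close>.\<close>
  have "m0 / 4 * ?G \<le> m0 / 2 * ?G - 2 * X * (real (nat \<lfloor>?H\<rfloor>) * (X * ?s))"
  proof -
    have diag: "real (nat \<lfloor>?H\<rfloor>) * ?s \<le> ?G"
      using S copK by (intro resonance_ge_diagonal) auto
    have "2 * X\<^sup>2 \<le> m0 / 4"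
    proof -
      have "16 * X\<^sup>2 \<le> ?M" using X N by (simp add: field_simps)
      moreover have "2 * x \<le> m / 4" if "16 * x \<le> M" "M / 2 \<le> m" for x m M :: real
        using that by linarith
      ultimately show ?thesis using m0(1) by blast
    qed
    moreover have "real (nat \<lfloor>?H\<rfloor>) * ?s \<ge> 0" by (intro mult_nonneg_nonneg sum_nonneg) auto
    ultimately have "2 * X\<^sup>2 * (real (nat \<lfloor>?H\<rfloor>) * ?s) \<le> m0 / 4 * ?G"
      using diag by (intro mult_mono) (auto simp: m0_def)
    then show ?thesis by (simp add: power2_eq_square algebra_simps)
  qed
  also have "\<dots> \<le> m0 / 2 * (\<Sum>k\<in>?K. \<Sum>n1\<in>S. \<Sum>n2\<in>S. ?r n1 n2 * of_bool (?I k n1 n2))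
      - 2 * X * (\<Sum>k\<in>?K. \<Sum>n1\<in>S. \<Sum>n2\<in>S. ?r n1 n2)"
    using G_le r_sum X(1) by (intro diff_mono mult_left_mono) (auto simp: m0_def)
  also have "\<dots> = (\<Sum>k\<in>?K. \<Sum>n1\<in>S. \<Sum>n2\<in>S. ?r n1 n2 * (m0 / 2 * of_bool (?I k n1 n2) - 2 * X))"
    by (simp only: sum_distrib_left sum_subtractf[symmetric]) (simp add: algebra_simps)
  also have "\<dots> \<le> (\<Sum>k\<in>?K. \<Sum>n1\<in>S. \<Sum>n2\<in>S. ?r n1 n2 * ?C k n1 n2)"
    by (intro sum_mono mult_left_mono C_ge) auto
  finally have "real (totient q) * (m0 / 4 * ?G) \<le> Re (gauss_moment q ?M ?H S)"
    unfolding Re by (intro mult_left_mono) auto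
  then show ?thesis by (simp add: m0_def mult.assoc)
qed

text \<open>Each Gauss sum costs \<open>sqrt q\<close>, and the principal character is estimated
  trivially. For the others \<open>Delta\<close> is taken out, and Cauchy-Schwarz leaves two second
  moments; since \<open>H * X < q\<close>, one of them is exactly the resonance that also occurs in
  the lower bound.\<close>

lemma norm_gauss_moment_le:
  fixes N X :: real
  assumes q: "prime q" and S: "finite S" "\<And>n. n \<in> S \<Longrightarrow> n > 0 \<and> real n \<le> X \<and> coprime n q"
    and X: "X \<ge> 0" "X < real q" and H: "H \<ge> 0" "H * X < real q" and M: "M \<ge> 0" and D0: "Delta M q \<ge> 0"
  shows "cmod (gauss_moment q M H S) \<le> sqrt (real q) *
     (M * (H * (X * (\<Sum>n\<in>S. 1 / real n))) + Delta M q * (real (totient q) * sqrt (resonance q H S * (\<Sum>n\<in>S. 1 / real n))))"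
proof -
  let ?X = "{chi. dirichlet_char q chi}"
  let ?s = "\<Sum>n\<in>S. 1 / real n"
  let ?R = "\<lambda>chi. cmod (resonator_sum S chi)"
  let ?V = "\<lambda>chi. cmod (char_sum H chi * resonator_sum S chi)"
  have q1: "q > 1" using q prime_gt_1_nat by blast
  have fin: "finite ?X" by (rule finite_dirichlet_chars)
  have p: "dirichlet_char q (principal_char q)" using q1 dirichlet_char_principal by simp
  have nq: "n < q" if "n \<in> S" for n using S(2)[OF that] X(2) by linarith
  have tot: "totient q > 0" using q1 by simp
  have "cmod (gauss_moment q M H S) \<le> (\<Sum>chi\<in>?X. sqrt (real q) * (cmod (char_sum M chi) * (?V chi * ?R chi)))"
    unfolding gauss_moment_def
  proof (rule sum_norm_le)
    fix chi assume "chi \<in> ?X"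
    then have "cmod (gauss_sum q chi) \<le> sqrt (real q)" using norm_gauss_sum_le[OF q] by simp
    then have "cmod (char_sum M chi) * (?V chi * ?R chi) * cmod (gauss_sum q chi)
       \<le> cmod (char_sum M chi) * (?V chi * ?R chi) * sqrt (real q)" by (intro mult_left_mono) auto
    then show "cmod (char_sum H chi * (resonator_sum S chi * (cnj (resonator_sum S chi) * (char_sum M chi * cnj (gauss_sum q chi)))))
       \<le> sqrt (real q) * (cmod (char_sum M chi) * (?V chi * ?R chi))"
      by (simp add: norm_mult mult_ac)
  qed
  also have "\<dots> = sqrt (real q) * (\<Sum>chi\<in>?X. cmod (char_sum M chi) * (?V chi * ?R chi))"
    by (simp only: sum_distrib_left)
  also have "(\<Sum>chi\<in>?X. cmod (char_sum M chi) * (?V chi * ?R chi))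
      = cmod (char_sum M (principal_char q)) * (?V (principal_char q) * ?R (principal_char q))
        + (\<Sum>chi\<in>?X - {principal_char q}. cmod (char_sum M chi) * (?V chi * ?R chi))"
    using fin p by (intro sum.remove) auto
  also have "\<dots> \<le> M * (H * (X * ?s)) + Delta M q * (real (totient q) * sqrt (resonance q H S * ?s))"
  proof (rule add_mono)
    let ?l = "\<Sum>n\<in>S. 1 / sqrt (real n)"
    have l0: "?l \<ge> 0" by (intro sum_nonneg) auto
    have "?V (principal_char q) * ?R (principal_char q) \<le> (H * ?l) * ?l"
      unfolding norm_mult
      using norm_char_sum_le[OF p H(1)] norm_resonator_sum_le[OF p, of S] H(1) l0
      by (intro mult_mono mult_nonneg_nonneg) auto
    also have "\<dots> = H * ?l\<^sup>2" by (simp add: power2_eq_square)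
    also have "\<dots> \<le> H * (X * ?s)" using S X H by (intro mult_left_mono resonator_l1_sq_le) auto
    finally have VR: "?V (principal_char q) * ?R (principal_char q) \<le> H * (X * ?s)" .
    show "cmod (char_sum M (principal_char q)) * (?V (principal_char q) * ?R (principal_char q)) \<le> M * (H * (X * ?s))"
      by (rule mult_mono[OF norm_char_sum_le[OF p M] VR]) (use M in auto)
    have "(\<Sum>chi\<in>?X - {principal_char q}. cmod (char_sum M chi) * (?V chi * ?R chi))
        \<le> (\<Sum>chi\<in>?X - {principal_char q}. Delta M q * (?V chi * ?R chi))"
    proof (rule sum_mono)
      fix chi assume "chi \<in> ?X - {principal_char q}"
      then show "cmod (char_sum M chi) * (?V chi * ?R chi) \<le> Delta M q * (?V chi * ?R chi)"
        using norm_char_sum_le_Delta[of q chi M] by (intro mult_right_mono) auto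
    qed
    also have "\<dots> \<le> Delta M q * (real (totient q) * sqrt (resonance q H S * ?s))"
    proof -
      have "(\<Sum>chi\<in>?X - {principal_char q}. ?V chi * ?R chi) \<le> (\<Sum>chi\<in>?X. ?V chi * ?R chi)"
        using fin by (intro sum_mono2) auto
      also have "\<dots> \<le> sqrt ((\<Sum>chi\<in>?X. (?V chi)\<^sup>2) * (\<Sum>chi\<in>?X. (?R chi)\<^sup>2))"
        by (intro real_le_rsqrt Cauchy_Schwarz_ineq_sum)
      also have "(\<Sum>chi\<in>?X. (?V chi)\<^sup>2) = real (totient q) * resonance q H S"
      proof (rule second_moment_eq_resonance[OF q1 S(1) _ _ H(1)])
        show "H * real n < real q" if "n \<in> S" for n
        proof -
          have "H * real n \<le> H * X" using S(2)[OF that] H(1) by (intro mult_left_mono) auto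
          then show ?thesis using H(2) by linarith
        qed
      qed (use S in auto)
      also have "(\<Sum>chi\<in>?X. (?R chi)\<^sup>2) = real (totient q) * ?s"
        using S nq by (intro resonator_moment q1) auto
      also have "sqrt (real (totient q) * resonance q H S * (real (totient q) * ?s)) = real (totient q) * sqrt (resonance q H S * ?s)"
      proof -
        have "real (totient q) * resonance q H S * (real (totient q) * ?s) = (real (totient q))\<^sup>2 * (resonance q H S * ?s)"
          by (simp add: power2_eq_square mult_ac)
        then show ?thesis by (simp only: real_sqrt_mult) simp
      qed
      finally show ?thesis using D0 by (simp only: sum_distrib_left[symmetric]) (rule mult_left_mono)
    qed
    finally show "(\<Sum>chi\<in>?X - {principal_char q}. cmod (char_sum M chi) * (?V chi * ?R chi))
      \<le> Delta M q * (real (totient q) * sqrt (resonance q H S * ?s))" .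
  qed
  finally show ?thesis by (simp add: mult_left_mono)
qed

text \<open>The lower bound for the moment is linear in the resonance \<open>G\<close>, while the
  main term of the upper bound has \<open>sqrt G\<close>. Dividing and inserting the assumed size of
  \<open>G\<close> isolates \<open>Delta\<close>. The constant is \<open>80 = 16 * 5\<close>, with
  16 from a quarter halved twice and \<open>sqrt 18 \<le> 5\<close>.\<close>

lemma Delta_long_core:
  fixes N X :: real
  assumes q: "prime q" "q > 2" and S: "finite S" "S \<noteq> {}" "\<And>n. n \<in> S \<Longrightarrow> n > 0 \<and> real n \<le> X \<and> coprime n q"
    and ratio: "\<And>n1 n2. n1 \<in> S \<Longrightarrow> n2 \<in> S \<Longrightarrow> real n1 \<le> 3 * real n2"
    and N: "256 \<le> N" "N \<le> real q" and X: "X \<ge> 1" "16 * X\<^sup>2 * N \<le> real q"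
    and res: "N / 18 * E\<^sup>2 * (\<Sum>n\<in>S. 1 / real n) \<le> resonance q (N / 18) S" and E: "E \<ge> 0"
  shows "sqrt (real q / N) * E \<le> 80 * Delta (real q / N) q"
proof -
  define M where "M = real q / N"
  define D where "D = Delta M q"
  define G where "G = resonance q (N / 18) S"
  define s where "s = (\<Sum>n\<in>S. 1 / real n)"
  define m0 where "m0 = real (nat \<lfloor>M\<rfloor>)"
  define \<phi> where "\<phi> = real (totient q)"
  have s: "s > 0" unfolding s_def using S by (intro sum_pos) auto
  have phi: "\<phi> = real q - 1" "\<phi> \<ge> real q / 2" "\<phi> > 0"
    using q by (auto simp: \<phi>_def totient_prime of_nat_diff)
  have D0: "D \<ge> 0"
    unfolding D_def using q phi by (intro Delta_nonneg) (auto simp: totient_prime)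
  have MX: "16 * X\<^sup>2 \<le> M" using X N by (simp add: M_def field_simps)
  have X2: "X\<^sup>2 \<ge> 1" using X(1) by simp
  have nat_floor: "x / 2 \<le> real (nat \<lfloor>x\<rfloor>) \<and> real (nat \<lfloor>x\<rfloor>) \<le> x" if "x \<ge> 2" for x :: real
    using that by linarith
  have M2: "M \<ge> 2" using MX X2 by linarith
  have m0: "M / 2 \<le> m0" using nat_floor[OF M2] unfolding m0_def by blast
  have qX: "256 * (16 * X\<^sup>2) \<le> real q"
  proof -
    have "16 * X\<^sup>2 * 256 \<le> 16 * X\<^sup>2 * N" using N X2 by (intro mult_left_mono) auto
    then show ?thesis using X(2) by linarith
  qed
  have "X * 1 \<le> X * X" using X(1) by (intro mult_left_mono) auto
  then have XX: "X \<le> X\<^sup>2" by (simp add: power2_eq_square)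
  have Xq: "X < real q" using XX qX X2 by linarith
  have HX: "N / 18 * X < real q"
  proof -
    have "N * X \<le> N * (16 * X\<^sup>2)" using N XX X2 by (intro mult_left_mono) linarith+
    then have "N * X \<le> real q" using X(2) by (simp add: mult_ac)
    moreover have "N * X > 0" using N X by simp
    ultimately show ?thesis by (simp add: field_simps)
  qed
  have copq: "coprime m q" if "0 < m" "m < q" for m
    using q(1) that by (metis coprime_commute nat_dvd_not_less prime_imp_coprime)
  have G_diag: "N / 36 * s \<le> G"
  proof -
    have h: "N / 18 / 2 \<le> real (nat \<lfloor>N / 18\<rfloor>) \<and> real (nat \<lfloor>N / 18\<rfloor>) \<le> N / 18"
      using N by (intro nat_floor) simp
    have "real (nat \<lfloor>N / 18\<rfloor>) < real q" using h N by linarith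
    then have "nat \<lfloor>N / 18\<rfloor> < q" by (simp only: of_nat_less_iff)
    then have "real (nat \<lfloor>N / 18\<rfloor>) * s \<le> G"
      unfolding G_def s_def using S copq by (intro resonance_ge_diagonal) auto
    moreover have "N / 36 * s \<le> real (nat \<lfloor>N / 18\<rfloor>) * s" using h s by (intro mult_right_mono) auto
    ultimately show ?thesis by linarith
  qed
  then have G0: "G > 0" using N s mult_pos_pos[of "N / 36" s] by linarith
  have "\<phi> * (m0 / 4) * G \<le> Re (gauss_moment q M (N / 18) S)"
    unfolding \<phi>_def m0_def G_def M_def
    by (rule Re_gauss_moment_ge) (use q S ratio N X in auto)
  also have "\<dots> \<le> cmod (gauss_moment q M (N / 18) S)" by (rule complex_Re_le_cmod)
  also have "\<dots> \<le> sqrt (real q) * (M * (N / 18 * (X * s)) + D * (\<phi> * sqrt (G * s)))"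
    unfolding s_def G_def D_def \<phi>_def
    by (rule norm_gauss_moment_le) (use q S Xq HX X N M2 D0 in \<open>auto simp: D_def\<close>)
  finally have main: "\<phi> * (m0 / 4) * G \<le> sqrt (real q) * (M * (N / 18 * (X * s))) + sqrt (real q) * (D * (\<phi> * sqrt (G * s)))"
    by (simp add: distrib_left)
  \<comment> \<open>The principal character takes at most half of the main term. This rests on
    \<open>64 * X \<le> sqrt q\<close>, which follows from \<open>256 \<le> N\<close> because
    \<open>256 * 16 = 64^2\<close>.\<close>
  have "sqrt (real q) * (M * (N / 18 * (X * s))) \<le> \<phi> * (m0 / 8) * G"
  proof -
    have "N / 18 * s \<le> 2 * G" using G_diag by simp
    then have "sqrt (real q) * M * X * (N / 18 * s) \<le> sqrt (real q) * M * X * (2 * G)"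
      using M2 X(1) by (intro mult_left_mono) auto
    also have "\<dots> = 2 * (sqrt (real q) * X) * (M * G)" by simp
    also have "\<dots> \<le> 2 * (real q / 64) * (M * G)"
    proof (intro mult_right_mono mult_left_mono)
      have "(64 * X)\<^sup>2 \<le> real q" using qX by (simp add: power_mult_distrib)
      then have "64 * X \<le> sqrt (real q)" by (rule real_le_rsqrt)
      then have "sqrt (real q) * (64 * X) \<le> sqrt (real q) * sqrt (real q)" by (intro mult_left_mono) auto
      then show "sqrt (real q) * X \<le> real q / 64" by simp
    qed (use M2 G0 in auto)
    also have "\<dots> = (real q / 2) * (M / 2 / 8) * G" by simp
    also have "\<dots> \<le> \<phi> * (m0 / 8) * G"
      using phi m0 G0 M2 by (intro mult_right_mono mult_mono) auto
    finally show ?thesis by (simp add: mult_ac)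
  qed
  then have "\<phi> * (m0 / 8) * G \<le> sqrt (real q) * (D * (\<phi> * sqrt (G * s)))" using main by simp
  then have "\<phi> * (m0 / 8 * G) \<le> \<phi> * (sqrt (real q) * (D * sqrt (G * s)))" by (simp add: mult_ac)
  then have "m0 / 8 * G \<le> sqrt (real q) * (D * sqrt (G * s))" using phi(3) by (rule mult_left_le_imp_le)
  moreover have "M / 16 * G \<le> m0 / 8 * G" using m0 G0 by (intro mult_right_mono) auto
  ultimately have "M / 16 * G \<le> sqrt (real q) * (D * (sqrt G * sqrt s))"
    unfolding real_sqrt_mult by linarith
  moreover have "sqrt G * sqrt G = G" using G0 by simp
  ultimately have "M / 16 * (sqrt G * sqrt G) \<le> sqrt (real q) * (D * (sqrt G * sqrt s))" by simp
  then have "sqrt G * (M / 16 * sqrt G) \<le> sqrt G * (sqrt (real q) * D * sqrt s)" by (simp add: mult_ac)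
  then have MG: "M / 16 * sqrt G \<le> sqrt (real q) * D * sqrt s"
    by (rule mult_left_le_imp_le) (use G0 in simp)
  have "sqrt (N / 18 * E\<^sup>2 * s) \<le> sqrt G" using res by (simp add: G_def s_def)
  moreover have "sqrt (N / 18 * E\<^sup>2 * s) = sqrt (N / 18) * E * sqrt s"
    unfolding real_sqrt_mult using E by simp
  ultimately have "sqrt (N / 18) * E * sqrt s \<le> sqrt G" by linarith
  then have "M / 16 * (sqrt (N / 18) * E * sqrt s) \<le> sqrt (real q) * D * sqrt s"
    using MG M2 mult_left_mono[of "sqrt (N / 18) * E * sqrt s" "sqrt G" "M / 16"] by linarith
  then have "M / 16 * (sqrt (N / 18) * E) * sqrt s \<le> sqrt (real q) * D * sqrt s" by (simp add: mult_ac)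
  then have ME: "M / 16 * (sqrt (N / 18) * E) \<le> sqrt (real q) * D"
    by (rule mult_right_le_imp_le) (use s in simp)
  have "sqrt M * E * (sqrt (real q) / 80) \<le> M / 16 * (sqrt (N / 18) * E)"
  proof -
    have s18: "sqrt 18 \<le> (5::real)" by (rule real_le_lsqrt) auto
    have "sqrt (real q) = sqrt M * sqrt N" using N by (simp add: M_def flip: real_sqrt_mult)
    then have "sqrt M * E * (sqrt (real q) / 80) = (sqrt M * sqrt M) / 16 * (sqrt N / 5 * E)" by simp
    also have "sqrt M * sqrt M = M" using M2 by simp
    also have "M / 16 * (sqrt N / 5 * E) \<le> M / 16 * (sqrt N / sqrt 18 * E)"
      using s18 E M2 N by (intro mult_left_mono mult_right_mono divide_left_mono) auto
    finally show ?thesis by (simp add: real_sqrt_divide)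
  qed
  then have "sqrt (real q) * (sqrt M * E / 80) \<le> sqrt (real q) * D" using ME by (simp add: mult_ac)
  then have "sqrt M * E / 80 \<le> D" by (rule mult_left_le_imp_le) (use q in simp)
  then show ?thesis by (simp add: M_def D_def)
qed

lemma long_range_conditions:
  fixes delta eps :: real
  assumes "delta > 0" "eps > 0"
  shows "\<forall>\<^sub>F q in sequentially. ln (real q) \<ge> 3 \<and> ln (ln (real q)) \<ge> 1 \<and> ln (ln (ln (real q))) \<ge> 0 \<and> eps / 4 * ln (real q) \<ge> ln 4 \<and>
     sqrt (ln (real q) * ln (ln (real q))) * ln (ln (ln (real q))) \<ge> 6 \<and>
     2 \<le> sqrt (eps * ln (real q) / (2 * ln (ln (real q)))) \<and>
     8 \<le> delta / 2 * sqrt (eps * ln (real q) / (2 * ln (ln (real q))))"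
  using assms by (intro eventually_conj; real_asymp)

theorem Delta_long_ge:
  fixes delta eps :: real
  assumes delta: "0 < delta" "delta \<le> 1" and eps: "0 < eps"
  shows "\<forall>\<^sub>F q in sequentially. prime q \<longrightarrow> (\<forall>N > 0. eps * ln (real q) \<le> ln (real q / N) \<and>
     4 * sqrt (ln (real q) * ln (ln (real q))) * ln (ln (ln (real q))) < ln N \<longrightarrow>
     sqrt (real q / N) * exp ((1 - delta) * sqrt (ln (real q / N) / (2 * ln (ln (real q))))) \<le> Delta (real q / N) q)"
proof -
  \<comment> \<open>\<open>ln X\<close> will be \<open>ln (q / N) / 2 - ln 4\<close>, of which
    \<open>eps / 4 * ln q\<close> is certain to remain.\<close>
  have d2: "0 < delta / 2" "delta / 2 \<le> 1" "0 < eps / 4" using delta eps by auto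
  show ?thesis
    using resonator_exists[OF d2] long_range_conditions[OF delta(1) eps]
  proof eventually_elim
    case (elim q)
    define L where "L = ln (real q)"
    define U where "U = ln L"
    have L: "L \<ge> 3" "U \<ge> 1" "ln U \<ge> 0" "eps / 4 * L \<ge> ln 4" "sqrt (L * U) * ln U \<ge> 6"
      "2 \<le> sqrt (eps * L / (2 * U))" "8 \<le> delta / 2 * sqrt (eps * L / (2 * U))"
      using elim by (auto simp: L_def U_def)
    have "real q > 0" using L(1) by (cases "q = 0") (auto simp: L_def)
    then have "exp 3 \<le> real q" using L(1) by (simp add: L_def ln_ge_iff)
    then have q: "real q > 2" using exp_ge_add_one_self[of 3] by linarith
    show ?case unfolding L_def[symmetric] U_def[symmetric]
    proof (intro impI allI)
      fix N :: real
      assume prime: "prime q" and N0: "N > 0" and "eps * L \<le> ln (real q / N) \<and> 4 * sqrt (L * U) * ln U < ln N"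
      then have N: "eps * L \<le> ln (real q / N)" "4 * (sqrt (L * U) * ln U) < ln N" by auto
      define M where "M = real q / N"
      \<comment> \<open>Turns \<open>16 * X^2 * N \<le> q\<close> into an equality, the largest
        resonator that \<open>Re_gauss_moment_ge\<close> admits.\<close>
      define X where "X = sqrt M / 4"
      define \<Lambda> where "\<Lambda> = sqrt (ln M / (2 * U))"
      define \<Lambda>' where "\<Lambda>' = sqrt (ln X / U)"
      have M: "M > 0" "ln M = L - ln N" using N0 q by (simp_all add: M_def L_def ln_div)
      have eL: "eps * L > 0" using eps L(1) by simp
      have lnX: "ln X = ln M / 2 - ln 4" using M by (simp add: X_def ln_div ln_sqrt)
      have X0: "X > 0" using M by (simp add: X_def)
      have lnX_ge: "eps / 4 * L \<le> ln X" "ln X \<le> L"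
      proof -
        show "eps / 4 * L \<le> ln X" using lnX N(1) L(4) unfolding M_def[symmetric] by linarith
        have "ln (4::real) \<ge> 0" by simp
        moreover have "ln N \<ge> 0" using N(2) L(5) by linarith
        ultimately show "ln X \<le> L" using lnX M(2) L(1) by linarith
      qed
      then have X1: "X \<ge> 1" using X0 eL ln_ge_zero_iff[of X] by linarith
      have X2: "16 * X\<^sup>2 * N \<le> real q" using M N0 by (simp add: X_def power_divide) (simp add: M_def)
      have N256: "256 \<le> N"
      proof -
        have "ln N \<ge> 8" using N(2) L(5) by linarith
        then have "exp 8 \<le> N" using N0 by (simp add: ln_ge_iff)
        moreover have "(2::real) ^ 8 \<le> exp 1 ^ 8" using exp_ge_add_one_self[of 1] by (intro power_mono) auto
        moreover have "exp (1::real) ^ 8 = exp 8" by (simp flip: exp_of_nat_mult)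
        ultimately show ?thesis by simp
      qed
      have "ln N \<le> ln (real q)" using N(1) eL M(2) unfolding M_def[symmetric] L_def by linarith
      then have Nq: "N \<le> real q" using N0 q by simp
      have lnH: "sqrt (L * U) * ln U \<le> ln (N / 18)"
      proof -
        have "ln (18::real) \<le> 17" using ln_le_minus_one[of "18::real"] by simp
        then show ?thesis using N(2) L(5) N0 by (simp add: ln_div)
      qed
      obtain S where S: "finite S" "S \<noteq> {}" "\<And>n. n \<in> S \<Longrightarrow> n > 0 \<and> real n \<le> X \<and> coprime n q"
        and ratio: "\<And>n1 n2. n1 \<in> S \<Longrightarrow> n2 \<in> S \<Longrightarrow> real n1 \<le> 3 * real n2"
        and res: "N / 18 * exp (2 * (1 - delta / 2) * \<Lambda>') * (\<Sum>n\<in>S. 1 / real n) \<le> resonance q (N / 18) S"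
      proof -
        have "0 < X \<and> eps / 4 * L \<le> ln X \<and> ln X \<le> L \<and> 0 < N / 18 \<and> N / 18 \<le> real q \<and> sqrt (L * U) * ln U \<le> ln (N / 18)"
          using X0 lnX_ge N0 Nq lnH by simp
        from elim(1)[folded L_def, folded U_def, rule_format, OF this] that
        show thesis unfolding \<Lambda>'_def resonator_set_def by (elim exE conjE) simp
      qed
      define E where "E = exp ((1 - delta / 2) * \<Lambda>')"
      have E2: "E\<^sup>2 = exp (2 * (1 - delta / 2) * \<Lambda>')" by (simp add: E_def exp_double[symmetric])
      have resE: "N / 18 * E\<^sup>2 * (\<Sum>n\<in>S. 1 / real n) \<le> resonance q (N / 18) S" unfolding E2 by (rule res)
      have "sqrt (real q / N) * E \<le> 80 * Delta (real q / N) q"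
        by (rule Delta_long_core[OF prime _ S ratio N256 Nq X1 X2 resE]) (use q in \<open>simp_all add: E_def\<close>)
      \<comment> \<open>Half of \<open>delta\<close> is worth at least 8 in the exponent: at most 1
        pays for \<open>ln 4\<close> in \<open>ln X\<close>, through
        \<open>\<Lambda> - 1 \<le> \<Lambda>'\<close>, and the remaining 7 for the constant
        80.\<close>
      moreover have "80 * exp ((1 - delta) * \<Lambda>) \<le> E"
      proof -
        have "sqrt (eps * L / (2 * U)) \<le> \<Lambda>" unfolding \<Lambda>_def M_def using N(1) L(2) by (simp add: divide_right_mono)
        moreover from this have "delta / 2 * sqrt (eps * L / (2 * U)) \<le> delta / 2 * \<Lambda>"
          using delta by (intro mult_left_mono) auto
        ultimately have La: "2 \<le> \<Lambda>" "8 \<le> delta / 2 * \<Lambda>" using L(6,7) by linarith+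
        have La2: "\<Lambda>\<^sup>2 = ln M / (2 * U)"
        proof -
          have "ln M \<ge> 0" using N(1) eL unfolding M_def by linarith
          then show ?thesis using L(2) by (simp add: \<Lambda>_def)
        qed
        have "\<Lambda> - 1 \<le> \<Lambda>'"
          unfolding \<Lambda>'_def
        proof (rule real_le_rsqrt)
          have "ln (4::real) \<le> 3" using ln_le_minus_one[of "4::real"] by simp
          then have "ln 4 / U \<le> 3" using L(2) by (simp add: pos_divide_le_eq)
          moreover have "ln X / U = \<Lambda>\<^sup>2 - ln 4 / U" unfolding La2 lnX by (simp add: diff_divide_distrib)
          moreover have "(\<Lambda> - 1)\<^sup>2 = \<Lambda>\<^sup>2 - 2 * \<Lambda> + 1" by (simp add: power2_eq_square algebra_simps)
          ultimately show "(\<Lambda> - 1)\<^sup>2 \<le> ln X / U" using La(1) by linarith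
        qed
        then have "(1 - delta / 2) * (\<Lambda> - 1) \<le> (1 - delta / 2) * \<Lambda>'" using delta by (intro mult_left_mono) auto
        moreover have "(1 - delta / 2) * (\<Lambda> - 1) = (1 - delta) * \<Lambda> + delta / 2 * \<Lambda> - (1 - delta / 2)"
          by (simp add: field_simps)
        ultimately have "7 + (1 - delta) * \<Lambda> \<le> (1 - delta / 2) * \<Lambda>'" using La(2) delta by linarith
        then have "exp 7 * exp ((1 - delta) * \<Lambda>) \<le> E" unfolding E_def exp_add[symmetric] by simp
        moreover have "(80::real) \<le> exp 7"
        proof -
          have "(2::real) ^ 7 \<le> exp 1 ^ 7" using exp_ge_add_one_self[of 1] by (intro power_mono) auto
          moreover have "exp (1::real) ^ 7 = exp 7" by (simp flip: exp_of_nat_mult)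
          ultimately show ?thesis by simp
        qed
        then have "80 * exp ((1 - delta) * \<Lambda>) \<le> exp 7 * exp ((1 - delta) * \<Lambda>)" by (intro mult_right_mono) auto
        ultimately show ?thesis by linarith
      qed
      then have "sqrt (real q / N) * (80 * exp ((1 - delta) * \<Lambda>)) \<le> sqrt (real q / N) * E"
        using N0 q by (intro mult_left_mono) auto
      ultimately have "sqrt (real q / N) * exp ((1 - delta) * \<Lambda>) \<le> Delta (real q / N) q" by linarith
      then show "sqrt (real q / N) * exp ((1 - delta) * sqrt (ln (real q / N) / (2 * U))) \<le> Delta (real q / N) q"
        by (simp add: \<Lambda>_def M_def)
    qed
  qed
qed

section \<open>Conclusion\<close>

text \<open>\<open>A q\<close> indexes the losses \<open>1 / Suc m\<close> admissible at
  \<open>q\<close>, and the smallest of these is chosen. The cutoff \<open>m \<le> q\<close> makes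
  the set finite, and yet each fixed \<open>m\<close> belongs to it eventually, which drives the
  choice to 0.\<close>

lemma diagonal_sequence:
  fixes Q :: "real \<Rightarrow> nat \<Rightarrow> bool"
  assumes "\<And>d. 0 < d \<Longrightarrow> d \<le> 1 \<Longrightarrow> \<forall>\<^sub>F q in sequentially. Q d q"
  shows "\<exists>d :: nat \<Rightarrow> real. d \<longlonglongrightarrow> 0 \<and> (\<forall>\<^sub>F q in sequentially. Q (d q) q)"
proof -
  define A where "A q = {m. m \<le> q \<and> Q (1 / real (Suc m)) q}" for q
  define d where "d q = 1 / real (Suc (Max (A q)))" for q
  have fin: "finite (A q)" for q by (rule finite_subset[of _ "{..q}"]) (auto simp: A_def)
  have ev: "\<forall>\<^sub>F q in sequentially. M \<in> A q" for M
  proof -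
    have "\<forall>\<^sub>F q in sequentially. Q (1 / real (Suc M)) q" by (rule assms) auto
    with eventually_ge_at_top[of M] show ?thesis by eventually_elim (simp add: A_def)
  qed
  have "\<forall>\<^sub>F q in sequentially. Q (d q) q"
    using ev[of 0]
  proof eventually_elim
    case (elim q)
    then have "Max (A q) \<in> A q" using fin by (intro Max_in) auto
    then show ?case by (simp add: A_def d_def)
  qed
  moreover have "d \<longlonglongrightarrow> 0"
  proof (rule tendstoI)
    fix e :: real assume "e > 0"
    then obtain M where M: "1 / real (Suc M) < e" using nat_approx_posE by blast
    show "\<forall>\<^sub>F q in sequentially. dist (d q) 0 < e"
      using ev[of M]
    proof eventually_elim
      case (elim q)
      then have "M \<le> Max (A q)" using fin by (intro Max_ge) auto
      then have "d q \<le> 1 / real (Suc M)" unfolding d_def by (intro divide_left_mono) auto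
      then show ?case using M by (simp add: d_def)
    qed
  qed
  ultimately show ?thesis by blast
qed

theorem theorem4:
  fixes eps :: real
  assumes "eps > 0"
  shows "\<exists>eta :: nat \<Rightarrow> real. eta \<longlonglongrightarrow> 0 \<and>
    (\<forall>\<^sub>F q in sequentially. \<forall>N :: real.
       (let theta = ln N / ln (real q) in
        theta < 1 - eps \<and>
        4 * sqrt (ln (real q) * ln (ln (real q))) * ln (ln (ln (real q))) < ln N \<longrightarrow>
          Delta N q \<ge> sqrt N * exp ((1 + eta q) *
             sqrt ((1 - theta) * ln (real q) / ln (ln (real q))))
          \<and> (prime q \<longrightarrow>
             Delta (real q / N) q \<ge> sqrt (real q / N) * exp ((1 + eta q) *
               sqrt ((1 - theta) * ln (real q) / (2 * ln (ln (real q))))))))"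
proof -
  \<comment> \<open>Both bounds, for all \<open>N\<close>, share one fixed loss \<open>d\<close>, so
    the diagonal choice yields a single error sequence \<open>- d q\<close> that is uniform in
    \<open>N\<close>.\<close>
  define Q where "Q d q \<longleftrightarrow> (\<forall>N :: real.
       (let theta = ln N / ln (real q) in
        theta < 1 - eps \<and>
        4 * sqrt (ln (real q) * ln (ln (real q))) * ln (ln (ln (real q))) < ln N \<longrightarrow>
          Delta N q \<ge> sqrt N * exp ((1 + - d) *
             sqrt ((1 - theta) * ln (real q) / ln (ln (real q))))
          \<and> (prime q \<longrightarrow>
             Delta (real q / N) q \<ge> sqrt (real q / N) * exp ((1 + - d) *
               sqrt ((1 - theta) * ln (real q) / (2 * ln (ln (real q))))))))" for d q
  have "\<forall>\<^sub>F q in sequentially. Q d q" if d: "0 < d" "d \<le> 1" for d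
  proof -
    have "\<forall>\<^sub>F q in sequentially. ln (real q) > 1" by real_asymp
    with Delta_short_ge[OF d assms] Delta_long_ge[OF d assms] show ?thesis
    proof eventually_elim
      case (elim q)
      have q: "real q > 0" using elim(3) by (cases "q = 0") auto
      show ?case unfolding Q_def Let_def
      proof (rule allI, rule impI)
        fix N :: real
        assume N: "ln N / ln (real q) < 1 - eps \<and>
          4 * sqrt (ln (real q) * ln (ln (real q))) * ln (ln (ln (real q))) < ln N"
        show "Delta N q \<ge> sqrt N * exp ((1 + - d) * sqrt ((1 - ln N / ln (real q)) * ln (real q) / ln (ln (real q))))
          \<and> (prime q \<longrightarrow> Delta (real q / N) q \<ge> sqrt (real q / N) *
               exp ((1 + - d) * sqrt ((1 - ln N / ln (real q)) * ln (real q) / (2 * ln (ln (real q))))))"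
        proof (cases "N > 0")
          case True
          have eq: "(1 - ln N / ln (real q)) * ln (real q) = ln (real q / N)"
          proof -
            have "ln (real q) \<noteq> 0" using elim(3) by linarith
            then show ?thesis using True q by (simp add: ln_div left_diff_distrib)
          qed
          have "eps * ln (real q) \<le> ln (real q / N)"
            unfolding eq[symmetric] using N elim(3) by (intro mult_right_mono) auto
          then show ?thesis unfolding eq using elim(1,2) N True by simp
        next
          case False
          \<comment> \<open>\<open>ln\<close> is even on the reals, so negative \<open>N\<close> can satisfy the hypotheses;
            there \<open>sqrt\<close> is negative and the bounds are trivial.\<close>
          then have "sqrt N \<le> 0" "sqrt (real q / N) \<le> 0" using q by (simp_all add: divide_le_0_iff)
          then have "sqrt N * exp x \<le> 0" "sqrt (real q / N) * exp x \<le> 0" for x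
            by (simp_all add: mult_nonpos_nonneg)
          then show ?thesis using elim(1) order_trans by blast
        qed
      qed
    qed
  qed
  from diagonal_sequence[of Q, OF this] obtain d
    where d: "d \<longlonglongrightarrow> 0" "\<forall>\<^sub>F q in sequentially. Q (d q) q" by blast
  have "(\<lambda>q. - d q) \<longlonglongrightarrow> 0" using tendsto_minus[OF d(1)] by simp
  with d(2) show ?thesis unfolding Q_def by (intro exI[of _ "\<lambda>q. - d q"]) blast
qed

end
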